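(* Suppose $F:\mathsf{Disk}_{1,\mathsf{or}}^{\coprod}\to \mathsf{Vect}_{\Bbbk}^{\otimes_{\Bbbk}}$ is a symmetric monoidal functor such that if $j$ and $j'$ are isotopic embeddings, then $F(j)=F(j')$. Then the data of $F$ is equivalent to the data of a unital associative $\Bbbk$-algebra.
   Context: $\Bbbk$ is a fixed field. $\mathsf{Disk}_{1,\mathsf{or}}$ is the ordinary category whose objects are finite (possibly empty) disjoint unions of oriented 1-dimensional open disks (up to isomorphism, $\emptyset$, $\mathbb{R}$, $\mathbb{R}\coprod\mathbb{R}$, and so on), and whose morphisms $X\to Y$ are all smooth embeddings $X\hookrightarrow Y$ respecting orientations. The superscript $\coprod$ indicates that it is regarded as a symmetric monoidal category under disjoint union, with unit $\emptyset$. Two embeddings $X\to Y$ are isotopic if they are connected by a smooth isotopy through orientation-respecting smooth embeddings. $\mathsf{Vect}_{\Bbbk}^{\otimes_{\Bbbk}}$ is the category of $\Bbbk$-vector spaces, regarded as a symmetric monoidal category under the usual tensor product over $\Bbbk$. A symmetric monoidal functor is a functor equipped with coherent natural isomorphisms $F(X\coprod Y)\cong F(X)\otimes_{\Bbbk}F(Y)$ and $F(\emptyset)\cong \Bbbk$, compatible with the swap isomorphisms. *)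

theory Defs
  imports "HOL-Analysis.Analysis" "HOL-Algebra.AbelCoset" "HOL-Algebra.Module"
begin

section \<open>Categories and equivalences of categories\<close>

text \<open>
  Arrows are compared by HOL equality.  The hom-sets of different pairs of objects may overlap, so
  the arrow part of a functor also takes the source and the target, and composition takes the
  source: \<open>Comp C a g f\<close> is the composite of \<open>f : a \<rightarrow> b\<close> followed by \<open>g : b \<rightarrow> c\<close>.
\<close>

record ('o, 'm) cat =
  Obj :: "'o set"
  Arr :: "'o \<Rightarrow> 'o \<Rightarrow> 'm set"
  Ident :: "'o \<Rightarrow> 'm"
  Comp :: "'o \<Rightarrow> 'm \<Rightarrow> 'm \<Rightarrow> 'm"

definition is_category :: "('o, 'm) cat \<Rightarrow> bool" where
  "is_category C \<longleftrightarrow>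
     (\<forall>a\<in>Obj C. Ident C a \<in> Arr C a a) \<and>
     (\<forall>a\<in>Obj C. \<forall>b\<in>Obj C. \<forall>c\<in>Obj C. \<forall>f\<in>Arr C a b. \<forall>g\<in>Arr C b c.
        Comp C a g f \<in> Arr C a c) \<and>
     (\<forall>a\<in>Obj C. \<forall>b\<in>Obj C. \<forall>f\<in>Arr C a b.
        Comp C a f (Ident C a) = f \<and> Comp C a (Ident C b) f = f) \<and>
     (\<forall>a\<in>Obj C. \<forall>b\<in>Obj C. \<forall>c\<in>Obj C. \<forall>d\<in>Obj C.
        \<forall>f\<in>Arr C a b. \<forall>g\<in>Arr C b c. \<forall>h\<in>Arr C c d.
        Comp C a h (Comp C a g f) = Comp C a (Comp C b h g) f)"

definition is_functor ::
  "('o, 'm) cat \<Rightarrow> ('p, 'n) cat \<Rightarrow> ('o \<Rightarrow> 'p) \<Rightarrow> ('o \<Rightarrow> 'o \<Rightarrow> 'm \<Rightarrow> 'n) \<Rightarrow> bool" where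
  "is_functor C D fo fm \<longleftrightarrow>
     (\<forall>a\<in>Obj C. fo a \<in> Obj D) \<and>
     (\<forall>a\<in>Obj C. \<forall>b\<in>Obj C. \<forall>f\<in>Arr C a b. fm a b f \<in> Arr D (fo a) (fo b)) \<and>
     (\<forall>a\<in>Obj C. fm a a (Ident C a) = Ident D (fo a)) \<and>
     (\<forall>a\<in>Obj C. \<forall>b\<in>Obj C. \<forall>c\<in>Obj C. \<forall>f\<in>Arr C a b. \<forall>g\<in>Arr C b c.
        fm a c (Comp C a g f) = Comp D (fo a) (fm b c g) (fm a b f))"

definition is_iso :: "('o, 'm) cat \<Rightarrow> 'o \<Rightarrow> 'o \<Rightarrow> 'm \<Rightarrow> bool" where
  "is_iso C a b u \<longleftrightarrow> u \<in> Arr C a b \<and>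
     (\<exists>v\<in>Arr C b a. Comp C a v u = Ident C a \<and> Comp C b u v = Ident C b)"

definition is_nat_iso ::
  "('o, 'm) cat \<Rightarrow> ('p, 'n) cat \<Rightarrow> ('o \<Rightarrow> 'p) \<Rightarrow> ('o \<Rightarrow> 'o \<Rightarrow> 'm \<Rightarrow> 'n) \<Rightarrow>
    ('o \<Rightarrow> 'p) \<Rightarrow> ('o \<Rightarrow> 'o \<Rightarrow> 'm \<Rightarrow> 'n) \<Rightarrow> ('o \<Rightarrow> 'n) \<Rightarrow> bool" where
  "is_nat_iso C D fo fm go gm \<eta> \<longleftrightarrow>
     (\<forall>a\<in>Obj C. is_iso D (fo a) (go a) (\<eta> a)) \<and>
     (\<forall>a\<in>Obj C. \<forall>b\<in>Obj C. \<forall>f\<in>Arr C a b.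
        Comp D (fo a) (gm a b f) (\<eta> a) = Comp D (fo a) (\<eta> b) (fm a b f))"

definition is_equivalence ::
  "('o, 'm) cat \<Rightarrow> ('p, 'n) cat \<Rightarrow> ('o \<Rightarrow> 'p) \<Rightarrow> ('o \<Rightarrow> 'o \<Rightarrow> 'm \<Rightarrow> 'n) \<Rightarrow> bool" where
  "is_equivalence C D fo fm \<longleftrightarrow>
     is_category C \<and> is_category D \<and> is_functor C D fo fm \<and>
     (\<exists>go gm \<eta> \<epsilon>. is_functor D C go gm \<and>
        is_nat_iso C C (\<lambda>a. a) (\<lambda>a b f. f)
          (\<lambda>a. go (fo a)) (\<lambda>a b f. gm (fo a) (fo b) (fm a b f)) \<eta> \<and>
        is_nat_iso D D (\<lambda>x. fo (go x)) (\<lambda>x y u. fm (go x) (go y) (gm x y u))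
          (\<lambda>x. x) (\<lambda>x y u. u) \<epsilon>)"


section \<open>The category of disjoint unions of oriented 1-dimensional disks\<close>

text \<open>
  \<open>C\<^sup>k\<close> functions on \<open>S\<close>, by iterated directional derivatives.  It is only used for \<open>S = UNIV\<close> and
  \<open>S = UNIV \<times> {0..1}\<close>, where derivatives within \<open>S\<close> are unique.
\<close>

primrec C_diff_on ::
  "nat \<Rightarrow> 'a::real_normed_vector set \<Rightarrow> ('a \<Rightarrow> 'b::real_normed_vector) \<Rightarrow> bool" where
  "C_diff_on 0 S f \<longleftrightarrow> continuous_on S f"
| "C_diff_on (Suc k) S f \<longleftrightarrow>
     (\<exists>f'. (\<forall>x\<in>S. (f has_derivative f' x) (at x within S)) \<and>
           (\<forall>v. C_diff_on k S (\<lambda>x. f' x v)))"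

definition smooth_on :: "'a::real_normed_vector set \<Rightarrow> ('a \<Rightarrow> 'b::real_normed_vector) \<Rightarrow> bool" where
  "smooth_on S f \<longleftrightarrow> (\<forall>k. C_diff_on k S f)"

text \<open>
  An oriented open disk of dimension 1 is a set with a bijective chart onto the real line, from
  which it inherits its smooth structure and its orientation (so composing the chart with negation
  gives the oppositely oriented disk).
\<close>

record 'p disk =
  points :: "'p set"
  chart :: "'p \<Rightarrow> real"

definition oriented_disk :: "'p disk \<Rightarrow> bool" where
  "oriented_disk D \<longleftrightarrow> bij_betw (chart D) (points D) UNIV"

text \<open>
  A list of disks stands for the disjoint union of its members; the point \<open>p\<close> of the \<open>i\<close>-th member
  is the pair \<open>(i, p)\<close>.  Concatenation of lists is then a strictly associative and strictly unital
  disjoint union.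
\<close>

definition pts :: "'p disk list \<Rightarrow> (nat \<times> 'p) set" where
  "pts X = {(i, p). i < length X \<and> p \<in> points (X ! i)}"

definition disk_topology :: "'p disk list \<Rightarrow> (nat \<times> 'p) topology" where
  "disk_topology X = pullback_topology (pts X) (\<lambda>(i, p). (i, chart (X ! i) p)) euclidean"

text \<open>
  A smooth map sends each (connected) component of the source into one component of the target, so
  its coordinate expressions are functions from the real line to itself.
\<close>

definition oriented_immersion :: "'p disk list \<Rightarrow> 'p disk list \<Rightarrow> (nat \<times> 'p \<Rightarrow> nat \<times> 'p) \<Rightarrow> bool" where
  "oriented_immersion X Y j \<longleftrightarrow>
     (\<forall>i<length X. \<exists>k<length Y. \<exists>f :: real \<Rightarrow> real.
        smooth_on UNIV f \<and> (\<forall>t. deriv f t > 0) \<and>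
        (\<forall>p\<in>points (X ! i). fst (j (i, p)) = k \<and>
           chart (Y ! k) (snd (j (i, p))) = f (chart (X ! i) p)))"

definition oriented_embeddings :: "'p disk list \<Rightarrow> 'p disk list \<Rightarrow> (nat \<times> 'p \<Rightarrow> nat \<times> 'p) set" where
  "oriented_embeddings X Y = {j \<in> pts X \<rightarrow>\<^sub>E pts Y.
     oriented_immersion X Y j \<and> embedding_map (disk_topology X) (disk_topology Y) j}"

definition disk_cat :: "('p disk list, nat \<times> 'p \<Rightarrow> nat \<times> 'p) cat" where
  "disk_cat = \<lparr> Obj = {X. \<forall>D\<in>set X. oriented_disk D},
                Arr = oriented_embeddings,
                Ident = (\<lambda>X. restrict (\<lambda>z. z) (pts X)),
                Comp = (\<lambda>X g f. compose (pts X) g f) \<rparr>"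

definition isotopic ::
  "'p disk list \<Rightarrow> 'p disk list \<Rightarrow> (nat \<times> 'p \<Rightarrow> nat \<times> 'p) \<Rightarrow> (nat \<times> 'p \<Rightarrow> nat \<times> 'p) \<Rightarrow> bool" where
  "isotopic X Y j j' \<longleftrightarrow>
     (\<exists>H :: real \<Rightarrow> nat \<times> 'p \<Rightarrow> nat \<times> 'p.
        H 0 = j \<and> H 1 = j' \<and> (\<forall>s\<in>{0..1}. H s \<in> oriented_embeddings X Y) \<and>
        (\<forall>i<length X. \<exists>k<length Y. \<exists>h :: real \<times> real \<Rightarrow> real.
           smooth_on (UNIV \<times> {0..1}) h \<and>
           (\<forall>p\<in>points (X ! i). \<forall>s\<in>{0..1}. fst (H s (i, p)) = k \<and>
              chart (Y ! k) (snd (H s (i, p))) = h (chart (X ! i) p, s))))"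

definition disj_union_map ::
  "'p disk list \<Rightarrow> 'p disk list \<Rightarrow> 'p disk list \<Rightarrow> (nat \<times> 'p \<Rightarrow> nat \<times> 'p) \<Rightarrow>
    (nat \<times> 'p \<Rightarrow> nat \<times> 'p) \<Rightarrow> nat \<times> 'p \<Rightarrow> nat \<times> 'p" where \<comment> \<open>for \<open>j : X \<rightarrow> X'\<close> and \<open>j' : Y \<rightarrow> Y'\<close>\<close>
  "disj_union_map X Y X' j j' = restrict
     (\<lambda>(i, p). if i < length X then j (i, p)
               else (case j' (i - length X, p) of (k, q) \<Rightarrow> (k + length X', q)))
     (pts (X @ Y))"

definition swap_map :: "'p disk list \<Rightarrow> 'p disk list \<Rightarrow> nat \<times> 'p \<Rightarrow> nat \<times> 'p" where
  "swap_map X Y = restrict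
     (\<lambda>(i, p). if i < length X then (i + length Y, p) else (i - length X, p)) (pts (X @ Y))"


section \<open>Vector spaces and their tensor product\<close>

text \<open>
  Vector spaces over the field \<open>K\<close> are modules over \<open>K\<close> in the sense of the library; the fields
  \<open>mult\<close> and \<open>one\<close> of the module record are irrelevant for them.  The type \<open>'v\<close> is the universe
  of vectors.
\<close>

definition linear_maps ::
  "('k, 'm) ring_scheme \<Rightarrow> ('k, 'v, 'r) module_scheme \<Rightarrow> ('k, 'w, 's) module_scheme \<Rightarrow> ('v \<Rightarrow> 'w) set" where
  "linear_maps K V W = {f \<in> carrier V \<rightarrow>\<^sub>E carrier W.
     (\<forall>x\<in>carrier V. \<forall>y\<in>carrier V. f (x \<oplus>\<^bsub>V\<^esub> y) = f x \<oplus>\<^bsub>W\<^esub> f y) \<and>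
     (\<forall>a\<in>carrier K. \<forall>x\<in>carrier V. f (a \<odot>\<^bsub>V\<^esub> x) = a \<odot>\<^bsub>W\<^esub> f x)}"

definition linear_isos ::
  "('k, 'm) ring_scheme \<Rightarrow> ('k, 'v, 'r) module_scheme \<Rightarrow> ('k, 'w, 's) module_scheme \<Rightarrow> ('v \<Rightarrow> 'w) set" where
  "linear_isos K V W = {f \<in> linear_maps K V W. bij_betw f (carrier V) (carrier W)}"

definition vect_cat :: "('k, 'm) ring_scheme \<Rightarrow> (('k, 'v) module, 'v \<Rightarrow> 'v) cat" where
  "vect_cat K = \<lparr> Obj = {V. Module.module K V},
                  Arr = linear_maps K,
                  Ident = (\<lambda>V. restrict (\<lambda>x. x) (carrier V)),
                  Comp = (\<lambda>V g f. compose (carrier V) g f) \<rparr>"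

definition ground_space :: "('k, 'm) ring_scheme \<Rightarrow> ('k, 'k) module" where
  "ground_space K = \<lparr> carrier = carrier K, mult = mult K, one = one K,
                      zero = zero K, add = add K, smult = mult K \<rparr>"

definition free_space :: "('k, 'm) ring_scheme \<Rightarrow> 'b set \<Rightarrow> ('k, 'b \<Rightarrow> 'k) module" where
  "free_space K B =
     \<lparr> carrier = {f. (\<forall>b\<in>B. f b \<in> carrier K) \<and> (\<forall>b. b \<notin> B \<longrightarrow> f b = \<zero>\<^bsub>K\<^esub>) \<and>
                     finite {b. f b \<noteq> \<zero>\<^bsub>K\<^esub>}},
       mult = undefined, one = undefined,
       zero = (\<lambda>_. \<zero>\<^bsub>K\<^esub>),
       add = (\<lambda>f g b. f b \<oplus>\<^bsub>K\<^esub> g b),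
       smult = (\<lambda>a f b. a \<otimes>\<^bsub>K\<^esub> f b) \<rparr>"

definition basis_vec :: "('k, 'm) ring_scheme \<Rightarrow> 'b \<Rightarrow> 'b \<Rightarrow> 'k" where
  "basis_vec K b = (\<lambda>b'. if b' = b then \<one>\<^bsub>K\<^esub> else \<zero>\<^bsub>K\<^esub>)"

definition submodule_span ::
  "('k, 'm) ring_scheme \<Rightarrow> ('k, 'v, 'r) module_scheme \<Rightarrow> 'v set \<Rightarrow> 'v set" where
  "submodule_span K V S = \<Inter>{H. submodule H K V \<and> S \<subseteq> H}"

definition quotient_space ::
  "('k, 'v, 'r) module_scheme \<Rightarrow> 'v set \<Rightarrow> ('k, 'v set) module" where
  "quotient_space V H =
     \<lparr> carrier = a_rcosets\<^bsub>V\<^esub> H,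
       mult = undefined, one = undefined,
       zero = H,
       add = (\<lambda>A B. A <+>\<^bsub>V\<^esub> B),
       smult = (\<lambda>a A. \<Union>x\<in>A. H +>\<^bsub>V\<^esub> (a \<odot>\<^bsub>V\<^esub> x)) \<rparr>"

definition bilinear_relations ::
  "('k, 'm) ring_scheme \<Rightarrow> ('k, 'v) module \<Rightarrow> ('k, 'w) module \<Rightarrow> ('v \<times> 'w \<Rightarrow> 'k) set" where
  "bilinear_relations K V W =
     (let M = free_space K (carrier V \<times> carrier W); e = (\<lambda>v w. basis_vec K (v, w)) in
        {e (v \<oplus>\<^bsub>V\<^esub> v') w \<ominus>\<^bsub>M\<^esub> (e v w \<oplus>\<^bsub>M\<^esub> e v' w) | v v' w.
           v \<in> carrier V \<and> v' \<in> carrier V \<and> w \<in> carrier W} \<union>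
        {e v (w \<oplus>\<^bsub>W\<^esub> w') \<ominus>\<^bsub>M\<^esub> (e v w \<oplus>\<^bsub>M\<^esub> e v w') | v w w'.
           v \<in> carrier V \<and> w \<in> carrier W \<and> w' \<in> carrier W} \<union>
        {e (a \<odot>\<^bsub>V\<^esub> v) w \<ominus>\<^bsub>M\<^esub> a \<odot>\<^bsub>M\<^esub> e v w | a v w.
           a \<in> carrier K \<and> v \<in> carrier V \<and> w \<in> carrier W} \<union>
        {e v (a \<odot>\<^bsub>W\<^esub> w) \<ominus>\<^bsub>M\<^esub> a \<odot>\<^bsub>M\<^esub> e v w | a v w.
           a \<in> carrier K \<and> v \<in> carrier V \<and> w \<in> carrier W})"

definition tensor_relations ::
  "('k, 'm) ring_scheme \<Rightarrow> ('k, 'v) module \<Rightarrow> ('k, 'w) module \<Rightarrow> ('v \<times> 'w \<Rightarrow> 'k) set" where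
  "tensor_relations K V W =
     submodule_span K (free_space K (carrier V \<times> carrier W)) (bilinear_relations K V W)"

definition tensor ::
  "('k, 'm) ring_scheme \<Rightarrow> ('k, 'v) module \<Rightarrow> ('k, 'w) module \<Rightarrow> ('k, ('v \<times> 'w \<Rightarrow> 'k) set) module" where
  "tensor K V W =
     quotient_space (free_space K (carrier V \<times> carrier W)) (tensor_relations K V W)"

definition pure_tensor ::
  "('k, 'm) ring_scheme \<Rightarrow> ('k, 'v) module \<Rightarrow> ('k, 'w) module \<Rightarrow> 'v \<Rightarrow> 'w \<Rightarrow> ('v \<times> 'w \<Rightarrow> 'k) set" where
  "pure_tensor K V W v w =
     tensor_relations K V W +>\<^bsub>free_space K (carrier V \<times> carrier W)\<^esub> basis_vec K (v, w)"


section \<open>Symmetric monoidal functors\<close>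

text \<open>
  \<open>fmu F X Y\<close> is the structure isomorphism from \<open>F X \<otimes> F Y\<close> to the value of \<open>F\<close> at the disjoint
  union of \<open>X\<close> and \<open>Y\<close>, and \<open>feps F\<close> the one from the ground field to the value at the empty union.
\<close>

record ('p, 'k, 'v) sm_functor =
  fobj :: "'p disk list \<Rightarrow> ('k, 'v) module"
  fmor :: "'p disk list \<Rightarrow> 'p disk list \<Rightarrow> (nat \<times> 'p \<Rightarrow> nat \<times> 'p) \<Rightarrow> 'v \<Rightarrow> 'v"
  fmu :: "'p disk list \<Rightarrow> 'p disk list \<Rightarrow> ('v \<times> 'v \<Rightarrow> 'k) set \<Rightarrow> 'v"
  feps :: "'k \<Rightarrow> 'v"

definition fprod ::
  "('k, 'm) ring_scheme \<Rightarrow> ('p, 'k, 'v) sm_functor \<Rightarrow> 'p disk list \<Rightarrow> 'p disk list \<Rightarrow> 'v \<Rightarrow> 'v \<Rightarrow> 'v" where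
  "fprod K F X Y x y = fmu F X Y (pure_tensor K (fobj F X) (fobj F Y) x y)"

text \<open>
  The last five conditions are naturality of \<open>fmu\<close> and its compatibility with the associators, the
  two unitors and the symmetries.  Both sides of these diagrams are linear maps on (iterated) tensor
  products, hence are compared on pure tensors.  Associators and unitors on the side of disks are
  identities.
\<close>

definition is_sm_functor :: "('k, 'm) ring_scheme \<Rightarrow> ('p, 'k, 'v) sm_functor \<Rightarrow> bool" where
  "is_sm_functor K F \<longleftrightarrow>
     is_functor disk_cat (vect_cat K) (fobj F) (fmor F) \<and>
     feps F \<in> linear_isos K (ground_space K) (fobj F []) \<and>
     (\<forall>X\<in>Obj disk_cat. \<forall>Y\<in>Obj disk_cat.
        fmu F X Y \<in> linear_isos K (tensor K (fobj F X) (fobj F Y)) (fobj F (X @ Y))) \<and>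
     (\<forall>X\<in>Obj disk_cat. \<forall>Y\<in>Obj disk_cat. \<forall>X'\<in>Obj disk_cat. \<forall>Y'\<in>Obj disk_cat.
        \<forall>j\<in>Arr disk_cat X X'. \<forall>j'\<in>Arr disk_cat Y Y'.
        \<forall>x\<in>carrier (fobj F X). \<forall>y\<in>carrier (fobj F Y).
          fmor F (X @ Y) (X' @ Y') (disj_union_map X Y X' j j') (fprod K F X Y x y) =
          fprod K F X' Y' (fmor F X X' j x) (fmor F Y Y' j' y)) \<and>
     (\<forall>X\<in>Obj disk_cat. \<forall>Y\<in>Obj disk_cat. \<forall>Z\<in>Obj disk_cat.
        \<forall>x\<in>carrier (fobj F X). \<forall>y\<in>carrier (fobj F Y). \<forall>z\<in>carrier (fobj F Z).
          fprod K F (X @ Y) Z (fprod K F X Y x y) z = fprod K F X (Y @ Z) x (fprod K F Y Z y z)) \<and>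
     (\<forall>X\<in>Obj disk_cat. \<forall>a\<in>carrier K. \<forall>x\<in>carrier (fobj F X).
        fprod K F [] X (feps F a) x = a \<odot>\<^bsub>fobj F X\<^esub> x) \<and>
     (\<forall>X\<in>Obj disk_cat. \<forall>a\<in>carrier K. \<forall>x\<in>carrier (fobj F X).
        fprod K F X [] x (feps F a) = a \<odot>\<^bsub>fobj F X\<^esub> x) \<and>
     (\<forall>X\<in>Obj disk_cat. \<forall>Y\<in>Obj disk_cat.
        \<forall>x\<in>carrier (fobj F X). \<forall>y\<in>carrier (fobj F Y).
          fmor F (X @ Y) (Y @ X) (swap_map X Y) (fprod K F X Y x y) = fprod K F Y X y x)"

definition isotopy_invariant :: "('p, 'k, 'v) sm_functor \<Rightarrow> bool" where
  "isotopy_invariant F \<longleftrightarrow>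
     (\<forall>X\<in>Obj disk_cat. \<forall>Y\<in>Obj disk_cat. \<forall>j\<in>Arr disk_cat X Y. \<forall>j'\<in>Arr disk_cat X Y.
        isotopic X Y j j' \<longrightarrow> fmor F X Y j = fmor F X Y j')"

definition monoidal_transformations ::
  "('k, 'm) ring_scheme \<Rightarrow> ('p, 'k, 'v) sm_functor \<Rightarrow> ('p, 'k, 'v) sm_functor \<Rightarrow>
    ('p disk list \<Rightarrow> 'v \<Rightarrow> 'v) set" where
  "monoidal_transformations K F G = {\<alpha> \<in> extensional (Obj disk_cat).
     (\<forall>X\<in>Obj disk_cat. \<alpha> X \<in> linear_maps K (fobj F X) (fobj G X)) \<and>
     (\<forall>X\<in>Obj disk_cat. \<forall>Y\<in>Obj disk_cat. \<forall>j\<in>Arr disk_cat X Y. \<forall>x\<in>carrier (fobj F X).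
        \<alpha> Y (fmor F X Y j x) = fmor G X Y j (\<alpha> X x)) \<and>
     (\<forall>X\<in>Obj disk_cat. \<forall>Y\<in>Obj disk_cat. \<forall>x\<in>carrier (fobj F X). \<forall>y\<in>carrier (fobj F Y).
        \<alpha> (X @ Y) (fprod K F X Y x y) = fprod K G X Y (\<alpha> X x) (\<alpha> Y y)) \<and>
     (\<forall>a\<in>carrier K. \<alpha> [] (feps F a) = feps G a)}"

definition isotopy_invariant_functor_cat ::
  "('k, 'm) ring_scheme \<Rightarrow> (('p, 'k, 'v) sm_functor, 'p disk list \<Rightarrow> 'v \<Rightarrow> 'v) cat" where
  "isotopy_invariant_functor_cat K =
     \<lparr> Obj = {F. is_sm_functor K F \<and> isotopy_invariant F},
       Arr = monoidal_transformations K,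
       Ident = (\<lambda>F. \<lambda>X\<in>Obj disk_cat. restrict (\<lambda>x. x) (carrier (fobj F X))),
       Comp = (\<lambda>F \<beta> \<alpha>. \<lambda>X\<in>Obj disk_cat. compose (carrier (fobj F X)) (\<beta> X) (\<alpha> X)) \<rparr>"


section \<open>Unital associative algebras\<close>

text \<open>The locale \<open>algebra\<close> of the library is not used, since it requires commutativity.\<close>

definition unital_assoc_algebra :: "('k, 'm) ring_scheme \<Rightarrow> ('k, 'v) module \<Rightarrow> bool" where
  "unital_assoc_algebra K A \<longleftrightarrow> Module.module K A \<and> Ring.ring A \<and>
     (\<forall>a\<in>carrier K. \<forall>x\<in>carrier A. \<forall>y\<in>carrier A.
        (a \<odot>\<^bsub>A\<^esub> x) \<otimes>\<^bsub>A\<^esub> y = a \<odot>\<^bsub>A\<^esub> (x \<otimes>\<^bsub>A\<^esub> y) \<and>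
        x \<otimes>\<^bsub>A\<^esub> (a \<odot>\<^bsub>A\<^esub> y) = a \<odot>\<^bsub>A\<^esub> (x \<otimes>\<^bsub>A\<^esub> y))"

definition algebra_cat :: "('k, 'm) ring_scheme \<Rightarrow> (('k, 'v) module, 'v \<Rightarrow> 'v) cat" where
  "algebra_cat K =
     \<lparr> Obj = {A. unital_assoc_algebra K A},
       Arr = (\<lambda>A B. {f \<in> linear_maps K A B. f \<in> ring_hom A B}),
       Ident = (\<lambda>A. restrict (\<lambda>x. x) (carrier A)),
       Comp = (\<lambda>A g f. compose (carrier A) g f) \<rparr>"


section \<open>The algebra of a functor\<close>

text \<open>
  The embedding of two copies of \<open>D\<close> into \<open>D\<close> that puts the first copy to the left of the second:
  in coordinates, \<open>t \<mapsto> - exp (- t)\<close> on the first copy and \<open>exp\<close> on the second.  The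
  unit is the image of \<open>1\<close> under the embedding of the empty union, which is \<open>\<lambda>_. undefined\<close> because
  arrows are extensional.
\<close>

definition fold_embedding :: "'p disk \<Rightarrow> nat \<times> 'p \<Rightarrow> nat \<times> 'p" where
  "fold_embedding D = restrict
     (\<lambda>(i, p). (0, inv_into (points D) (chart D)
        (if i = 0 then - exp (- chart D p) else exp (chart D p)))) (pts [D, D])"

definition functor_algebra ::
  "('k, 'm) ring_scheme \<Rightarrow> 'p disk \<Rightarrow> ('p, 'k, 'v) sm_functor \<Rightarrow> ('k, 'v) module" where
  "functor_algebra K D F =
     \<lparr> carrier = carrier (fobj F [D]),
       mult = (\<lambda>x y. fmor F [D, D] [D] (fold_embedding D) (fprod K F [D] [D] x y)),
       one = fmor F [] [D] (\<lambda>_. undefined) (feps F \<one>\<^bsub>K\<^esub>),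
       zero = zero (fobj F [D]),
       add = add (fobj F [D]),
       smult = smult (fobj F [D]) \<rparr>"

end

theory Submission
  imports Defs
begin

text \<open>
  Two embeddings of disks are isotopic iff they induce the same map on components and the same order
  on the disks inside every component: in coordinates, the straight line between two such embeddings
  is an isotopy.  Put \<open>A = F [D]\<close>, with the multiplication given by the fold embedding.  The monoidal
  structure makes \<open>F X\<close> a tensor power of \<open>A\<close>, and every embedding is isotopic to a composite of
  unions of swaps, fold embeddings and embeddings of the empty union; hence \<open>F j\<close> sends a pure tensor
  to the tensor of the products of its entries, taken over the fibres of \<open>j\<close> in their order.  This
  formula shows that transformations are the same as homomorphisms of algebras, and, read as a
  definition on tensor powers of a given algebra, it produces a functor.  Since the vector spaces have
  to live in the universe \<open>'v\<close>, tensor powers are transported along an injection that exists by a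
  cardinality argument.
\<close>

section \<open>Equivalences of categories\<close>

text \<open>Two difficulties shape the argument. An arbitrary embedding has to be factored up to
  isotopy, but no explicit factorisation is written down: the property of obeying the product
  formula (\<open>good\<close>) is closed under composition, disjoint union and isotopy, and an
  induction on the number of disks splits off the leftmost one. Embeddings are handled as a map of
  components \<open>\<kappa>\<close> with increasing functions \<open>f\<close>, and the position of
  a disk is read off at the single coordinate \<open>0\<close>; this is enough because the images of
  two disks in one component are disjoint intervals. The other difficulty is that a tensor product
  of spaces over \<open>'v\<close> lives on a different type, so tensor powers cannot be iterated
  literally. They are characterised inside \<open>'v\<close> by a universal property, which fits
  both the values of a given functor and the spaces chosen for a given algebra. Functoriality,
  naturality and monoidality are then checked on generators and extended linearly.\<close>

lemma category_compD:
  assumes "is_category C" "a \<in> Obj C" "b \<in> Obj C" "c \<in> Obj C" "f \<in> Arr C a b" "g \<in> Arr C b c"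
  shows "Comp C a g f \<in> Arr C a c"
  using assms unfolding is_category_def by blast

lemma category_assoc:
  assumes "is_category C" "a \<in> Obj C" "b \<in> Obj C" "c \<in> Obj C" "d \<in> Obj C"
    "f \<in> Arr C a b" "g \<in> Arr C b c" "h \<in> Arr C c d"
  shows "Comp C a (Comp C b h g) f = Comp C a h (Comp C a g f)"
  using assms unfolding is_category_def by metis

lemma category_ident:
  assumes "is_category C" "a \<in> Obj C"
  shows "Ident C a \<in> Arr C a a"
    and "b \<in> Obj C \<Longrightarrow> f \<in> Arr C a b \<Longrightarrow> Comp C a f (Ident C a) = f"
    and "b \<in> Obj C \<Longrightarrow> f \<in> Arr C b a \<Longrightarrow> Comp C b (Ident C a) f = f"
  using assms unfolding is_category_def by blast+

lemma functorD:
  assumes "is_functor C D fo fm" "a \<in> Obj C"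
  shows "fo a \<in> Obj D"
    and "fm a a (Ident C a) = Ident D (fo a)"
    and "b \<in> Obj C \<Longrightarrow> f \<in> Arr C a b \<Longrightarrow> fm a b f \<in> Arr D (fo a) (fo b)"
    and "b \<in> Obj C \<Longrightarrow> c \<in> Obj C \<Longrightarrow> f \<in> Arr C a b \<Longrightarrow> g \<in> Arr C b c \<Longrightarrow>
           fm a c (Comp C a g f) = Comp D (fo a) (fm b c g) (fm a b f)"
  using assms unfolding is_functor_def by blast+

lemma is_isoI:
  assumes "u \<in> Arr C a b" "v \<in> Arr C b a" "Comp C a v u = Ident C a" "Comp C b u v = Ident C b"
  shows "is_iso C a b u"
  using assms unfolding is_iso_def by blast

text \<open>Choice gives every \<open>x\<close> an object \<open>go x\<close> with an isomorphism
  \<open>e x\<close> from \<open>fo (go x)\<close> to \<open>x\<close>; an arrow is conjugated by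
  these isomorphisms and lifted along the full functor. Equations in \<open>C\<close> are checked
  after applying the functor, equations in \<open>D\<close> after composing with \<open>e\<close>.
  In the theorem this spares an explicit inverse functor: one functor for each algebra is
  enough.\<close>

lemma is_equivalenceI:
  assumes C: "is_category C" and D: "is_category D" and F: "is_functor C D fo fm"
    and faithful: "\<And>a b f g. \<lbrakk>a \<in> Obj C; b \<in> Obj C; f \<in> Arr C a b; g \<in> Arr C a b;
                     fm a b f = fm a b g\<rbrakk> \<Longrightarrow> f = g"
    and full: "\<And>a b h. \<lbrakk>a \<in> Obj C; b \<in> Obj C; h \<in> Arr D (fo a) (fo b)\<rbrakk> \<Longrightarrow> \<exists>f\<in>Arr C a b. fm a b f = h"
    and ess: "\<And>x. x \<in> Obj D \<Longrightarrow> \<exists>a\<in>Obj C. \<exists>u. is_iso D (fo a) x u"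
  shows "is_equivalence C D fo fm"
proof -
  have "\<forall>x\<in>Obj D. \<exists>a u v. a \<in> Obj C \<and> u \<in> Arr D (fo a) x \<and> v \<in> Arr D x (fo a) \<and>
          Comp D (fo a) v u = Ident D (fo a) \<and> Comp D x u v = Ident D x"
    using ess unfolding is_iso_def by blast
  then obtain go e e' where ge: "\<forall>x\<in>Obj D. go x \<in> Obj C \<and> e x \<in> Arr D (fo (go x)) x \<and>
      e' x \<in> Arr D x (fo (go x)) \<and> Comp D (fo (go x)) (e' x) (e x) = Ident D (fo (go x)) \<and>
      Comp D x (e x) (e' x) = Ident D x"
    by metis
  have fo: "fo a \<in> Obj D" if "a \<in> Obj C" for a using functorD(1)[OF F that] .
  have go: "go x \<in> Obj C" and fgo: "fo (go x) \<in> Obj D"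
    and e: "e x \<in> Arr D (fo (go x)) x" and e': "e' x \<in> Arr D x (fo (go x))"
    and e'e: "Comp D (fo (go x)) (e' x) (e x) = Ident D (fo (go x))"
    and ee': "Comp D x (e x) (e' x) = Ident D x" if "x \<in> Obj D" for x
    using ge that fo by blast+
  note ids = category_ident[OF D]
  define pre where "pre a b h = (SOME f. f \<in> Arr C a b \<and> fm a b f = h)" for a b h
  have pre: "pre a b h \<in> Arr C a b" "fm a b (pre a b h) = h"
    if "a \<in> Obj C" "b \<in> Obj C" "h \<in> Arr D (fo a) (fo b)" for a b h
    using someI_ex[of "\<lambda>f. f \<in> Arr C a b \<and> fm a b f = h"] full[OF that] unfolding pre_def by blast+
  define conj where "conj x y u = Comp D (fo (go x)) (e' y) (Comp D (fo (go x)) u (e x))" for x y u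
  define gm where "gm x y u = pre (go x) (go y) (conj x y u)" for x y u
  have ue: "Comp D (fo (go x)) u (e x) \<in> Arr D (fo (go x)) y"
    if "x \<in> Obj D" "y \<in> Obj D" "u \<in> Arr D x y" for x y u
    using category_compD[OF D fgo _ _ e] that by blast
  have conj: "conj x y u \<in> Arr D (fo (go x)) (fo (go y))"
    if "x \<in> Obj D" "y \<in> Obj D" "u \<in> Arr D x y" for x y u
    unfolding conj_def using category_compD[OF D fgo _ fgo ue e'] that by blast
  have gm: "gm x y u \<in> Arr C (go x) (go y)" "fm (go x) (go y) (gm x y u) = conj x y u"
    if "x \<in> Obj D" "y \<in> Obj D" "u \<in> Arr D x y" for x y u
    unfolding gm_def using pre[OF go go conj] that by blast+
  have e_conj: "Comp D (fo (go x)) (e y) (conj x y u) = Comp D (fo (go x)) u (e x)"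
    if x: "x \<in> Obj D" and y: "y \<in> Obj D" and u: "u \<in> Arr D x y" for x y u
  proof -
    have "Comp D (fo (go x)) (e y) (conj x y u)
        = Comp D (fo (go x)) (Comp D y (e y) (e' y)) (Comp D (fo (go x)) u (e x))"
      unfolding conj_def
      using category_assoc[OF D fgo[OF x] y fgo[OF y] y ue[OF x y u] e'[OF y] e[OF y]] by simp
    also have "\<dots> = Comp D (fo (go x)) u (e x)"
      using ee'[OF y] ids(3)[OF y fgo[OF x] ue[OF x y u]] by simp
    finally show ?thesis .
  qed
  \<comment> \<open>\<open>e x\<close> has the left inverse \<open>e' x\<close>, so it can be
    cancelled.\<close>
  have e_mono: "h = k" if x: "x \<in> Obj D" and z: "z \<in> Obj D"
    and h: "h \<in> Arr D z (fo (go x))" and k: "k \<in> Arr D z (fo (go x))"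
    and eq: "Comp D z (e x) h = Comp D z (e x) k" for x z h k
    using category_assoc[OF D z fgo[OF x] x fgo[OF x] h e[OF x] e'[OF x]]
      category_assoc[OF D z fgo[OF x] x fgo[OF x] k e[OF x] e'[OF x]]
      e'e[OF x] ids(3)[OF fgo[OF x] z] h k eq by metis
  have G: "is_functor D C go gm"
    unfolding is_functor_def
  proof (intro conjI ballI)
    fix x assume x: "x \<in> Obj D"
    show "go x \<in> Obj C" using go[OF x] .
    show "gm x x (Ident D x) = Ident C (go x)"
    proof (rule faithful[OF go[OF x] go[OF x] gm(1)[OF x x ids(1)[OF x]] category_ident(1)[OF C go[OF x]]])
      have "conj x x (Ident D x) = Ident D (fo (go x))"
        unfolding conj_def using ids(3)[OF x fgo[OF x] e[OF x]] e'e[OF x] by simp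
      then show "fm (go x) (go x) (gm x x (Ident D x)) = fm (go x) (go x) (Ident C (go x))"
        using gm(2)[OF x x ids(1)[OF x]] functorD(2)[OF F go[OF x]] by simp
    qed
  next
    fix x y u assume x: "x \<in> Obj D" and y: "y \<in> Obj D" and u: "u \<in> Arr D x y"
    show "gm x y u \<in> Arr C (go x) (go y)" using gm(1)[OF x y u] .
  next
    fix x y z u v assume x: "x \<in> Obj D" and y: "y \<in> Obj D" and z: "z \<in> Obj D"
      and u: "u \<in> Arr D x y" and v: "v \<in> Arr D y z"
    have vu: "Comp D x v u \<in> Arr D x z" using category_compD[OF D x y z u v] .
    have gg: "Comp C (go x) (gm y z v) (gm x y u) \<in> Arr C (go x) (go z)"
      using category_compD[OF C go[OF x] go[OF y] go[OF z] gm(1)[OF x y u] gm(1)[OF y z v]] .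
    have cc: "Comp D (fo (go x)) (conj y z v) (conj x y u) \<in> Arr D (fo (go x)) (fo (go z))"
      using category_compD[OF D fgo[OF x] fgo[OF y] fgo[OF z] conj[OF x y u] conj[OF y z v]] .
    \<comment> \<open>Naturality of \<open>e\<close>, in the form \<open>e_conj\<close>, moves
      \<open>e\<close> past both conjugates; the two candidates agree after \<open>e z\<close> and
      \<open>e_mono\<close> finishes.\<close>
    have "Comp D (fo (go x)) (e z) (Comp D (fo (go x)) (conj y z v) (conj x y u))
        = Comp D (fo (go x)) (Comp D (fo (go y)) v (e y)) (conj x y u)"
      using category_assoc[OF D fgo[OF x] fgo[OF y] fgo[OF z] z conj[OF x y u] conj[OF y z v] e[OF z]]
        e_conj[OF y z v] by simp
    also have "\<dots> = Comp D (fo (go x)) v (Comp D (fo (go x)) u (e x))"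
      using category_assoc[OF D fgo[OF x] fgo[OF y] y z conj[OF x y u] e[OF y] v] e_conj[OF x y u] by simp
    also have "\<dots> = Comp D (fo (go x)) (e z) (conj x z (Comp D x v u))"
      using category_assoc[OF D fgo[OF x] x y z e[OF x] u v] e_conj[OF x z vu] by simp
    finally have "conj x z (Comp D x v u) = Comp D (fo (go x)) (conj y z v) (conj x y u)"
      using e_mono[OF z fgo[OF x] cc conj[OF x z vu]] by simp
    then have "fm (go x) (go z) (gm x z (Comp D x v u)) = fm (go x) (go z) (Comp C (go x) (gm y z v) (gm x y u))"
      using functorD(4)[OF F go[OF x] go[OF y] go[OF z] gm(1)[OF x y u] gm(1)[OF y z v]]
        gm(2)[OF x y u] gm(2)[OF y z v] gm(2)[OF x z vu] by simp
    then show "gm x z (Comp D x v u) = Comp C (go x) (gm y z v) (gm x y u)"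
      by (rule faithful[OF go[OF x] go[OF z] gm(1)[OF x z vu] gg])
  qed
  \<comment> \<open>The unit lifts the inverse isomorphism \<open>e'\<close>; a fully faithful
    functor reflects isomorphisms, and the inverse is the lift of \<open>e\<close>.\<close>
  define eta where "eta a = pre a (go (fo a)) (e' (fo a))" for a
  define eta' where "eta' a = pre (go (fo a)) a (e (fo a))" for a
  have eta: "eta a \<in> Arr C a (go (fo a))" "fm a (go (fo a)) (eta a) = e' (fo a)"
    and eta': "eta' a \<in> Arr C (go (fo a)) a" "fm (go (fo a)) a (eta' a) = e (fo a)" if a: "a \<in> Obj C" for a
    unfolding eta_def eta'_def
    using pre[OF a go[OF fo[OF a]] e'[OF fo[OF a]]] pre[OF go[OF fo[OF a]] a e[OF fo[OF a]]] by simp_all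
  have N1: "is_nat_iso C C (\<lambda>a. a) (\<lambda>a b f. f)
          (\<lambda>a. go (fo a)) (\<lambda>a b f. gm (fo a) (fo b) (fm a b f)) eta"
    unfolding is_nat_iso_def
  proof (intro conjI ballI)
    fix a assume a: "a \<in> Obj C"
    let ?a = "go (fo a)"
    have a2: "?a \<in> Obj C" using go[OF fo[OF a]] .
    show "is_iso C a ?a (eta a)"
    proof (rule is_isoI[OF eta(1)[OF a] eta'(1)[OF a]])
      show "Comp C a (eta' a) (eta a) = Ident C a"
      proof (rule faithful[OF a a])
        show "fm a a (Comp C a (eta' a) (eta a)) = fm a a (Ident C a)"
          using functorD(4)[OF F a a2 a eta(1)[OF a] eta'(1)[OF a]] functorD(2)[OF F a]
            eta(2)[OF a] eta'(2)[OF a] ee'[OF fo[OF a]] by simp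
      qed (use category_compD[OF C a a2 a eta(1)[OF a] eta'(1)[OF a]] category_ident(1)[OF C a] in auto)
      show "Comp C ?a (eta a) (eta' a) = Ident C ?a"
      proof (rule faithful[OF a2 a2])
        show "fm ?a ?a (Comp C ?a (eta a) (eta' a)) = fm ?a ?a (Ident C ?a)"
          using functorD(4)[OF F a2 a a2 eta'(1)[OF a] eta(1)[OF a]] functorD(2)[OF F a2]
            eta(2)[OF a] eta'(2)[OF a] e'e[OF fo[OF a]] by simp
      qed (use category_compD[OF C a2 a a2 eta'(1)[OF a] eta(1)[OF a]] category_ident(1)[OF C a2] in auto)
    qed
  next
    fix a b f assume a: "a \<in> Obj C" and b: "b \<in> Obj C" and f: "f \<in> Arr C a b"
    let ?a = "go (fo a)" and ?b = "go (fo b)" and ?f = "fm a b f"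
    note fa = fo[OF a] and fb = fo[OF b]
    have a2: "?a \<in> Obj C" and b2: "?b \<in> Obj C" using go fa fb by auto
    have f2: "?f \<in> Arr D (fo a) (fo b)" using functorD(3)[OF F a b f] .
    note g = gm[OF fa fb f2]
    show "Comp C a (gm (fo a) (fo b) ?f) (eta a) = Comp C a (eta b) f"
    proof (rule faithful[OF a b2])
      have c1: "Comp D (fo a) (conj (fo a) (fo b) ?f) (e' (fo a)) \<in> Arr D (fo a) (fo ?b)"
        using category_compD[OF D fa fgo[OF fa] fgo[OF fb] e'[OF fa] conj[OF fa fb f2]] .
      have c2: "Comp D (fo a) (e' (fo b)) ?f \<in> Arr D (fo a) (fo ?b)"
        using category_compD[OF D fa fb fgo[OF fb] f2 e'[OF fb]] .
      have "Comp D (fo a) (e (fo b)) (Comp D (fo a) (conj (fo a) (fo b) ?f) (e' (fo a))) =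
            Comp D (fo a) ?f (Comp D (fo a) (e (fo a)) (e' (fo a)))"
        using category_assoc[OF D fa fgo[OF fa] fgo[OF fb] fb e'[OF fa] conj[OF fa fb f2] e[OF fb]]
          category_assoc[OF D fa fgo[OF fa] fa fb e'[OF fa] e[OF fa] f2] e_conj[OF fa fb f2] by simp
      also have "\<dots> = Comp D (fo a) (e (fo b)) (Comp D (fo a) (e' (fo b)) ?f)"
        using category_assoc[OF D fa fb fgo[OF fb] fb f2 e'[OF fb] e[OF fb]] ee'[OF fa] ee'[OF fb]
          ids(2)[OF fa fb f2] ids(3)[OF fb fa f2] by simp
      finally have "Comp D (fo a) (conj (fo a) (fo b) ?f) (e' (fo a)) = Comp D (fo a) (e' (fo b)) ?f"
        using e_mono[OF fb fa c1 c2] by simp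
      then show "fm a ?b (Comp C a (gm (fo a) (fo b) ?f) (eta a)) = fm a ?b (Comp C a (eta b) f)"
        using functorD(4)[OF F a a2 b2 eta(1)[OF a] g(1)] functorD(4)[OF F a b b2 f eta(1)[OF b]]
          g(2) eta(2)[OF a] eta(2)[OF b] by simp
    qed (use category_compD[OF C a a2 b2 eta(1)[OF a] g(1)] category_compD[OF C a b b2 f eta(1)[OF b]] in auto)
  qed
  have N2: "is_nat_iso D D (\<lambda>x. fo (go x)) (\<lambda>x y u. fm (go x) (go y) (gm x y u)) (\<lambda>x. x) (\<lambda>x y u. u) e"
    unfolding is_nat_iso_def
    using is_isoI[OF e e' e'e ee'] gm(2) e_conj by auto
  show ?thesis
    unfolding is_equivalence_def using C D F G N1 N2 by blast
qed

section \<open>Embeddings in coordinates\<close>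

lemma C_diff_on_SucD: "C_diff_on (Suc k) S f \<Longrightarrow> C_diff_on k S f"
proof (induction k arbitrary: f)
  case 0
  then show ?case
    by (metis C_diff_on.simps differentiable_def differentiable_imp_continuous_on differentiable_on_def)
next
  case (Suc k)
  then obtain f' where f': "\<forall>x\<in>S. (f has_derivative f' x) (at x within S)"
    "\<forall>v. C_diff_on (Suc k) S (\<lambda>x. f' x v)" unfolding C_diff_on.simps(2)[of "Suc k"] by blast
  then have "\<forall>v. C_diff_on k S (\<lambda>x. f' x v)" using Suc.IH by blast
  with f'(1) show ?case by auto
qed

lemma C_diff_on_const [simp]: "C_diff_on k S (\<lambda>x. c)"
proof (induction k arbitrary: c)
  case (Suc k)
  have "\<forall>x\<in>S. ((\<lambda>x. c) has_derivative (\<lambda>v. 0)) (at x within S)" by simp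
  then show ?case using Suc.IH[of 0] by (auto intro!: exI[of _ "\<lambda>x v. 0"])
qed simp

lemma C_diff_on_linear: "bounded_linear l \<Longrightarrow> C_diff_on k S l"
proof (cases k)
  case (Suc n)
  assume l: "bounded_linear l"
  have "\<forall>x\<in>S. (l has_derivative l) (at x within S)"
    using bounded_linear.has_derivative[OF l, of "\<lambda>x. x" "\<lambda>x. x"] by auto
  then show ?thesis unfolding Suc by (auto intro!: exI[of _ "\<lambda>x. l"])
qed (auto intro: linear_continuous_on)

lemma C_diff_on_add: "C_diff_on k S f \<Longrightarrow> C_diff_on k S g \<Longrightarrow> C_diff_on k S (\<lambda>x. f x + g x)"
proof (induction k arbitrary: f g)
  case (Suc k)
  obtain f' where f': "\<forall>x\<in>S. (f has_derivative f' x) (at x within S)" "\<forall>v. C_diff_on k S (\<lambda>x. f' x v)"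
    using Suc.prems(1) by auto
  obtain g' where g': "\<forall>x\<in>S. (g has_derivative g' x) (at x within S)" "\<forall>v. C_diff_on k S (\<lambda>x. g' x v)"
    using Suc.prems(2) by auto
  have "\<forall>x\<in>S. ((\<lambda>x. f x + g x) has_derivative (\<lambda>v. f' x v + g' x v)) (at x within S)"
    using f'(1) g'(1) by (auto intro: has_derivative_add)
  then show ?case using Suc.IH f'(2) g'(2) by auto
qed (auto intro: continuous_on_add)

lemma C_diff_on_mult:
  fixes f g :: "'a::real_normed_vector \<Rightarrow> real"
  shows "C_diff_on k S f \<Longrightarrow> C_diff_on k S g \<Longrightarrow> C_diff_on k S (\<lambda>x. f x * g x)"
proof (induction k arbitrary: f g)
  case (Suc k)
  obtain f' where f': "\<forall>x\<in>S. (f has_derivative f' x) (at x within S)" "\<forall>v. C_diff_on k S (\<lambda>x. f' x v)"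
    using Suc.prems(1) by auto
  obtain g' where g': "\<forall>x\<in>S. (g has_derivative g' x) (at x within S)" "\<forall>v. C_diff_on k S (\<lambda>x. g' x v)"
    using Suc.prems(2) by auto
  have "\<forall>x\<in>S. ((\<lambda>x. f x * g x) has_derivative (\<lambda>v. f x * g' x v + f' x v * g x)) (at x within S)"
    using f'(1) g'(1) by (auto intro: has_derivative_mult)
  \<comment> \<open>The Leibniz rule contains the factors themselves; \<open>C_diff_on_SucD\<close>
    brings them down to the order \<open>k\<close> of the induction hypothesis.\<close>
  moreover have "C_diff_on k S (\<lambda>x. f x * g' x v + f' x v * g x)" for v
    using Suc.IH f'(2) g'(2) C_diff_on_SucD[OF Suc.prems(1)] C_diff_on_SucD[OF Suc.prems(2)]
    by (intro C_diff_on_add) auto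
  ultimately show ?case by (auto intro!: exI[of _ "\<lambda>x v. f x * g' x v + f' x v * g x"])
qed (auto intro: continuous_on_mult)

lemma C_diff_on_compose:
  fixes f :: "real \<Rightarrow> real" and g :: "'a::real_normed_vector \<Rightarrow> real"
  shows "C_diff_on k UNIV f \<Longrightarrow> C_diff_on k S g \<Longrightarrow> C_diff_on k S (\<lambda>x. f (g x))"
proof (induction k arbitrary: f g)
  case 0
  then show ?case by (auto intro: continuous_on_compose2)
next
  case (Suc k)
  obtain f' where f': "\<forall>x. (f has_derivative f' x) (at x)" "\<forall>v. C_diff_on k UNIV (\<lambda>x. f' x v)"
    using Suc.prems(1) by auto
  obtain g' where g': "\<forall>x\<in>S. (g has_derivative g' x) (at x within S)" "\<forall>v. C_diff_on k S (\<lambda>x. g' x v)"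
    using Suc.prems(2) by auto
  \<comment> \<open>\<open>C_diff_on\<close> controls derivatives along fixed directions, while the
    chain rule feeds \<open>f'\<close> the moving direction \<open>g' x v\<close>. On the line,
    linearity turns this direction into a factor, so that the derivative of the composite is a
    product.\<close>
  have lin: "f' x v = v * f' x 1" for x v
    using linear.scaleR[OF has_derivative_linear[OF f'(1)[rule_format, of x]], of v 1] by simp
  have "((\<lambda>x. f (g x)) has_derivative (\<lambda>v. g' x v * f' (g x) 1)) (at x within S)" if "x \<in> S" for x
  proof -
    have "(\<lambda>v. f' (g x) (g' x v)) = (\<lambda>v. g' x v * f' (g x) 1)"
      by (rule ext, rule lin)
    then show ?thesis
      using has_derivative_compose[OF g'(1)[rule_format, OF that] f'(1)[rule_format, of "g x"]] by simp
  qed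
  moreover have "C_diff_on k S (\<lambda>x. g' x v * f' (g x) 1)" for v
    using C_diff_on_mult[OF g'(2)[rule_format] Suc.IH[OF f'(2)[rule_format] C_diff_on_SucD[OF Suc.prems(2)]]] .
  ultimately have "(\<forall>x\<in>S. ((\<lambda>x. f (g x)) has_derivative (\<lambda>v. g' x v * f' (g x) 1)) (at x within S)) \<and>
      (\<forall>v. C_diff_on k S (\<lambda>x. g' x v * f' (g x) 1))" by blast
  then show ?case unfolding C_diff_on.simps by (intro exI[of _ "\<lambda>x v. g' x v * f' (g x) 1"])
qed

lemma C_diff_on_exp: "C_diff_on k UNIV (exp :: real \<Rightarrow> real)"
proof (induction k)
  case (Suc k)
  have "(exp has_derivative (\<lambda>v. v * exp x)) (at x)" for x :: real
    by (rule derivative_eq_intros refl | simp)+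
  moreover have "C_diff_on k UNIV (\<lambda>x::real. v * exp x)" for v
    using C_diff_on_mult[OF C_diff_on_const Suc.IH] .
  ultimately show ?case by (auto intro!: exI[of _ "\<lambda>x v. v * exp x"])
qed (auto intro: continuous_on_exp)

section \<open>Orientation preserving embeddings of the line into itself\<close>

definition increasing_smooth :: "(real \<Rightarrow> real) \<Rightarrow> bool" where
  "increasing_smooth f \<longleftrightarrow> smooth_on UNIV f \<and> (\<forall>t. deriv f t > 0)"

lemma increasing_smooth_deriv:
  assumes "increasing_smooth f"
  shows "(f has_real_derivative deriv f t) (at t)" "deriv f t > 0"
proof -
  have "C_diff_on (Suc 0) UNIV f" using assms by (simp add: increasing_smooth_def smooth_on_def del: C_diff_on.simps)
  then have "f differentiable at t" by (auto simp: differentiable_def)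
  then show "(f has_real_derivative deriv f t) (at t)" by (simp add: DERIV_deriv_iff_real_differentiable)
  show "deriv f t > 0" using assms by (simp add: increasing_smooth_def)
qed

lemma increasing_smoothI:
  assumes "\<And>k. C_diff_on k UNIV f" "\<And>t. (f has_real_derivative f' t) (at t)" "\<And>t. f' t > 0"
  shows "increasing_smooth f"
proof -
  have "deriv f t = f' t" for t using DERIV_imp_deriv[OF assms(2)] .
  then show ?thesis using assms(1,3) by (simp add: increasing_smooth_def smooth_on_def)
qed

lemma increasing_smooth_less_iff:
  assumes "increasing_smooth f" shows "f s < f t \<longleftrightarrow> s < t"
proof -
  have "f s < f t" if "s < t" for s t
    using DERIV_pos_imp_increasing[OF that] increasing_smooth_deriv[OF assms] by blast
  then show ?thesis by (metis less_asym linorder_neqE)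
qed

lemma increasing_smooth_eq_iff:
  assumes "increasing_smooth f" shows "f s = f t \<longleftrightarrow> s = t"
  using increasing_smooth_less_iff[OF assms, of s t] increasing_smooth_less_iff[OF assms, of t s]
  by (cases s t rule: linorder_cases) auto

lemma increasing_smooth_continuous: "increasing_smooth f \<Longrightarrow> continuous_on UNIV f"
  by (rule DERIV_continuous_on[where D = "deriv f"])
    (rule has_field_derivative_at_within[OF increasing_smooth_deriv(1)])

lemma increasing_smooth_id: "increasing_smooth (\<lambda>t. t)"
  by (rule increasing_smoothI[where f' = "\<lambda>t. 1"]) (auto intro: C_diff_on_linear bounded_linear_ident)

lemma increasing_smooth_exp: "increasing_smooth exp"
  by (rule increasing_smoothI[where f' = exp]) (auto intro: C_diff_on_exp)

lemma increasing_smooth_minus_exp: "increasing_smooth (\<lambda>t. - exp (- t))"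
proof (rule increasing_smoothI[where f' = "\<lambda>t. exp (- t)"])
  have m: "C_diff_on k UNIV (\<lambda>t::real. - t)" for k
    by (intro C_diff_on_linear bounded_linear_minus bounded_linear_ident)
  show "C_diff_on k UNIV (\<lambda>t::real. - exp (- t))" for k
    using C_diff_on_compose[OF m C_diff_on_compose[OF C_diff_on_exp m]] .
qed (auto intro!: derivative_eq_intros)

lemma increasing_smooth_compose:
  assumes f: "increasing_smooth f" and g: "increasing_smooth g"
  shows "increasing_smooth (\<lambda>t. f (g t))"
proof (rule increasing_smoothI[where f' = "\<lambda>t. deriv f (g t) * deriv g t"])
  show "C_diff_on k UNIV (\<lambda>t. f (g t))" for k
    using f g C_diff_on_compose[of k f UNIV g] by (auto simp: increasing_smooth_def smooth_on_def)
  show "((\<lambda>t. f (g t)) has_real_derivative deriv f (g t) * deriv g t) (at t)" for t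
    using DERIV_chain2[OF increasing_smooth_deriv(1)[OF f] increasing_smooth_deriv(1)[OF g]] .
qed (use increasing_smooth_deriv(2)[OF f] increasing_smooth_deriv(2)[OF g] in auto)

lemma increasing_smooth_convex:
  assumes f: "increasing_smooth f" and g: "increasing_smooth g" and s: "s \<in> {0..1}"
  shows "increasing_smooth (\<lambda>t. (1 - s) * f t + s * g t)"
proof (rule increasing_smoothI[where f' = "\<lambda>t. (1 - s) * deriv f t + s * deriv g t"])
  show "C_diff_on k UNIV (\<lambda>t. (1 - s) * f t + s * g t)" for k
    using f g by (intro C_diff_on_add C_diff_on_mult) (auto simp: increasing_smooth_def smooth_on_def)
  show "((\<lambda>t. (1 - s) * f t + s * g t) has_real_derivative (1 - s) * deriv f t + s * deriv g t) (at t)" for t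
    using increasing_smooth_deriv(1)[OF f] increasing_smooth_deriv(1)[OF g]
    by (intro DERIV_add DERIV_cmult)
  show "0 < (1 - s) * deriv f t + s * deriv g t" for t
  \<comment> \<open>The first summand is positive except at the end \<open>s = 1\<close>, where it
    vanishes and the second one takes over.\<close>
  proof (cases "s = 1")
    case False
    then have "0 < (1 - s) * deriv f t" "0 \<le> s * deriv g t"
      using s increasing_smooth_deriv(2)[OF f, of t] increasing_smooth_deriv(2)[OF g, of t] by auto
    then show ?thesis by linarith
  qed (use increasing_smooth_deriv(2)[OF g] in auto)
qed

text \<open>An isotopy has to be smooth in space and time together. Here \<open>f\<close> and
  \<open>g\<close> are composed with the projection to space, and time enters as a linear
  factor.\<close>

lemma smooth_on_straight_line:
  assumes f: "increasing_smooth f" and g: "increasing_smooth g"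
  shows "smooth_on (UNIV \<times> {0..1}) (\<lambda>(t, s). (1 - s) * f t + s * g t)"
proof -
  have fst: "C_diff_on k S (fst :: real \<times> real \<Rightarrow> real)" and snd: "C_diff_on k S (snd :: real \<times> real \<Rightarrow> real)"
    and msnd: "C_diff_on k S (\<lambda>x::real \<times> real. - snd x)" for k S
    by (intro C_diff_on_linear bounded_linear_fst bounded_linear_snd bounded_linear_minus)+
  have "C_diff_on k S (\<lambda>x::real \<times> real. (1 + - snd x) * f (fst x) + snd x * g (fst x))" for k S
    using f g C_diff_on_compose[of k f S fst] C_diff_on_compose[of k g S fst] fst snd msnd
    by (intro C_diff_on_add C_diff_on_mult C_diff_on_const) (auto simp: increasing_smooth_def smooth_on_def)
  then show ?thesis by (simp add: smooth_on_def case_prod_unfold)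
qed

text \<open>Injective continuous maps from the line to itself are open. This is what makes
  coordinate maps topological embeddings.\<close>

lemma increasing_smooth_open_image:
  assumes "increasing_smooth f" "open S" shows "open (f ` S)"
proof (rule injective_into_1d_imp_open_map_UNIV[OF assms(2)])
  show "inj_on f S" using increasing_smooth_eq_iff[OF assms(1)] by (simp add: inj_on_def)
qed (use increasing_smooth_continuous[OF assms(1)] continuous_on_subset in blast)+

section \<open>Coordinates on disjoint unions of disks\<close>

definition coord_point :: "'p disk list \<Rightarrow> nat \<Rightarrow> real \<Rightarrow> nat \<times> 'p" where
  "coord_point X i t = (i, inv_into (points (X ! i)) (chart (X ! i)) t)"

text \<open>Kept as membership in \<open>Obj\<close>, so that the quantifiers in the axioms of a
  functor match it directly; \<open>disks_simps\<close> lets the simplifier decide it.\<close>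

abbreviation disks :: "'p disk list \<Rightarrow> bool" where
  "disks X \<equiv> X \<in> Obj disk_cat"

lemma disks_def: "disks X \<longleftrightarrow> (\<forall>D\<in>set X. oriented_disk D)"
  by (simp add: disk_cat_def)

lemma disks_simps [simp]: "disks []" "disks (E # X) \<longleftrightarrow> oriented_disk E \<and> disks X"
  "disks (X @ Y) \<longleftrightarrow> disks X \<and> disks Y"
  by (auto simp: disks_def)

lemma disks_nth: "disks X \<Longrightarrow> i < length X \<Longrightarrow> bij_betw (chart (X ! i)) (points (X ! i)) UNIV"
  by (auto simp: disks_def oriented_disk_def)

lemma coord_point_in [simp]: "disks X \<Longrightarrow> i < length X \<Longrightarrow> coord_point X i t \<in> pts X"
  by (simp add: coord_point_def pts_def inv_into_into bij_betw_imp_surj_on[OF disks_nth])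

lemma fst_coord_point [simp]: "fst (coord_point X i t) = i"
  by (simp add: coord_point_def)

lemma chart_coord_point [simp]:
  "disks X \<Longrightarrow> i < length X \<Longrightarrow> chart (X ! i) (snd (coord_point X i t)) = t"
  by (simp add: coord_point_def f_inv_into_f bij_betw_imp_surj_on[OF disks_nth])

lemma coord_point_chart:
  "disks X \<Longrightarrow> (i, p) \<in> pts X \<Longrightarrow> coord_point X i (chart (X ! i) p) = (i, p)"
  by (simp add: coord_point_def pts_def inv_into_f_f bij_betw_imp_inj_on[OF disks_nth])

lemma pts_coord:
  assumes "disks X" "z \<in> pts X"
  obtains i t where "i < length X" "z = coord_point X i t"
  using coord_point_chart[OF assms(1), of "fst z" "snd z"] assms(2) that[of "fst z" "chart (X ! fst z) (snd z)"]
  by (auto simp: pts_def)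

lemma coord_point_eq_iff [simp]:
  "disks X \<Longrightarrow> i < length X \<Longrightarrow> coord_point X i t = coord_point X i' t' \<longleftrightarrow> i = i' \<and> t = t'"
  by (metis chart_coord_point fst_coord_point)

text \<open>The index of the component carries the discrete topology of \<open>nat\<close>, so
  openness is tested on one coordinate line at a time.\<close>

lemma openin_disk_topology:
  assumes X: "disks X"
  shows "openin (disk_topology X) U \<longleftrightarrow> U \<subseteq> pts X \<and> (\<forall>i<length X. open {t. coord_point X i t \<in> U})"
proof -
  let ?c = "\<lambda>(i, p). (i, chart (X ! i) p)"
  have c: "?c (coord_point X i t) = (i, t)" if "i < length X" for i t
    using chart_coord_point[OF X that] fst_coord_point[of X i t] by (metis case_prod_unfold)
  show ?thesis
  proof
    assume "openin (disk_topology X) U"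
    then obtain V where V: "open V" "U = ?c -` V \<inter> pts X"
      by (auto simp: disk_topology_def openin_pullback_topology)
    have "{t. coord_point X i t \<in> U} = (\<lambda>t. (i, t)) -` V" if "i < length X" for i
      using V(2) c[OF that] coord_point_in[OF X that] by auto
    moreover have "open ((\<lambda>t::real. (i, t)) -` V)" for i
      using V(1) by (intro open_vimage continuous_intros)
    ultimately show "U \<subseteq> pts X \<and> (\<forall>i<length X. open {t. coord_point X i t \<in> U})"
      using V(2) by auto
  next
    assume U: "U \<subseteq> pts X \<and> (\<forall>i<length X. open {t. coord_point X i t \<in> U})"
    define V where "V = (\<Union>i<length X. {i} \<times> {t. coord_point X i t \<in> U})"
    have "open V"
      unfolding V_def using U by (intro open_UN ballI open_Times open_discrete) auto
    moreover have "U = ?c -` V \<inter> pts X"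
    proof (intro Set.set_eqI)
      fix z
      show "z \<in> U \<longleftrightarrow> z \<in> ?c -` V \<inter> pts X"
      proof (cases "z \<in> pts X")
        case True
        then obtain i t where z: "i < length X" "z = coord_point X i t" using pts_coord[OF X] by blast
        then show ?thesis using c[OF z(1)] True by (auto simp: V_def)
      qed (use U in auto)
    qed
    ultimately show "openin (disk_topology X) U"
      by (auto simp: disk_topology_def openin_pullback_topology)
  qed
qed

lemma topspace_disk_topology [simp]: "topspace (disk_topology X) = pts X"
  by (simp add: disk_topology_def topspace_pullback_topology)

text \<open>Only the values of \<open>\<kappa>\<close> and \<open>f\<close> at indices below
  \<open>length X\<close> enter, so one embedding has many such presentations.\<close>

definition coord_map ::
  "'p disk list \<Rightarrow> 'p disk list \<Rightarrow> (nat \<Rightarrow> nat) \<Rightarrow> (nat \<Rightarrow> real \<Rightarrow> real) \<Rightarrow> nat \<times> 'p \<Rightarrow> nat \<times> 'p" where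
  "coord_map X Y \<kappa> f = restrict (\<lambda>(i, p). coord_point Y (\<kappa> i) (f i (chart (X ! i) p))) (pts X)"

lemma coord_map_point [simp]:
  "disks X \<Longrightarrow> i < length X \<Longrightarrow> coord_map X Y \<kappa> f (coord_point X i t) = coord_point Y (\<kappa> i) (f i t)"
  using coord_point_in[of X i t] chart_coord_point[of X i t]
  by (simp add: coord_map_def case_prod_unfold)

lemma extensional_eqI_coord:
  assumes X: "disks X" and "j \<in> extensional (pts X)" "j' \<in> extensional (pts X)"
    and "\<And>i t. i < length X \<Longrightarrow> j (coord_point X i t) = j' (coord_point X i t)"
  shows "j = j'"
  using assms(2,3)
proof (rule extensionalityI)
  fix z assume "z \<in> pts X"
  then show "j z = j' z" using pts_coord[OF X] assms(4) by metis
qed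

lemma coord_map_extensional [simp]: "coord_map X Y \<kappa> f \<in> extensional (pts X)"
  by (simp add: coord_map_def)

lemma coord_map_cong:
  assumes "disks X" "\<And>i. i < length X \<Longrightarrow> \<kappa> i = \<kappa>' i" "\<And>i t. i < length X \<Longrightarrow> f i t = f' i t"
  shows "coord_map X Y \<kappa> f = coord_map X Y \<kappa>' f'"
  by (rule extensional_eqI_coord[OF assms(1)]) (simp_all add: assms)

text \<open>Only the numbers of disks matter, since every chart is onto the whole line. Injectivity
  on a single disk follows from monotonicity; the last condition is injectivity across two disks of
  the same component.\<close>

definition coord_embedding ::
  "nat \<Rightarrow> nat \<Rightarrow> (nat \<Rightarrow> nat) \<Rightarrow> (nat \<Rightarrow> real \<Rightarrow> real) \<Rightarrow> bool" where
  "coord_embedding n m \<kappa> f \<longleftrightarrow> (\<forall>i<n. \<kappa> i < m \<and> increasing_smooth (f i)) \<and>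
     (\<forall>i<n. \<forall>i'<n. \<forall>t t'. i \<noteq> i' \<longrightarrow> \<kappa> i = \<kappa> i' \<longrightarrow> f i t \<noteq> f i' t')"

lemma coord_embeddingD:
  assumes "coord_embedding n m \<kappa> f" "i < n"
  shows "\<kappa> i < m" "increasing_smooth (f i)"
    "i' < n \<Longrightarrow> i \<noteq> i' \<Longrightarrow> \<kappa> i = \<kappa> i' \<Longrightarrow> f i t \<noteq> f i' t'"
  using assms unfolding coord_embedding_def by blast+

lemma coord_map_in_embeddings:
  assumes X: "disks X" and Y: "disks Y" and e: "coord_embedding (length X) (length Y) \<kappa> f"
  shows "coord_map X Y \<kappa> f \<in> oriented_embeddings X Y"
proof -
  let ?j = "coord_map X Y \<kappa> f"
  note e = coord_embeddingD[OF e]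
  have maps: "?j \<in> pts X \<rightarrow> pts Y"
  proof
    fix z assume "z \<in> pts X"
    then obtain i t where "i < length X" "z = coord_point X i t" using pts_coord[OF X] by blast
    then show "?j z \<in> pts Y" using X Y e(1) by simp
  qed
  have inj: "inj_on ?j (pts X)"
  proof (rule inj_onI)
    fix z z' assume "z \<in> pts X" "z' \<in> pts X" and eq: "?j z = ?j z'"
    then obtain i t i' t' where z: "i < length X" "z = coord_point X i t" "i' < length X" "z' = coord_point X i' t'"
      using pts_coord[OF X] by metis
    then have eq': "\<kappa> i = \<kappa> i'" "f i t = f i' t'" using eq X Y e(1) by auto
    then have "i = i'" using e(3)[OF z(1,3)] by blast
    then show "z = z'" using eq'(2) increasing_smooth_eq_iff[OF e(2)[OF z(1)]] z by auto
  qed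
  have imm: "oriented_immersion X Y ?j"
    unfolding oriented_immersion_def
  proof (intro allI impI)
    fix i assume i: "i < length X"
    have "?j (i, p) = coord_point Y (\<kappa> i) (f i (chart (X ! i) p))" if "p \<in> points (X ! i)" for p
      using that i by (simp add: coord_map_def pts_def)
    then show "\<exists>k<length Y. \<exists>f :: real \<Rightarrow> real. smooth_on UNIV f \<and> (\<forall>t. deriv f t > 0) \<and>
        (\<forall>p\<in>points (X ! i). fst (?j (i, p)) = k \<and> chart (Y ! k) (snd (?j (i, p))) = f (chart (X ! i) p))"
      using Y e(1,2)[OF i] unfolding increasing_smooth_def by (intro exI[of _ "\<kappa> i"] exI[of _ "f i"]) auto
  qed
  have cont: "continuous_map (disk_topology X) (disk_topology Y) ?j"
    unfolding continuous_map_def topspace_disk_topology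
  proof (intro conjI maps allI impI)
    fix U assume U: "openin (disk_topology Y) U"
    have "open {t. coord_point X i t \<in> {x \<in> pts X. ?j x \<in> U}}" if i: "i < length X" for i
    proof -
      have "{t. coord_point X i t \<in> {x \<in> pts X. ?j x \<in> U}} = f i -` {t. coord_point Y (\<kappa> i) t \<in> U}"
        using X i by auto
      moreover have "open (f i -` {t. coord_point Y (\<kappa> i) t \<in> U})"
        using U e(1)[OF i] increasing_smooth_continuous[OF e(2)[OF i]]
        by (intro open_vimage) (auto simp: openin_disk_topology[OF Y])
      ultimately show ?thesis by simp
    qed
    then show "openin (disk_topology X) {x \<in> pts X. ?j x \<in> U}"
      by (auto simp: openin_disk_topology[OF X])
  qed
  have open_map: "open_map (disk_topology X) (disk_topology Y) ?j"
    unfolding open_map_def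
  proof (intro allI impI)
    fix U assume U: "openin (disk_topology X) U"
    then have UX: "U \<subseteq> pts X" by (simp add: openin_disk_topology[OF X])
    have "open {t. coord_point Y k t \<in> ?j ` U}" if k: "k < length Y" for k
    proof -
      \<comment> \<open>The part of the image in component \<open>k\<close> is a union over the
        disks sent there, each contributing the open image of an open set.\<close>
      have "{t. coord_point Y k t \<in> ?j ` U} = (\<Union>i\<in>{i. i < length X \<and> \<kappa> i = k}. f i ` {t. coord_point X i t \<in> U})"
        (is "?A = ?B")
      proof (intro Set.set_eqI iffI)
        fix t assume "t \<in> ?A"
        then obtain z where z: "z \<in> U" "coord_point Y k t = ?j z" by auto
        then obtain i s where i: "i < length X" "z = coord_point X i s" using UX pts_coord[OF X] by blast
        then have "k = \<kappa> i" "t = f i s" using z(2) X Y k by auto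
        then show "t \<in> ?B" using i z by auto
      next
        fix t assume "t \<in> ?B"
        then obtain i s where i: "i < length X" "\<kappa> i = k" "t = f i s" "coord_point X i s \<in> U" by auto
        then have "coord_point Y k t = ?j (coord_point X i s)" using X by simp
        then show "t \<in> ?A" using i(4) by blast
      qed
      moreover have "open ?B"
        using U e(2) by (intro open_UN ballI increasing_smooth_open_image) (auto simp: openin_disk_topology[OF X])
      ultimately show ?thesis by simp
    qed
    moreover have "?j ` U \<subseteq> pts Y" using maps UX by blast
    ultimately show "openin (disk_topology Y) (?j ` U)" by (simp add: openin_disk_topology[OF Y])
  qed
  have "embedding_map (disk_topology X) (disk_topology Y) ?j"
    using injective_open_imp_embedding_map[OF cont open_map] inj by simp
  then show ?thesis using maps imm unfolding oriented_embeddings_def by (simp add: PiE_def)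
qed

text \<open>A point of the target is determined by its component and its coordinate, and
  \<open>oriented_immersion\<close> provides both for every image point. Disjointness of the images
  comes from injectivity of the topological embedding.\<close>

lemma embeddings_coord_map:
  assumes X: "disks X" and Y: "disks Y" and j: "j \<in> oriented_embeddings X Y"
  obtains \<kappa> f where "coord_embedding (length X) (length Y) \<kappa> f" "j = coord_map X Y \<kappa> f"
proof -
  have jE: "j \<in> pts X \<rightarrow>\<^sub>E pts Y" and imm: "oriented_immersion X Y j"
    and emb: "embedding_map (disk_topology X) (disk_topology Y) j"
    using j by (auto simp: oriented_embeddings_def)
  have inj: "inj_on j (pts X)"
    using emb homeomorphic_imp_injective_map unfolding embedding_map_def by fastforce
  obtain \<kappa> f where kf: "\<And>i. i < length X \<Longrightarrow> \<kappa> i < length Y \<and> smooth_on UNIV (f i) \<and> (\<forall>t. deriv (f i) t > 0) \<and>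
        (\<forall>p\<in>points (X ! i). fst (j (i, p)) = \<kappa> i \<and> chart (Y ! \<kappa> i) (snd (j (i, p))) = f i (chart (X ! i) p))"
    using imm unfolding oriented_immersion_def by metis
  have jc: "j (coord_point X i t) = coord_point Y (\<kappa> i) (f i t)" if i: "i < length X" for i t
  proof -
    let ?z = "coord_point X i t"
    have z: "?z \<in> pts X" using X i by simp
    then have zp: "snd ?z \<in> points (X ! i)" by (auto simp: pts_def coord_point_def)
    have jz: "fst (j ?z) = \<kappa> i" "chart (Y ! \<kappa> i) (snd (j ?z)) = f i t"
      using kf[OF i] zp chart_coord_point[OF X i, of t] by (metis fst_coord_point prod.collapse)+
    have "j ?z \<in> pts Y" using jE z by blast
    then show ?thesis
      using coord_point_chart[OF Y, of "fst (j ?z)" "snd (j ?z)"] jz by (metis prod.collapse)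
  qed
  have "coord_embedding (length X) (length Y) \<kappa> f"
    unfolding coord_embedding_def
  proof (intro conjI allI impI)
    fix i i' t t' assume i: "i < length X" "i' < length X" "i \<noteq> i'" "\<kappa> i = \<kappa> i'"
    show "f i t \<noteq> f i' t'"
    proof
      assume "f i t = f i' t'"
      then have "j (coord_point X i t) = j (coord_point X i' t')" using jc i by simp
      then show False using inj_onD[OF inj] i X by (metis coord_point_in coord_point_eq_iff)
    qed
  qed (use kf in \<open>auto simp: increasing_smooth_def\<close>)
  moreover have "j = coord_map X Y \<kappa> f"
    using jE X jc by (intro extensional_eqI_coord[OF X]) (auto simp: PiE_def)
  ultimately show thesis using that by blast
qed

section \<open>The order of disks inside a component as the isotopy invariant\<close>

lemma less_of_avoid:
  fixes g :: "'a::topological_space \<Rightarrow> real"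
  assumes "connected S" "continuous_on S g" "\<And>x. x \<in> S \<Longrightarrow> g x \<noteq> c" "a \<in> S" "b \<in> S" "g a < c"
  shows "g b < c"
proof (rule ccontr)
  assume "\<not> g b < c"
  \<comment> \<open>The image of a connected set is an interval and would contain the avoided
    value.\<close>
  then have "c \<in> g ` S"
    using connectedD_interval[OF connected_continuous_image[OF assms(2,1)], of "g a" "g b" c] assms(4-6) by auto
  then show False using assms(3) by auto
qed

text \<open>The images of two disks in one component are disjoint intervals, so comparing one point
  of each compares all. One coordinate is moved at a time, the other point being the value to
  avoid.\<close>

lemma coord_embedding_less:
  assumes e: "coord_embedding n m \<kappa> f" and i: "i < n" "i' < n" "\<kappa> i = \<kappa> i'" and less: "f i 0 < f i' 0"
  shows "f i s < f i' t"
proof -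
  note D = coord_embeddingD[OF e]
  have ne: "i \<noteq> i'" using less by auto
  have "f i s < f i' 0"
    using less_of_avoid[OF connected_UNIV increasing_smooth_continuous[OF D(2)[OF i(1)]], of "f i' 0" 0 s]
      D(3)[OF i(1,2) ne i(3)] less by auto
  \<comment> \<open>\<open>less_of_avoid\<close> preserves upper bounds; the lower bound on the
    second disk is obtained for the negated function.\<close>
  then have "- f i' 0 < - f i s" by simp
  moreover have "- f i' r \<noteq> - f i s" for r
    using D(3)[OF i(1,2) ne i(3), of s r] by simp
  ultimately have "- f i' t < - f i s"
    using less_of_avoid[OF connected_UNIV continuous_on_minus[OF increasing_smooth_continuous[OF D(2)[OF i(2)]]], of "- f i s" 0 t]
    by blast
  then show ?thesis by simp
qed

text \<open>By \<open>coord_embedding_less\<close> the coordinate \<open>0\<close> stands for the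
  whole disk, so the two embeddings agree in components and in left-to-right order.
  \<open>isotopicI\<close> and \<open>isotopicD\<close> show that this characterises
  isotopy.\<close>

definition same_order ::
  "nat \<Rightarrow> (nat \<Rightarrow> nat) \<Rightarrow> (nat \<Rightarrow> real \<Rightarrow> real) \<Rightarrow> (nat \<Rightarrow> nat) \<Rightarrow> (nat \<Rightarrow> real \<Rightarrow> real) \<Rightarrow> bool" where
  "same_order n \<kappa> f \<kappa>' f' \<longleftrightarrow> (\<forall>i<n. \<kappa> i = \<kappa>' i) \<and>
     (\<forall>i<n. \<forall>i'<n. \<kappa> i = \<kappa> i' \<longrightarrow> (f i 0 < f i' 0 \<longleftrightarrow> f' i 0 < f' i' 0))"

lemma coord_embedding_convex:
  assumes e: "coord_embedding n m \<kappa> f" and e': "coord_embedding n m \<kappa>' f'"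
    and so: "same_order n \<kappa> f \<kappa>' f'" and s: "s \<in> {0..1}"
  shows "coord_embedding n m \<kappa> (\<lambda>i t. (1 - s) * f i t + s * f' i t)"
proof -
  let ?g = "\<lambda>i t. (1 - s) * f i t + s * f' i t"
  note D = coord_embeddingD[OF e] and D' = coord_embeddingD[OF e']
  \<comment> \<open>Both ends of the line put disk \<open>i\<close> to the left of disk
    \<open>i'\<close>, whatever the parameters, and a convex combination of strict inequalities is
    strict.\<close>
  have less: "?g i t < ?g i' t'" if i: "i < n" "i' < n" "\<kappa> i = \<kappa> i'" and l: "f i 0 < f i' 0" for i i' t t'
  proof -
    have "f i t < f i' t'" using coord_embedding_less[OF e i l] .
    moreover have "\<kappa>' i = \<kappa>' i'" "f' i 0 < f' i' 0" using so i l by (auto simp: same_order_def)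
    then have "f' i t < f' i' t'" using coord_embedding_less[OF e' i(1,2)] by simp
    ultimately show ?thesis
      using s convex_bound_lt[of "f i t - f i' t'" 0 "f' i t - f' i' t'" "1 - s" s] by (simp add: algebra_simps)
  qed
  show ?thesis
    unfolding coord_embedding_def
  proof (intro conjI allI impI)
    fix i assume i: "i < n"
    then show "\<kappa> i < m" "increasing_smooth (?g i)"
      using D(1,2) D'(2) increasing_smooth_convex s by auto
  next
    fix i i' t t' assume i: "i < n" "i' < n" "i \<noteq> i'" "\<kappa> i = \<kappa> i'"
    have "f i 0 \<noteq> f i' 0" using D(3)[OF i] .
    then show "?g i t \<noteq> ?g i' t'"
      using less[OF i(1,2,4), of t t'] less[OF i(2,1) i(4)[symmetric], of t' t] by linarith
  qed
qed

lemma isotopicI: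
  assumes X: "disks X" and Y: "disks Y"
    and e: "coord_embedding (length X) (length Y) \<kappa> f" and e': "coord_embedding (length X) (length Y) \<kappa>' f'"
    and so: "same_order (length X) \<kappa> f \<kappa>' f'"
  shows "isotopic X Y (coord_map X Y \<kappa> f) (coord_map X Y \<kappa>' f')"
proof -
  define H where "H s = coord_map X Y \<kappa> (\<lambda>i t. (1 - s) * f i t + s * f' i t)" for s
  note D = coord_embeddingD[OF e] and D' = coord_embeddingD[OF e']
  have "H 0 = coord_map X Y \<kappa> f" "H 1 = coord_map X Y \<kappa>' f'"
    using so unfolding H_def same_order_def by (auto intro!: coord_map_cong[OF X])
  moreover have "\<forall>s\<in>{0..1}. H s \<in> oriented_embeddings X Y"
    unfolding H_def using coord_map_in_embeddings[OF X Y coord_embedding_convex[OF e e' so]] by blast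
  moreover have "\<exists>k<length Y. \<exists>h :: real \<times> real \<Rightarrow> real.
           smooth_on (UNIV \<times> {0..1}) h \<and>
           (\<forall>p\<in>points (X ! i). \<forall>s\<in>{0..1}. fst (H s (i, p)) = k \<and>
              chart (Y ! k) (snd (H s (i, p))) = h (chart (X ! i) p, s))" if i: "i < length X" for i
  proof (intro exI conjI ballI)
    show "\<kappa> i < length Y" using D(1)[OF i] .
    show "smooth_on (UNIV \<times> {0..1}) (\<lambda>(t, s). (1 - s) * f i t + s * f' i t)"
      using smooth_on_straight_line[OF D(2)[OF i] D'(2)[OF i]] .
    fix p s assume "p \<in> points (X ! i)"
    then have "H s (i, p) = coord_point Y (\<kappa> i) ((1 - s) * f i (chart (X ! i) p) + s * f' i (chart (X ! i) p))"
      using i by (simp add: H_def coord_map_def pts_def)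
    then show "fst (H s (i, p)) = \<kappa> i"
      "chart (Y ! \<kappa> i) (snd (H s (i, p))) = (case (chart (X ! i) p, s) of (t, s) \<Rightarrow> (1 - s) * f i t + s * f' i t)"
      using Y D(1)[OF i] by simp_all
  qed
  ultimately show ?thesis unfolding isotopic_def by blast
qed

text \<open>Along an isotopy the positions of two disks of one component vary continuously and never
  meet, so their difference keeps its sign. This direction makes the functor built from an algebra
  isotopy invariant.\<close>

lemma isotopicD:
  assumes X: "disks X" and Y: "disks Y"
    and iso: "isotopic X Y (coord_map X Y \<kappa> f) (coord_map X Y \<kappa>' f')"
    and e: "coord_embedding (length X) (length Y) \<kappa> f" and e': "coord_embedding (length X) (length Y) \<kappa>' f'"
  shows "same_order (length X) \<kappa> f \<kappa>' f'"
proof -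
  obtain H where H: "H 0 = coord_map X Y \<kappa> f" "H 1 = coord_map X Y \<kappa>' f'"
      "\<forall>s\<in>{0..1}. H s \<in> oriented_embeddings X Y"
    and "\<forall>i<length X. \<exists>k<length Y. \<exists>h :: real \<times> real \<Rightarrow> real.
           smooth_on (UNIV \<times> {0..1}) h \<and>
           (\<forall>p\<in>points (X ! i). \<forall>s\<in>{0..1}. fst (H s (i, p)) = k \<and>
              chart (Y ! k) (snd (H s (i, p))) = h (chart (X ! i) p, s))"
    using iso unfolding isotopic_def by blast
  then obtain k and h :: "nat \<Rightarrow> real \<times> real \<Rightarrow> real" where kh: "\<And>i. i < length X \<Longrightarrow> k i < length Y \<and> smooth_on (UNIV \<times> {0..1}) (h i) \<and>
           (\<forall>p\<in>points (X ! i). \<forall>s\<in>{0..1}. fst (H s (i, p)) = k i \<and>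
              chart (Y ! k i) (snd (H s (i, p))) = h i (chart (X ! i) p, s))"
    by metis
  have Hc: "fst (H s (coord_point X i t)) = k i" "chart (Y ! k i) (snd (H s (coord_point X i t))) = h i (t, s)"
    if i: "i < length X" and s: "s \<in> {0..1}" for i s t
  proof -
    let ?p = "snd (coord_point X i t)"
    have z: "coord_point X i t = (i, ?p)" by (metis fst_coord_point prod.collapse)
    then have "?p \<in> points (X ! i)" using coord_point_in[OF X i, of t] by (auto simp: pts_def)
    then show "fst (H s (coord_point X i t)) = k i" "chart (Y ! k i) (snd (H s (coord_point X i t))) = h i (t, s)"
      using kh[OF i] s z chart_coord_point[OF X i] by metis+
  qed
  have k: "\<kappa> i = k i" "\<kappa>' i = k i" if i: "i < length X" for i
    using Hc(1)[OF i, of 0 0] Hc(1)[OF i, of 1 0] H(1,2) X i by auto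
  have h0: "f i t = h i (t, 0)" "f' i t = h i (t, 1)" if i: "i < length X" for i t
    using Hc(2)[OF i, of 0 t] Hc(2)[OF i, of 1 t] H(1,2) X Y i k[OF i] kh[OF i] by auto
  \<comment> \<open>Every stage of the isotopy is an embedding and has coordinates
    \<open>\<mu>\<close>, \<open>g\<close> of its own; they agree with \<open>k\<close> and
    \<open>h\<close>, so the disjointness of images at time \<open>s\<close> becomes a statement
    about \<open>h\<close>.\<close>
  have hne: "h i (0, s) \<noteq> h i' (0, s)"
    if i: "i < length X" "i' < length X" "i \<noteq> i'" "k i = k i'" and s: "s \<in> {0..1}" for i i' s
  proof -
    obtain \<mu> g where g: "coord_embedding (length X) (length Y) \<mu> g" "H s = coord_map X Y \<mu> g"
      using embeddings_coord_map[OF X Y H(3)[rule_format, OF s]] .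
    have mu: "\<mu> l = k l" "h l (0, s) = g l 0" if l: "l < length X" for l
      using Hc[OF l s, of 0] g(2) X Y l coord_embeddingD(1)[OF g(1) l] by auto
    show ?thesis using coord_embeddingD(3)[OF g(1) i(1,2,3), of 0 0] mu[OF i(1)] mu[OF i(2)] i(4) by simp
  qed
  have cont: "continuous_on {0..1} (\<lambda>s. h i (0, s))" if i: "i < length X" for i
  proof -
    have "continuous_on (UNIV \<times> {0..1}) (h i)"
      using kh[OF i] C_diff_on.simps(1) unfolding smooth_on_def by blast
    then show ?thesis
      by (rule continuous_on_compose2) (auto intro!: continuous_intros)
  qed
  have less: "h i (0, b) < h i' (0, b)"
    if i: "i < length X" "i' < length X" "k i = k i'" and l: "h i (0, a) < h i' (0, a)"
      and ab: "a \<in> {0..1}" "b \<in> {0..1}" for i i' a b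
  proof -
    have "i \<noteq> i'" using l by auto
    then have ne: "h i (0, s) - h i' (0, s) \<noteq> 0" if "s \<in> {0..1}" for s
      using hne[OF i(1,2) _ i(3) that] by simp
    have "h i (0, b) - h i' (0, b) < 0"
      by (rule less_of_avoid[OF connected_Icc continuous_on_diff[OF cont[OF i(1)] cont[OF i(2)]] ne ab])
        (use l in simp_all)
    then show ?thesis by simp
  qed
  have "f i 0 < f i' 0 \<longleftrightarrow> f' i 0 < f' i' 0"
    if i: "i < length X" "i' < length X" "\<kappa> i = \<kappa> i'" for i i'
  proof -
    have "k i = k i'" using k i by metis
    then show ?thesis
      using less[OF i(1,2), of 0 1] less[OF i(1,2), of 1 0] h0[OF i(1)] h0[OF i(2)] by auto
  qed
  then show ?thesis unfolding same_order_def using k by auto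
qed

section \<open>Composition, disjoint union, swaps and folds in coordinates\<close>

lemma coord_embedding_compose:
  assumes e: "coord_embedding n m \<kappa> f" and e': "coord_embedding m l \<kappa>' f'"
  shows "coord_embedding n l (\<lambda>i. \<kappa>' (\<kappa> i)) (\<lambda>i t. f' (\<kappa> i) (f i t))"
proof -
  note D = coord_embeddingD[OF e] and D' = coord_embeddingD[OF e']
  show ?thesis
    unfolding coord_embedding_def
  proof (intro conjI allI impI)
    fix i i' t t' assume i: "i < n" "i' < n" "i \<noteq> i'" "\<kappa>' (\<kappa> i) = \<kappa>' (\<kappa> i')"
    show "f' (\<kappa> i) (f i t) \<noteq> f' (\<kappa> i') (f i' t')"
      using D(3)[OF i(1,2,3)] D'(3)[OF D(1)[OF i(1)] D(1)[OF i(2)] _ i(4)]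
        increasing_smooth_eq_iff[OF D'(2)[OF D(1)[OF i(1)]]] by metis
  qed (use D D' increasing_smooth_compose in auto)
qed

lemma coord_map_compose:
  assumes "disks X" "disks Y" "coord_embedding (length X) (length Y) \<kappa> f"
  shows "compose (pts X) (coord_map Y Z \<kappa>' f') (coord_map X Y \<kappa> f)
       = coord_map X Z (\<lambda>i. \<kappa>' (\<kappa> i)) (\<lambda>i t. f' (\<kappa> i) (f i t))"
  using assms coord_embeddingD(1)[OF assms(3)]
  by (intro extensional_eqI_coord[OF assms(1)]) (auto simp: compose_def)

text \<open>The shifts by \<open>n\<close> in the source and by \<open>m\<close> in the target are
  those of \<open>disj_union_map\<close>, where the second family is numbered after the
  first.\<close>

definition union_index :: "nat \<Rightarrow> nat \<Rightarrow> (nat \<Rightarrow> nat) \<Rightarrow> (nat \<Rightarrow> nat) \<Rightarrow> nat \<Rightarrow> nat" where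
  "union_index n m \<kappa> \<kappa>' i = (if i < n then \<kappa> i else \<kappa>' (i - n) + m)"

definition union_fun :: "nat \<Rightarrow> (nat \<Rightarrow> 'a) \<Rightarrow> (nat \<Rightarrow> 'a) \<Rightarrow> nat \<Rightarrow> 'a" where
  "union_fun n f f' i = (if i < n then f i else f' (i - n))"

lemma coord_point_append:
  "coord_point (X @ Y) i t = (if i < length X then coord_point X i t
     else (i, snd (coord_point Y (i - length X) t)))"
  by (simp add: coord_point_def nth_append)

lemma coord_embedding_union:
  assumes e: "coord_embedding n m \<kappa> f" and e': "coord_embedding n' m' \<kappa>' f'"
  shows "coord_embedding (n + n') (m + m') (union_index n m \<kappa> \<kappa>') (union_fun n f f')"
proof -
  note D = coord_embeddingD[OF e] and D' = coord_embeddingD[OF e']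
  show ?thesis
    unfolding coord_embedding_def
  proof (intro conjI allI impI)
    fix i assume i: "i < n + n'"
    show "union_index n m \<kappa> \<kappa>' i < m + m'"
      using D(1)[of i] D'(1)[of "i - n"] i by (auto simp: union_index_def)
    show "increasing_smooth (union_fun n f f' i)"
      using D(2)[of i] D'(2)[of "i - n"] i by (auto simp: union_fun_def)
  next
    fix i i' t t'
    assume i: "i < n + n'" "i' < n + n'" "i \<noteq> i'" "union_index n m \<kappa> \<kappa>' i = union_index n m \<kappa> \<kappa>' i'"
    \<comment> \<open>A disk of the first family and one of the second never share a component: the
      former lands below \<open>m\<close>, the latter at or above it.\<close>
    consider "i < n" "i' < n" | "i \<ge> n" "i' \<ge> n"
      using i(4) D(1)[of i] D(1)[of i'] unfolding union_index_def by (metis add.commute not_add_less1 not_le)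
    then show "union_fun n f f' i t \<noteq> union_fun n f f' i' t'"
    proof cases
      case 1
      then show ?thesis using D(3)[of i i'] i by (auto simp: union_fun_def union_index_def)
    next
      case 2
      then have "i - n < n'" "i' - n < n'" "i - n \<noteq> i' - n" using i by auto
      then show ?thesis using 2 D'(3)[of "i - n" "i' - n"] i(4) by (auto simp: union_fun_def union_index_def)
    qed
  qed
qed

lemma coord_map_union:
  assumes X: "disks X" and Y: "disks Y" and e: "coord_embedding (length X) (length X') \<kappa> f"
  shows "disj_union_map X Y X' (coord_map X X' \<kappa> f) (coord_map Y Y' \<kappa>' f')
       = coord_map (X @ Y) (X' @ Y') (union_index (length X) (length X') \<kappa> \<kappa>') (union_fun (length X) f f')"
proof (rule extensional_eqI_coord)
  fix i t assume i: "i < length (X @ Y)"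
  have XY: "disks (X @ Y)" using X Y by simp
  have z: "coord_point (X @ Y) i t \<in> pts (X @ Y)" using coord_point_in[OF XY i] .
  show "disj_union_map X Y X' (coord_map X X' \<kappa> f) (coord_map Y Y' \<kappa>' f') (coord_point (X @ Y) i t) =
     coord_map (X @ Y) (X' @ Y') (union_index (length X) (length X') \<kappa> \<kappa>') (union_fun (length X) f f')
       (coord_point (X @ Y) i t)"
    unfolding coord_map_point[OF XY i]
  proof (cases "i < length X")
    case True
    have "disj_union_map X Y X' (coord_map X X' \<kappa> f) (coord_map Y Y' \<kappa>' f') (coord_point (X @ Y) i t) =
        coord_map X X' \<kappa> f (coord_point X i t)"
      using z True fst_coord_point[of X i t]
      by (cases "coord_point X i t") (simp add: disj_union_map_def coord_point_append)
    then show "disj_union_map X Y X' (coord_map X X' \<kappa> f) (coord_map Y Y' \<kappa>' f') (coord_point (X @ Y) i t) =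
        coord_point (X' @ Y') (union_index (length X) (length X') \<kappa> \<kappa>' i) (union_fun (length X) f f' i t)"
      using True X coord_embeddingD(1)[OF e True] by (simp add: coord_point_append union_index_def union_fun_def)
  next
    case False
    let ?i = "i - length X"
    have i': "?i < length Y" using i False by simp
    have "(?i, snd (coord_point Y ?i t)) = coord_point Y ?i t" by (metis fst_coord_point prod.collapse)
    then have "disj_union_map X Y X' (coord_map X X' \<kappa> f) (coord_map Y Y' \<kappa>' f') (coord_point (X @ Y) i t) =
        (case coord_map Y Y' \<kappa>' f' (coord_point Y ?i t) of (k, q) \<Rightarrow> (k + length X', q))"
      using z False by (simp add: disj_union_map_def coord_point_append)
    also have "\<dots> = (\<kappa>' ?i + length X', snd (coord_point Y' (\<kappa>' ?i) (f' ?i t)))"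
      using Y i' fst_coord_point[of Y' "\<kappa>' ?i" "f' ?i t"] by (simp add: case_prod_unfold)
    finally show "disj_union_map X Y X' (coord_map X X' \<kappa> f) (coord_map Y Y' \<kappa>' f') (coord_point (X @ Y) i t) =
        coord_point (X' @ Y') (union_index (length X) (length X') \<kappa> \<kappa>' i) (union_fun (length X) f f' i t)"
      using False by (simp add: coord_point_append union_index_def union_fun_def)
  qed
qed (use X Y in \<open>auto simp: disj_union_map_def\<close>)

definition swap_index :: "nat \<Rightarrow> nat \<Rightarrow> nat \<Rightarrow> nat" where
  "swap_index n m i = (if i < n then i + m else i - n)"

lemma coord_embedding_inj:
  assumes "\<And>i. i < n \<Longrightarrow> \<kappa> i < m" "inj_on \<kappa> {..<n}" "\<And>i. i < n \<Longrightarrow> increasing_smooth (f i)"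
  shows "coord_embedding n m \<kappa> f"
  using assms unfolding coord_embedding_def inj_on_def by blast

lemma coord_embedding_swap: "coord_embedding (n + m) (m + n) (swap_index n m) (\<lambda>i t. t)"
  by (rule coord_embedding_inj) (auto simp: swap_index_def inj_on_def increasing_smooth_id split: if_splits)

lemma swap_map_coord:
  assumes X: "disks X" and Y: "disks Y"
  shows "swap_map X Y = coord_map (X @ Y) (Y @ X) (swap_index (length X) (length Y)) (\<lambda>i t. t)"
proof (rule extensional_eqI_coord)
  fix i t assume i: "i < length (X @ Y)"
  have XY: "disks (X @ Y)" using X Y by simp
  have z: "coord_point (X @ Y) i t \<in> pts (X @ Y)" using coord_point_in[OF XY i] .
  show "swap_map X Y (coord_point (X @ Y) i t) =
    coord_map (X @ Y) (Y @ X) (swap_index (length X) (length Y)) (\<lambda>i t. t) (coord_point (X @ Y) i t)"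
    unfolding coord_map_point[OF XY i] using z i
    by (auto simp: swap_map_def coord_point_def swap_index_def nth_append)
qed (use X Y in \<open>auto simp: swap_map_def\<close>)

lemma coord_embedding_ident: "coord_embedding n n (\<lambda>i. i) (\<lambda>i t. t)"
  by (rule coord_embedding_inj) (auto simp: increasing_smooth_id)

lemma ident_coord: "disks X \<Longrightarrow> restrict (\<lambda>z. z) (pts X) = coord_map X X (\<lambda>i. i) (\<lambda>i t. t)"
  by (rule extensional_eqI_coord) auto

text \<open>The coordinate form of \<open>fold_embedding\<close>. The images are the negative and
  the positive half-line, hence disjoint and in this order.\<close>

definition fold_fun :: "nat \<Rightarrow> real \<Rightarrow> real" where
  "fold_fun i t = (if i = 0 then - exp (- t) else exp t)"

lemma fold_fun_less: "fold_fun 0 s < fold_fun (Suc i) t"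
  by (simp add: fold_fun_def) (meson exp_gt_zero less_trans neg_less_0_iff_less)

lemma coord_embedding_fold: "coord_embedding 2 1 (\<lambda>i. 0) fold_fun"
proof -
  have "increasing_smooth (fold_fun i)" for i
    using increasing_smooth_exp increasing_smooth_minus_exp by (cases i) (simp_all add: fold_fun_def[abs_def])
  moreover have "fold_fun 0 s \<noteq> fold_fun (Suc i) t" for s i t
    using fold_fun_less[of s i t] by simp
  ultimately show ?thesis
    unfolding coord_embedding_def by (auto simp: less_2_cases_iff) metis+
qed

lemma fold_embedding_coord: "oriented_disk E \<Longrightarrow> fold_embedding E = coord_map [E, E] [E] (\<lambda>i. 0) fold_fun"
  by (rule extensional_eqI_coord)
    (auto simp: fold_embedding_def coord_map_def coord_point_def fold_fun_def less_Suc_eq pts_def)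

lemma coord_embedding_empty: "coord_embedding 0 m \<kappa> f"
  by (simp add: coord_embedding_def)

text \<open>There is no disk to map, so every \<open>\<kappa>\<close> and \<open>f\<close> present
  the one arrow out of the empty union, and the unit of the algebra can be rewritten with whichever
  pair is convenient.\<close>

lemma empty_coord: "(\<lambda>_. undefined) = coord_map [] Y \<kappa> f"
  by (rule ext) (simp add: coord_map_def pts_def)

section \<open>Ordered products along an embedding\<close>

text \<open>Sorting by the image of the coordinate \<open>0\<close> arranges the fibre from left to
  right, because the images are disjoint intervals.\<close>

definition fibre_list :: "nat \<Rightarrow> (nat \<Rightarrow> nat) \<Rightarrow> (nat \<Rightarrow> real \<Rightarrow> real) \<Rightarrow> nat \<Rightarrow> nat list" where
  "fibre_list n \<kappa> f k = sort_key (\<lambda>i. f i 0) (filter (\<lambda>i. \<kappa> i = k) [0..<n])"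

lemma set_fibre_list [simp]: "set (fibre_list n \<kappa> f k) = {i. i < n \<and> \<kappa> i = k}"
  by (auto simp: fibre_list_def)

lemma distinct_fibre_list: "distinct (fibre_list n \<kappa> f k)"
  by (simp add: fibre_list_def)

text \<open>A strictly sorted enumeration of a finite set is unique, so a fibre is computed by
  exhibiting one.\<close>

lemma fibre_list_eqI:
  assumes "set l = {i. i < n \<and> \<kappa> i = k}" "sorted_wrt (\<lambda>i i'. f i 0 < f i' 0) l"
  shows "fibre_list n \<kappa> f k = l"
proof -
  have l: "sorted_wrt (<) (map (\<lambda>i. f i 0) l)" using assms(2) by (simp add: sorted_wrt_map)
  then have sd: "sorted (map (\<lambda>i. f i 0) l)" "distinct (map (\<lambda>i. f i 0) l)"
    using strict_sorted_iff by blast+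
  then have inj: "inj_on (\<lambda>i. f i 0) (set l)" by (simp add: distinct_map)
  have "distinct (map (\<lambda>i. f i 0) (fibre_list n \<kappa> f k))"
    using inj distinct_fibre_list by (simp add: distinct_map assms(1))
  then show ?thesis
    using sd inj assms(1) by (intro map_sorted_distinct_set_unique[of "\<lambda>i. f i 0"]) (auto simp: fibre_list_def)
qed

lemma sorted_fibre_list:
  assumes e: "coord_embedding n m \<kappa> f"
  shows "sorted_wrt (\<lambda>i i'. f i 0 < f i' 0) (fibre_list n \<kappa> f k)"
proof -
  have "inj_on (\<lambda>i. f i 0) (set (fibre_list n \<kappa> f k))"
    using coord_embeddingD(3)[OF e] unfolding inj_on_def by fastforce
  then have "distinct (map (\<lambda>i. f i 0) (fibre_list n \<kappa> f k))"
    using distinct_fibre_list by (simp add: distinct_map)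
  moreover have "sorted (map (\<lambda>i. f i 0) (fibre_list n \<kappa> f k))"
    by (simp add: fibre_list_def)
  ultimately have "sorted_wrt (<) (map (\<lambda>i. f i 0) (fibre_list n \<kappa> f k))"
    using strict_sorted_iff by blast
  then show ?thesis by (simp add: sorted_wrt_map)
qed

lemma fibre_list_same_order:
  assumes e: "coord_embedding n m \<kappa> f" and so: "same_order n \<kappa> f \<kappa>' f'"
  shows "fibre_list n \<kappa>' f' k = fibre_list n \<kappa> f k"
proof (rule fibre_list_eqI)
  show "set (fibre_list n \<kappa> f k) = {i. i < n \<and> \<kappa>' i = k}"
    using so by (auto simp: same_order_def)
  show "sorted_wrt (\<lambda>i i'. f' i 0 < f' i' 0) (fibre_list n \<kappa> f k)"
    using sorted_fibre_list[OF e] by (rule sorted_wrt_mono_rel[rotated]) (use so in \<open>auto simp: same_order_def\<close>)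
qed

lemma sorted_wrt_concat:
  assumes "\<And>xs. xs \<in> set xss \<Longrightarrow> sorted_wrt R xs"
    and "sorted_wrt (\<lambda>xs ys. \<forall>x\<in>set xs. \<forall>y\<in>set ys. R x y) xss"
  shows "sorted_wrt R (concat xss)"
  using assms by (induction xss) (auto simp: sorted_wrt_append)

text \<open>The outer functions are increasing on each component, which keeps the order within a
  block, and they send different components over \<open>k\<close> to disjoint intervals, which
  orders the blocks. Functoriality of the product formula rests on this.\<close>

lemma fibre_list_compose:
  assumes e: "coord_embedding n m \<kappa> f" and e': "coord_embedding m l \<kappa>' f'"
  shows "fibre_list n (\<lambda>i. \<kappa>' (\<kappa> i)) (\<lambda>i t. f' (\<kappa> i) (f i t)) k
       = concat (map (fibre_list n \<kappa> f) (fibre_list m \<kappa>' f' k))"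
proof (rule fibre_list_eqI)
  show "set (concat (map (fibre_list n \<kappa> f) (fibre_list m \<kappa>' f' k))) = {i. i < n \<and> \<kappa>' (\<kappa> i) = k}"
    using coord_embeddingD(1)[OF e] by auto
  let ?R = "\<lambda>i i'. f' (\<kappa> i) (f i 0) < f' (\<kappa> i') (f i' 0)"
  show "sorted_wrt ?R (concat (map (fibre_list n \<kappa> f) (fibre_list m \<kappa>' f' k)))"
  proof (rule sorted_wrt_concat)
    fix xs assume "xs \<in> set (map (fibre_list n \<kappa> f) (fibre_list m \<kappa>' f' k))"
    then obtain c where c: "c < m" "xs = fibre_list n \<kappa> f c" by auto
    show "sorted_wrt ?R xs"
      unfolding c(2) using sorted_fibre_list[OF e, of c]
      by (rule sorted_wrt_mono_rel[rotated])
        (use increasing_smooth_less_iff[OF coord_embeddingD(2)[OF e' c(1)]] in auto)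
  next
    show "sorted_wrt (\<lambda>xs ys. \<forall>x\<in>set xs. \<forall>y\<in>set ys. ?R x y) (map (fibre_list n \<kappa> f) (fibre_list m \<kappa>' f' k))"
      unfolding sorted_wrt_map using sorted_fibre_list[OF e', of k]
      by (rule sorted_wrt_mono_rel[rotated]) (use coord_embedding_less[OF e'] in auto)
  qed
qed

lemma fibre_list_union:
  assumes e: "coord_embedding n m \<kappa> f" and e': "coord_embedding n' m' \<kappa>' f'"
  shows "k < m \<Longrightarrow> fibre_list (n + n') (union_index n m \<kappa> \<kappa>') (union_fun n f f') k = fibre_list n \<kappa> f k"
    and "fibre_list (n + n') (union_index n m \<kappa> \<kappa>') (union_fun n f f') (m + k) = map ((+) n) (fibre_list n' \<kappa>' f' k)"
proof -
  assume k: "k < m"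
  show "fibre_list (n + n') (union_index n m \<kappa> \<kappa>') (union_fun n f f') k = fibre_list n \<kappa> f k"
  proof (rule fibre_list_eqI)
    show "set (fibre_list n \<kappa> f k) = {i. i < n + n' \<and> union_index n m \<kappa> \<kappa>' i = k}"
      using k by (auto simp: union_index_def)
    show "sorted_wrt (\<lambda>i i'. union_fun n f f' i 0 < union_fun n f f' i' 0) (fibre_list n \<kappa> f k)"
      using sorted_fibre_list[OF e] by (rule sorted_wrt_mono_rel[rotated]) (auto simp: union_fun_def)
  qed
next
  show "fibre_list (n + n') (union_index n m \<kappa> \<kappa>') (union_fun n f f') (m + k) = map ((+) n) (fibre_list n' \<kappa>' f' k)"
  proof (rule fibre_list_eqI)
    have "i \<in> (+) n ` {i. i < n' \<and> \<kappa>' i = k}" if "i < n + n'" "union_index n m \<kappa> \<kappa>' i = m + k" for i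
      using that coord_embeddingD(1)[OF e, of i]
      by (intro image_eqI[of _ _ "i - n"]) (auto simp: union_index_def split: if_splits)
    then show "set (map ((+) n) (fibre_list n' \<kappa>' f' k)) = {i. i < n + n' \<and> union_index n m \<kappa> \<kappa>' i = m + k}"
      by (auto simp: union_index_def)
    show "sorted_wrt (\<lambda>i i'. union_fun n f f' i 0 < union_fun n f f' i' 0) (map ((+) n) (fibre_list n' \<kappa>' f' k))"
      unfolding sorted_wrt_map using sorted_fibre_list[OF e']
      by (rule sorted_wrt_mono_rel[rotated]) (auto simp: union_fun_def)
  qed
qed

lemma fibre_list_singleton: "{i. i < n \<and> \<kappa> i = k} = {i} \<Longrightarrow> fibre_list n \<kappa> f k = [i]"
  by (rule fibre_list_eqI) auto

text \<open>The fold ends in the unit, so an empty fibre contributes \<open>one A\<close>. This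
  matches the unit of \<open>functor_algebra\<close>, which comes from the empty union.\<close>

definition list_product :: "('a, 'b) monoid_scheme \<Rightarrow> 'a list \<Rightarrow> 'a" where
  "list_product A xs = foldr (mult A) xs (one A)"

lemma list_product_simps [simp]:
  "list_product A [] = \<one>\<^bsub>A\<^esub>" "list_product A (x # xs) = x \<otimes>\<^bsub>A\<^esub> list_product A xs"
  by (simp_all add: list_product_def)

text \<open>The effect of an embedding on the entries of a pure tensor, for a given functor as well
  as for the functor built from an algebra.\<close>

definition ordered_products ::
  "('a, 'b) monoid_scheme \<Rightarrow> nat \<Rightarrow> nat \<Rightarrow> (nat \<Rightarrow> nat) \<Rightarrow> (nat \<Rightarrow> real \<Rightarrow> real) \<Rightarrow> 'a list \<Rightarrow> 'a list" where
  "ordered_products A n m \<kappa> f as = map (\<lambda>k. list_product A (map ((!) as) (fibre_list n \<kappa> f k))) [0..<m]"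

lemma length_ordered_products [simp]: "length (ordered_products A n m \<kappa> f as) = m"
  by (simp add: ordered_products_def)

lemma ordered_products_same_order:
  assumes "coord_embedding n m \<kappa> f" "same_order n \<kappa> f \<kappa>' f'"
  shows "ordered_products A n m \<kappa>' f' as = ordered_products A n m \<kappa> f as"
  by (simp add: ordered_products_def fibre_list_same_order[OF assms])

lemma ordered_products_ident:
  assumes "Group.monoid A" "set as \<subseteq> carrier A" "length as = n"
  shows "ordered_products A n n (\<lambda>i. i) f as = as"
proof (rule nth_equalityI)
  fix k assume k: "k < length (ordered_products A n n (\<lambda>i. i) f as)"
  then have "fibre_list n (\<lambda>i. i) f k = [k]" by (intro fibre_list_singleton) auto
  moreover have "as ! k \<in> carrier A" using k assms(2,3) by auto
  ultimately show "ordered_products A n n (\<lambda>i. i) f as ! k = as ! k"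
    using k monoid.r_one[OF assms(1)] by (simp add: ordered_products_def)
qed (use assms in simp)

lemma ordered_products_swap:
  assumes A: "Group.monoid A" and as: "set as \<subseteq> carrier A" "length as = n" and bs: "set bs \<subseteq> carrier A" "length bs = m"
  shows "ordered_products A (n + m) (m + n) (swap_index n m) f (as @ bs) = bs @ as"
proof (rule nth_equalityI)
  fix k assume "k < length (ordered_products A (n + m) (m + n) (swap_index n m) f (as @ bs))"
  then have k: "k < m + n" by simp
  have "fibre_list (n + m) (swap_index n m) f k = [swap_index m n k]"
    using k by (intro fibre_list_singleton) (auto simp: swap_index_def split: if_splits)
  moreover have "(as @ bs) ! swap_index m n k = (bs @ as) ! k"
    using k as bs by (auto simp: swap_index_def nth_append)
  moreover have "(bs @ as) ! k \<in> carrier A"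
    using nth_mem[of k "bs @ as"] k as bs by auto
  ultimately show "ordered_products A (n + m) (m + n) (swap_index n m) f (as @ bs) ! k = (bs @ as) ! k"
    using k monoid.r_one[OF A] by (simp add: ordered_products_def)
qed (use assms in simp)

lemma ordered_products_union:
  assumes e: "coord_embedding n m \<kappa> f" and e': "coord_embedding n' m' \<kappa>' f'" and as: "length as = n"
  shows "ordered_products A (n + n') (m + m') (union_index n m \<kappa> \<kappa>') (union_fun n f f') (as @ bs)
       = ordered_products A n m \<kappa> f as @ ordered_products A n' m' \<kappa>' f' bs"
proof -
  have eq: "map ((!) as) (fibre_list n \<kappa> f k) = map ((!) (as @ bs)) (fibre_list n \<kappa> f k)" for k
    using as by (auto simp: nth_append)
  have "ordered_products A n m \<kappa> f as =
      map (\<lambda>k. list_product A (map ((!) (as @ bs)) (fibre_list (n + n') (union_index n m \<kappa> \<kappa>') (union_fun n f f') k))) [0..<m]"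
    unfolding ordered_products_def eq by (intro map_cong refl) (simp add: fibre_list_union(1)[OF e e'])
  moreover have eq': "map ((!) bs) (fibre_list n' \<kappa>' f' k) = map ((!) (as @ bs)) (map ((+) n) (fibre_list n' \<kappa>' f' k))" for k
    using as by (auto simp: nth_append)
  have "ordered_products A n' m' \<kappa>' f' bs =
      map (\<lambda>k. list_product A (map ((!) (as @ bs)) (fibre_list (n + n') (union_index n m \<kappa> \<kappa>') (union_fun n f f') (m + k)))) [0..<m']"
    unfolding ordered_products_def fibre_list_union(2)[OF e e'] eq' ..
  moreover have "[0..<m + m'] = [0..<m] @ map ((+) m) [0..<m']"
    by (rule nth_equalityI) (auto simp: nth_append)
  ultimately show ?thesis
    by (simp only: ordered_products_def[of A "n + n'"] map_append map_map comp_def)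
qed

context
  fixes A (structure)
  assumes A: "Group.monoid A"
begin

interpretation A: Group.monoid A by (rule A)

lemma list_product_closed [simp]: "set xs \<subseteq> carrier A \<Longrightarrow> list_product A xs \<in> carrier A"
  by (induction xs) auto

lemma list_product_append:
  "set xs \<subseteq> carrier A \<Longrightarrow> set ys \<subseteq> carrier A \<Longrightarrow>
    list_product A (xs @ ys) = list_product A xs \<otimes> list_product A ys"
  by (induction xs) (auto simp: A.m_assoc)

lemma list_product_concat:
  "(\<And>xs. xs \<in> set xss \<Longrightarrow> set xs \<subseteq> carrier A) \<Longrightarrow>
    list_product A (concat xss) = list_product A (map (list_product A) xss)"
  by (induction xss) (auto simp: list_product_append UN_least)

lemma ordered_products_carrier:
  assumes "set as \<subseteq> carrier A" "length as = n"
  shows "set (ordered_products A n m \<kappa> f as) \<subseteq> carrier A"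
proof -
  have "as ! i \<in> carrier A" if "i < n" for i using assms nth_mem[of i as] that by auto
  then show ?thesis by (auto simp: ordered_products_def intro!: list_product_closed)
qed

lemma ordered_products_compose:
  assumes e: "coord_embedding n m \<kappa> f" and e': "coord_embedding m l \<kappa>' f'"
    and as: "set as \<subseteq> carrier A" "length as = n"
  shows "ordered_products A n l (\<lambda>i. \<kappa>' (\<kappa> i)) (\<lambda>i t. f' (\<kappa> i) (f i t)) as
       = ordered_products A m l \<kappa>' f' (ordered_products A n m \<kappa> f as)"
proof -
  have as_nth: "as ! i \<in> carrier A" if "i < n" for i using as nth_mem[of i as] that by auto
  have "list_product A (map ((!) as) (concat (map (fibre_list n \<kappa> f) (fibre_list m \<kappa>' f' k)))) =
        list_product A (map ((!) (ordered_products A n m \<kappa> f as)) (fibre_list m \<kappa>' f' k))" for k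
  proof -
    have "list_product A (map ((!) as) (concat (map (fibre_list n \<kappa> f) (fibre_list m \<kappa>' f' k)))) =
      list_product A (concat (map (\<lambda>c. map ((!) as) (fibre_list n \<kappa> f c)) (fibre_list m \<kappa>' f' k)))"
      by (simp add: map_concat comp_def)
    also have "\<dots> = list_product A (map (list_product A) (map (\<lambda>c. map ((!) as) (fibre_list n \<kappa> f c)) (fibre_list m \<kappa>' f' k)))"
      by (rule list_product_concat) (use as_nth in auto)
    also have "\<dots> = list_product A (map ((!) (ordered_products A n m \<kappa> f as)) (fibre_list m \<kappa>' f' k))"
      by (rule arg_cong[where f = "list_product A"]) (auto simp: ordered_products_def)
    finally show ?thesis .
  qed
  then show ?thesis
    unfolding ordered_products_def[of A n l] ordered_products_def[of A m l] fibre_list_compose[OF e e'] by simp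
qed

text \<open>Each source disk lies in exactly one fibre, so a single entry \<open>x\<close>
  influences a single output, through multiplication on both sides by fixed elements. Multilinearity
  of the formula then follows from bilinearity of the multiplication.\<close>

lemma ordered_products_slot:
  assumes e: "coord_embedding n m \<kappa> f" and us: "set us \<subseteq> carrier A" and vs: "set vs \<subseteq> carrier A"
    and n: "length us + 1 + length vs = n"
  obtains ps l r qs where "set ps \<subseteq> carrier A" "set qs \<subseteq> carrier A" "length ps + 1 + length qs = m"
    "l \<in> carrier A" "r \<in> carrier A"
    "\<And>x. x \<in> carrier A \<Longrightarrow> ordered_products A n m \<kappa> f (us @ x # vs) = ps @ (l \<otimes> (x \<otimes> r)) # qs"
proof -
  define i where "i = length us"
  have i: "i < n" using n by (simp add: i_def)
  define k where "k = \<kappa> i"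
  have k: "k < m" using coord_embeddingD(1)[OF e i] by (simp add: k_def)
  have "i \<in> set (fibre_list n \<kappa> f k)" using i by (simp add: k_def)
  then obtain ls rs where lr: "fibre_list n \<kappa> f k = ls @ i # rs" by (meson split_list)
  then have d: "i \<notin> set ls" "i \<notin> set rs" and lt: "\<forall>c\<in>set ls. c < n" "\<forall>c\<in>set rs. c < n"
    using distinct_fibre_list[of n \<kappa> f k] set_fibre_list[of n \<kappa> f k] by auto
  \<comment> \<open>The unit is a placeholder in slot \<open>i\<close>; away from \<open>i\<close>,
    entries may be read from this fixed list.\<close>
  let ?x0 = "us @ \<one> # vs"
  define g where "g c = list_product A (map ((!) ?x0) (fibre_list n \<kappa> f c))" for c
  have x0: "?x0 ! c \<in> carrier A" if "c < n" for c
    using nth_mem[of c ?x0] us vs n that by auto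
  have nth: "(us @ x # vs) ! c = ?x0 ! c" if "c \<noteq> i" for c x
    using that by (auto simp: nth_append i_def nth_Cons split: nat.split)
  have nthi: "(us @ x # vs) ! i = x" for x by (simp add: i_def)
  have other: "list_product A (map ((!) (us @ x # vs)) (fibre_list n \<kappa> f c)) = g c" if "c \<noteq> k" for c x
  proof -
    have "map ((!) (us @ x # vs)) (fibre_list n \<kappa> f c) = map ((!) ?x0) (fibre_list n \<kappa> f c)"
      using that by (auto simp: k_def intro!: nth)
    then show ?thesis unfolding g_def by (rule arg_cong)
  qed
  have g: "g c \<in> carrier A" for c
    unfolding g_def using x0 by (intro list_product_closed) auto
  define l where "l = list_product A (map ((!) ?x0) ls)"
  define r where "r = list_product A (map ((!) ?x0) rs)"
  have lrc: "set (map ((!) ?x0) ls) \<subseteq> carrier A" "set (map ((!) ?x0) rs) \<subseteq> carrier A"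
    using x0 lt by auto
  have this_k: "list_product A (map ((!) (us @ x # vs)) (fibre_list n \<kappa> f k)) = l \<otimes> (x \<otimes> r)"
    if "x \<in> carrier A" for x
  proof -
    have "map ((!) (us @ x # vs)) ls = map ((!) ?x0) ls" "map ((!) (us @ x # vs)) rs = map ((!) ?x0) rs"
      using d by (auto intro!: nth)
    then have "map ((!) (us @ x # vs)) (fibre_list n \<kappa> f k) = map ((!) ?x0) ls @ x # map ((!) ?x0) rs"
      using lr nthi by simp
    then show ?thesis using lrc that list_product_append[OF lrc(1), of "x # map ((!) ?x0) rs"] by (simp add: l_def r_def)
  qed
  show thesis
  proof (rule that[of "map g [0..<k]" "map g [Suc k..<m]" l r])
    fix x assume x: "x \<in> carrier A"
    have "[0..<m] = [0..<k] @ k # [Suc k..<m]"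
      using k by (metis le0 less_imp_le_nat upt_add_eq_append upt_conv_Cons le_add_diff_inverse add_0)
    then show "ordered_products A n m \<kappa> f (us @ x # vs) = map g [0..<k] @ (l \<otimes> (x \<otimes> r)) # map g [Suc k..<m]"
      using other this_k[OF x] by (simp add: ordered_products_def)
  qed (use g k lrc in \<open>auto simp: l_def r_def\<close>)
qed

end

lemma list_product_hom:
  assumes A: "Group.monoid A" and h: "\<And>x y. x \<in> carrier A \<Longrightarrow> y \<in> carrier A \<Longrightarrow> h (x \<otimes>\<^bsub>A\<^esub> y) = h x \<otimes>\<^bsub>B\<^esub> h y"
    "h \<one>\<^bsub>A\<^esub> = \<one>\<^bsub>B\<^esub>" and xs: "set xs \<subseteq> carrier A"
  shows "h (list_product A xs) = list_product B (map h xs)"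
  using xs by (induction xs) (auto simp: h list_product_closed[OF A])

text \<open>Applied to an algebra homomorphism, this gives naturality of the transformation that it
  induces.\<close>

lemma ordered_products_hom:
  assumes A: "Group.monoid A" and h: "\<And>x y. x \<in> carrier A \<Longrightarrow> y \<in> carrier A \<Longrightarrow> h (x \<otimes>\<^bsub>A\<^esub> y) = h x \<otimes>\<^bsub>B\<^esub> h y"
    "h \<one>\<^bsub>A\<^esub> = \<one>\<^bsub>B\<^esub>" and as: "set as \<subseteq> carrier A" "length as = n"
  shows "map h (ordered_products A n m \<kappa> f as) = ordered_products B n m \<kappa> f (map h as)"
proof -
  have "h (list_product A (map ((!) as) (fibre_list n \<kappa> f k))) = list_product B (map ((!) (map h as)) (fibre_list n \<kappa> f k))" for k
  proof -
    have "h (list_product A (map ((!) as) (fibre_list n \<kappa> f k))) = list_product B (map h (map ((!) as) (fibre_list n \<kappa> f k)))"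
      by (rule list_product_hom[OF A h]) (use as in auto)
    also have "map h (map ((!) as) (fibre_list n \<kappa> f k)) = map ((!) (map h as)) (fibre_list n \<kappa> f k)"
      using as by auto
    finally show ?thesis .
  qed
  then show ?thesis by (simp add: ordered_products_def)
qed

lemma ordered_products_empty: "ordered_products A 0 m \<kappa> f [] = replicate m \<one>\<^bsub>A\<^esub>"
  by (rule nth_equalityI) (simp_all add: ordered_products_def fibre_list_def)

lemma ordered_products_fold:
  assumes "Group.monoid A" "a \<in> carrier A" "b \<in> carrier A"
  shows "ordered_products A 2 1 (\<lambda>i. 0) fold_fun [a, b] = [a \<otimes>\<^bsub>A\<^esub> b]"
proof -
  have "fibre_list 2 (\<lambda>i. 0) fold_fun 0 = [0, 1]"
    using fold_fun_less[of 0 0 0] by (intro fibre_list_eqI) auto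
  then show ?thesis using monoid.r_one[OF assms(1,3)] by (simp add: ordered_products_def)
qed

section \<open>Tensor products\<close>

lemma linear_mapsD:
  assumes "f \<in> linear_maps K V W"
  shows "x \<in> carrier V \<Longrightarrow> f x \<in> carrier W"
    and "x \<in> carrier V \<Longrightarrow> y \<in> carrier V \<Longrightarrow> f (x \<oplus>\<^bsub>V\<^esub> y) = f x \<oplus>\<^bsub>W\<^esub> f y"
    and "a \<in> carrier K \<Longrightarrow> x \<in> carrier V \<Longrightarrow> f (a \<odot>\<^bsub>V\<^esub> x) = a \<odot>\<^bsub>W\<^esub> f x"
    and "f \<in> extensional (carrier V)"
  using assms unfolding linear_maps_def by (auto simp: PiE_def)

lemma linear_mapsI:
  assumes "\<And>x. x \<in> carrier V \<Longrightarrow> f x \<in> carrier W"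
    and "\<And>x y. x \<in> carrier V \<Longrightarrow> y \<in> carrier V \<Longrightarrow> f (x \<oplus>\<^bsub>V\<^esub> y) = f x \<oplus>\<^bsub>W\<^esub> f y"
    and "\<And>a x. a \<in> carrier K \<Longrightarrow> x \<in> carrier V \<Longrightarrow> f (a \<odot>\<^bsub>V\<^esub> x) = a \<odot>\<^bsub>W\<^esub> f x"
    and "f \<in> extensional (carrier V)"
  shows "f \<in> linear_maps K V W"
  using assms unfolding linear_maps_def by (auto simp: PiE_def)

lemma module_closed:
  assumes "Module.module K V"
  shows "x \<in> carrier V \<Longrightarrow> y \<in> carrier V \<Longrightarrow> x \<oplus>\<^bsub>V\<^esub> y \<in> carrier V"
    and "a \<in> carrier K \<Longrightarrow> x \<in> carrier V \<Longrightarrow> a \<odot>\<^bsub>V\<^esub> x \<in> carrier V"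
    and "\<zero>\<^bsub>V\<^esub> \<in> carrier V"
proof -
  interpret Module.module K V by fact
  show "x \<in> carrier V \<Longrightarrow> y \<in> carrier V \<Longrightarrow> x \<oplus>\<^bsub>V\<^esub> y \<in> carrier V"
    "a \<in> carrier K \<Longrightarrow> x \<in> carrier V \<Longrightarrow> a \<odot>\<^bsub>V\<^esub> x \<in> carrier V" "\<zero>\<^bsub>V\<^esub> \<in> carrier V" by simp_all
qed

lemma linear_mapsI_restrict:
  assumes V: "Module.module K V"
    and "\<And>x. x \<in> carrier V \<Longrightarrow> f x \<in> carrier W"
    and "\<And>x y. x \<in> carrier V \<Longrightarrow> y \<in> carrier V \<Longrightarrow> f (x \<oplus>\<^bsub>V\<^esub> y) = f x \<oplus>\<^bsub>W\<^esub> f y"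
    and "\<And>a x. a \<in> carrier K \<Longrightarrow> x \<in> carrier V \<Longrightarrow> f (a \<odot>\<^bsub>V\<^esub> x) = a \<odot>\<^bsub>W\<^esub> f x"
  shows "restrict f (carrier V) \<in> linear_maps K V W"
  using assms module_closed[OF V] by (intro linear_mapsI) auto

lemma linear_maps_ident: "Module.module K V \<Longrightarrow> restrict (\<lambda>x. x) (carrier V) \<in> linear_maps K V V"
  by (rule linear_mapsI_restrict) auto

lemma linear_maps_compose:
  assumes V: "Module.module K V" and f: "f \<in> linear_maps K V W" and g: "g \<in> linear_maps K W U"
  shows "compose (carrier V) g f \<in> linear_maps K V U"
  unfolding compose_def using linear_mapsD[OF f] linear_mapsD[OF g]
  by (intro linear_mapsI_restrict[OF V]) auto

lemma linear_maps_zero: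
  assumes V: "Module.module K V" and W: "Module.module K W" and f: "f \<in> linear_maps K V W"
  shows "f \<zero>\<^bsub>V\<^esub> = \<zero>\<^bsub>W\<^esub>"
proof -
  interpret V: Module.module K V by fact
  interpret W: Module.module K W by fact
  have "f (\<zero>\<^bsub>K\<^esub> \<odot>\<^bsub>V\<^esub> \<zero>\<^bsub>V\<^esub>) = \<zero>\<^bsub>K\<^esub> \<odot>\<^bsub>W\<^esub> f \<zero>\<^bsub>V\<^esub>"
    by (rule linear_mapsD(3)[OF f]) auto
  then show ?thesis using linear_mapsD(1)[OF f] by simp
qed

lemma linear_isosD:
  assumes "f \<in> linear_isos K V W"
  shows "f \<in> linear_maps K V W" "bij_betw f (carrier V) (carrier W)"
  using assms by (simp_all add: linear_isos_def)

lemma linear_isos_inverse: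
  assumes V: "Module.module K V" and W: "Module.module K W" and f: "f \<in> linear_isos K V W"
  obtains g where "g \<in> linear_isos K W V" "\<forall>x\<in>carrier V. g (f x) = x" "\<forall>y\<in>carrier W. f (g y) = y"
proof -
  note L = linear_mapsD[OF linear_isosD(1)[OF f]] and B = linear_isosD(2)[OF f]
  define g where "g = restrict (inv_into (carrier V) f) (carrier W)"
  have gf: "g (f x) = x" if "x \<in> carrier V" for x
    using that L(1) bij_betw_inv_into_left[OF B] by (simp add: g_def)
  have fg: "f (g y) = y" and gV: "g y \<in> carrier V" if "y \<in> carrier W" for y
    using that bij_betw_inv_into_right[OF B] bij_betw_imp_surj_on[OF B] by (simp_all add: g_def inv_into_into)
  have inj: "x = y" if "f x = f y" "x \<in> carrier V" "y \<in> carrier V" for x y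
    using that bij_betw_imp_inj_on[OF B] by (simp add: inj_onD)
  have "g \<in> linear_maps K W V"
  proof (rule linear_mapsI)
    show "g (x \<oplus>\<^bsub>W\<^esub> y) = g x \<oplus>\<^bsub>V\<^esub> g y" if "x \<in> carrier W" "y \<in> carrier W" for x y
      using that L(2)[OF gV gV] fg gV module_closed(1)[OF V gV gV] module_closed(1)[OF W]
      by (intro inj) simp_all
    show "g (a \<odot>\<^bsub>W\<^esub> x) = a \<odot>\<^bsub>V\<^esub> g x" if "a \<in> carrier K" "x \<in> carrier W" for a x
      using that L(3)[OF _ gV] fg gV module_closed(2)[OF V _ gV] module_closed(2)[OF W]
      by (intro inj) simp_all
  qed (use gV in \<open>auto simp: g_def\<close>)
  moreover have "bij_betw g (carrier W) (carrier V)"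
    using gf fg gV L(1) by (intro bij_betw_byWitness[where f' = f]) auto
  ultimately show thesis using that[of g] gf fg by (simp add: linear_isos_def)
qed

lemma linear_isos_compose:
  assumes V: "Module.module K V" and f: "f \<in> linear_isos K V W" and g: "g \<in> linear_isos K W U"
  shows "compose (carrier V) g f \<in> linear_isos K V U"
  using linear_maps_compose[OF V linear_isosD(1)[OF f] linear_isosD(1)[OF g]]
    bij_betw_compose[OF linear_isosD(2)[OF f] linear_isosD(2)[OF g]]
  by (simp add: linear_isos_def)

text \<open>The operations of a module, its negatives and its laws pass to the image of any
  surjection that respects the operations. Cosets, copies along an injection and the algebra on
  \<open>F [D]\<close> all become modules this way.\<close>

lemma module_surj:
  fixes Q :: "('k, 'w, 'x) module_scheme"
  assumes M: "Module.module K M" and carrier: "carrier Q = p ` carrier M"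
    and add: "\<And>x y. x \<in> carrier M \<Longrightarrow> y \<in> carrier M \<Longrightarrow> p x \<oplus>\<^bsub>Q\<^esub> p y = p (x \<oplus>\<^bsub>M\<^esub> y)"
    and smult: "\<And>a x. a \<in> carrier K \<Longrightarrow> x \<in> carrier M \<Longrightarrow> a \<odot>\<^bsub>Q\<^esub> p x = p (a \<odot>\<^bsub>M\<^esub> x)"
    and zero: "\<zero>\<^bsub>Q\<^esub> = p \<zero>\<^bsub>M\<^esub>"
  shows "Module.module K Q"
proof -
  interpret M: Module.module K M by fact
  have ag: "abelian_group Q"
  proof (rule abelian_groupI)
    fix x assume "x \<in> carrier Q"
    then obtain x' where x': "x' \<in> carrier M" "x = p x'" by (auto simp: carrier)
    then show "\<exists>y\<in>carrier Q. y \<oplus>\<^bsub>Q\<^esub> x = \<zero>\<^bsub>Q\<^esub>"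
      using add[of "\<ominus>\<^bsub>M\<^esub> x'" x'] zero M.M.l_neg by (intro bexI[of _ "p (\<ominus>\<^bsub>M\<^esub> x')"]) (auto simp: carrier)
  qed (auto simp: carrier add zero M.M.a_ac)
  show ?thesis
    by (rule moduleI[OF M.is_cring ag])
      (auto simp: carrier add smult M.smult_l_distr M.smult_r_distr M.smult_assoc1)
qed

text \<open>Generation is encoded as an induction principle, which avoids linear combinations. Zero
  is not among the closure conditions: it is reached as \<open>\<zero>\<close> times a generator, so
  the empty set spans no module.\<close>

definition spans :: "('k, 'm) ring_scheme \<Rightarrow> ('k, 'v, 'r) module_scheme \<Rightarrow> 'v set \<Rightarrow> bool" where
  "spans K V S \<longleftrightarrow> (\<forall>P. (\<forall>x\<in>S. P x) \<longrightarrow>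
     (\<forall>x\<in>carrier V. \<forall>y\<in>carrier V. P x \<longrightarrow> P y \<longrightarrow> P (x \<oplus>\<^bsub>V\<^esub> y)) \<longrightarrow>
     (\<forall>a\<in>carrier K. \<forall>x\<in>carrier V. P x \<longrightarrow> P (a \<odot>\<^bsub>V\<^esub> x)) \<longrightarrow> (\<forall>x\<in>carrier V. P x))"

lemma spans_induct [consumes 2, case_names gen add smult]:
  assumes "spans K V S" "x \<in> carrier V" "\<And>x. x \<in> S \<Longrightarrow> P x"
    and "\<And>x y. x \<in> carrier V \<Longrightarrow> y \<in> carrier V \<Longrightarrow> P x \<Longrightarrow> P y \<Longrightarrow> P (x \<oplus>\<^bsub>V\<^esub> y)"
    and "\<And>a x. a \<in> carrier K \<Longrightarrow> x \<in> carrier V \<Longrightarrow> P x \<Longrightarrow> P (a \<odot>\<^bsub>V\<^esub> x)"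
  shows "P x"
proof -
  have "(\<forall>x\<in>S. P x) \<longrightarrow>
     (\<forall>x\<in>carrier V. \<forall>y\<in>carrier V. P x \<longrightarrow> P y \<longrightarrow> P (x \<oplus>\<^bsub>V\<^esub> y)) \<longrightarrow>
     (\<forall>a\<in>carrier K. \<forall>x\<in>carrier V. P x \<longrightarrow> P (a \<odot>\<^bsub>V\<^esub> x)) \<longrightarrow> (\<forall>x\<in>carrier V. P x)"
    using assms(1) unfolding spans_def by (rule spec)
  then show ?thesis using assms(2-5) by simp
qed

lemma spansI:
  assumes "\<And>P x. \<lbrakk>\<And>x. x \<in> S \<Longrightarrow> P x; \<And>x y. x \<in> carrier V \<Longrightarrow> y \<in> carrier V \<Longrightarrow> P x \<Longrightarrow> P y \<Longrightarrow> P (x \<oplus>\<^bsub>V\<^esub> y);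
     \<And>a x. a \<in> carrier K \<Longrightarrow> x \<in> carrier V \<Longrightarrow> P x \<Longrightarrow> P (a \<odot>\<^bsub>V\<^esub> x); x \<in> carrier V\<rbrakk> \<Longrightarrow> P x"
  shows "spans K V S"
  unfolding spans_def by (intro allI impI ballI, rule assms) simp_all

lemma spans_linear_agree:
  assumes "spans K V S" "f \<in> linear_maps K V W" "g \<in> linear_maps K V W" "\<And>x. x \<in> S \<Longrightarrow> f x = g x"
    "x \<in> carrier V"
  shows "f x = g x"
  using assms(1,5)
  by (induction rule: spans_induct) (use assms(2-4) linear_mapsD(2,3) in \<open>metis+\<close>)

lemma spans_surj:
  assumes S: "spans K V S" and f: "f \<in> linear_maps K V W" and onto: "f ` carrier V = carrier W"
  shows "spans K W (f ` S)"
proof (rule spansI)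
  fix P y assume gen: "\<And>x. x \<in> f ` S \<Longrightarrow> P x"
    and add: "\<And>x y. x \<in> carrier W \<Longrightarrow> y \<in> carrier W \<Longrightarrow> P x \<Longrightarrow> P y \<Longrightarrow> P (x \<oplus>\<^bsub>W\<^esub> y)"
    and smult: "\<And>a x. a \<in> carrier K \<Longrightarrow> x \<in> carrier W \<Longrightarrow> P x \<Longrightarrow> P (a \<odot>\<^bsub>W\<^esub> x)"
    and y: "y \<in> carrier W"
  obtain x where x: "x \<in> carrier V" "y = f x" using y onto by auto
  have "P (f x)" using S x(1)
  proof (induction rule: spans_induct)
    case (add x y)
    then show ?case using assms(2) by (simp add: linear_mapsD \<open>\<And>x y. x \<in> carrier W \<Longrightarrow> y \<in> carrier W \<Longrightarrow> P x \<Longrightarrow> P y \<Longrightarrow> P (x \<oplus>\<^bsub>W\<^esub> y)\<close>)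
  next
    case (smult a x)
    then show ?case using assms(2) by (simp add: linear_mapsD \<open>\<And>a x. a \<in> carrier K \<Longrightarrow> x \<in> carrier W \<Longrightarrow> P x \<Longrightarrow> P (a \<odot>\<^bsub>W\<^esub> x)\<close>)
  qed (use gen in auto)
  then show "P y" using x by simp
qed

text \<open>The partial maps are restricted because members of \<open>linear_maps\<close> are
  extensional.\<close>

definition bilinear ::
  "('k, 'm) ring_scheme \<Rightarrow> ('k, 'v, 'r) module_scheme \<Rightarrow> ('k, 'w, 's) module_scheme \<Rightarrow>
    ('k, 'u, 't) module_scheme \<Rightarrow> ('v \<Rightarrow> 'w \<Rightarrow> 'u) \<Rightarrow> bool" where
  "bilinear K V W U b \<longleftrightarrow>
     (\<forall>x\<in>carrier V. restrict (b x) (carrier W) \<in> linear_maps K W U) \<and>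
     (\<forall>y\<in>carrier W. restrict (\<lambda>x. b x y) (carrier V) \<in> linear_maps K V U)"

lemma bilinearI:
  assumes V: "Module.module K V" and W: "Module.module K W"
    and "\<And>x y. x \<in> carrier V \<Longrightarrow> y \<in> carrier W \<Longrightarrow> b x y \<in> carrier U"
    and "\<And>x x' y. x \<in> carrier V \<Longrightarrow> x' \<in> carrier V \<Longrightarrow> y \<in> carrier W \<Longrightarrow> b (x \<oplus>\<^bsub>V\<^esub> x') y = b x y \<oplus>\<^bsub>U\<^esub> b x' y"
    and "\<And>x y y'. x \<in> carrier V \<Longrightarrow> y \<in> carrier W \<Longrightarrow> y' \<in> carrier W \<Longrightarrow> b x (y \<oplus>\<^bsub>W\<^esub> y') = b x y \<oplus>\<^bsub>U\<^esub> b x y'"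
    and "\<And>a x y. a \<in> carrier K \<Longrightarrow> x \<in> carrier V \<Longrightarrow> y \<in> carrier W \<Longrightarrow> b (a \<odot>\<^bsub>V\<^esub> x) y = a \<odot>\<^bsub>U\<^esub> b x y"
    and "\<And>a x y. a \<in> carrier K \<Longrightarrow> x \<in> carrier V \<Longrightarrow> y \<in> carrier W \<Longrightarrow> b x (a \<odot>\<^bsub>W\<^esub> y) = a \<odot>\<^bsub>U\<^esub> b x y"
  shows "bilinear K V W U b"
  unfolding bilinear_def using assms(3-) by (auto intro!: linear_mapsI_restrict V W)

lemma bilinearD:
  assumes b: "bilinear K V W U b" and V: "Module.module K V" and W: "Module.module K W"
    and x: "x \<in> carrier V" and y: "y \<in> carrier W"
  shows "b x y \<in> carrier U"
    and "x' \<in> carrier V \<Longrightarrow> b (x \<oplus>\<^bsub>V\<^esub> x') y = b x y \<oplus>\<^bsub>U\<^esub> b x' y"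
    and "y' \<in> carrier W \<Longrightarrow> b x (y \<oplus>\<^bsub>W\<^esub> y') = b x y \<oplus>\<^bsub>U\<^esub> b x y'"
    and "a \<in> carrier K \<Longrightarrow> b (a \<odot>\<^bsub>V\<^esub> x) y = a \<odot>\<^bsub>U\<^esub> b x y"
    and "a \<in> carrier K \<Longrightarrow> b x (a \<odot>\<^bsub>W\<^esub> y) = a \<odot>\<^bsub>U\<^esub> b x y"
proof -
  have l: "restrict (b x) (carrier W) \<in> linear_maps K W U" and r: "restrict (\<lambda>x. b x y) (carrier V) \<in> linear_maps K V U"
    using b x y unfolding bilinear_def by blast+
  show "b x y \<in> carrier U" using linear_mapsD(1)[OF l y] y by simp
  show "x' \<in> carrier V \<Longrightarrow> b (x \<oplus>\<^bsub>V\<^esub> x') y = b x y \<oplus>\<^bsub>U\<^esub> b x' y"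
    using linear_mapsD(2)[OF r x] module_closed(1)[OF V x] x by simp
  show "y' \<in> carrier W \<Longrightarrow> b x (y \<oplus>\<^bsub>W\<^esub> y') = b x y \<oplus>\<^bsub>U\<^esub> b x y'"
    using linear_mapsD(2)[OF l y] module_closed(1)[OF W y] y by simp
  show "a \<in> carrier K \<Longrightarrow> b (a \<odot>\<^bsub>V\<^esub> x) y = a \<odot>\<^bsub>U\<^esub> b x y"
    using linear_mapsD(3)[OF r _ x] module_closed(2)[OF V _ x] x by simp
  show "a \<in> carrier K \<Longrightarrow> b x (a \<odot>\<^bsub>W\<^esub> y) = a \<odot>\<^bsub>U\<^esub> b x y"
    using linear_mapsD(3)[OF l _ y] module_closed(2)[OF W _ y] y by simp
qed

lemma bilinear_compose:
  assumes b: "bilinear K V' W' U b" and V: "Module.module K V" and W: "Module.module K W"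
    and V': "Module.module K V'" and W': "Module.module K W'"
    and f: "f \<in> linear_maps K V V'" and h: "h \<in> linear_maps K W W'"
  shows "bilinear K V W U (\<lambda>x y. b (f x) (h y))"
  using linear_mapsD[OF f] linear_mapsD[OF h] bilinearD[OF b V' W']
  by (intro bilinearI[OF V W]) auto

lemma bilinear_flip: "bilinear K V W U b \<Longrightarrow> bilinear K W V U (\<lambda>y x. b x y)"
  unfolding bilinear_def by blast

text \<open>Linear extension in one variable at a time: first in \<open>y\<close> for a generator
  \<open>x\<close>, then in \<open>x\<close> for every \<open>y\<close>.\<close>

lemma bilinear_agree:
  assumes V: "Module.module K V" and W: "Module.module K W"
    and S: "spans K V S" "S \<subseteq> carrier V" and T: "spans K W T"
    and b: "bilinear K V W U b" and c: "bilinear K V W U c"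
    and eq: "\<And>x y. x \<in> S \<Longrightarrow> y \<in> T \<Longrightarrow> b x y = c x y"
    and T': "T \<subseteq> carrier W" and x: "x \<in> carrier V" and y: "y \<in> carrier W"
  shows "b x y = c x y"
proof -
  have 1: "b x y = c x y" if "x \<in> S" "y \<in> carrier W" for x y
    using spans_linear_agree[OF T, of "restrict (b x) (carrier W)" U "restrict (c x) (carrier W)" y]
      b c eq that S(2) T' unfolding bilinear_def by (auto simp: subset_iff)
  show ?thesis
    using spans_linear_agree[OF S(1), of "restrict (\<lambda>x. b x y) (carrier V)" U "restrict (\<lambda>x. c x y) (carrier V)" x]
      b c 1 x y S(2) unfolding bilinear_def by (auto simp: subset_iff)
qed

section \<open>Free modules and quotients\<close>

lemma free_space_module:
  assumes "cring K" shows "Module.module K (free_space K B)"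
proof -
  interpret K: cring K by fact
  have fin: "finite {b. f b \<oplus>\<^bsub>K\<^esub> g b \<noteq> \<zero>\<^bsub>K\<^esub>}" if "finite {b. f b \<noteq> \<zero>\<^bsub>K\<^esub>}" "finite {b. g b \<noteq> \<zero>\<^bsub>K\<^esub>}"
    for f g :: "'c \<Rightarrow> 'a"
    by (rule finite_subset[OF _ finite_UnI[OF that]]) auto
  have fins: "finite {b. a \<otimes>\<^bsub>K\<^esub> f b \<noteq> \<zero>\<^bsub>K\<^esub>}" if "finite {b. f b \<noteq> \<zero>\<^bsub>K\<^esub>}" "a \<in> carrier K"
    for a and f :: "'c \<Rightarrow> 'a"
    by (rule finite_subset[OF _ that(1)]) (use that(2) in auto)
  have car: "f b \<in> carrier K" if "\<forall>b\<in>B. f b \<in> carrier K" "\<forall>b. b \<notin> B \<longrightarrow> f b = \<zero>\<^bsub>K\<^esub>" for f b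
    using that by (cases "b \<in> B") auto
  have ag: "abelian_group (free_space K B)"
  proof (rule abelian_groupI)
    fix f assume f: "f \<in> carrier (free_space K B)"
    have "finite {b. \<ominus>\<^bsub>K\<^esub> f b \<noteq> \<zero>\<^bsub>K\<^esub>}"
      by (rule finite_subset[of _ "{b. f b \<noteq> \<zero>\<^bsub>K\<^esub>}"]) (use f in \<open>auto simp: free_space_def\<close>)
    then show "\<exists>g\<in>carrier (free_space K B). g \<oplus>\<^bsub>free_space K B\<^esub> f = \<zero>\<^bsub>free_space K B\<^esub>"
      using f car[of f] by (intro bexI[of _ "\<lambda>b. \<ominus>\<^bsub>K\<^esub> f b"]) (auto simp: free_space_def K.l_neg)
  qed (use fin car in \<open>auto simp: free_space_def K.a_ac intro!: ext\<close>)
  show ?thesis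
    by (rule moduleI[OF assms ag])
      (use fins car in \<open>auto simp: free_space_def K.l_distr K.r_distr K.m_assoc intro!: ext\<close>)
qed

lemma basis_vec_in:
  assumes "cring K" "b \<in> B" shows "basis_vec K b \<in> carrier (free_space K B)"
proof -
  interpret K: cring K by fact
  have "finite {b'. basis_vec K b b' \<noteq> \<zero>\<^bsub>K\<^esub>}"
    by (rule finite_subset[of _ "{b}"]) (auto simp: basis_vec_def)
  then show ?thesis using assms(2) by (auto simp: free_space_def basis_vec_def)
qed

text \<open>Induction on a finite set containing the support, splitting off one basis vector at a
  time. The zero function is \<open>\<zero>\<close> times some basis vector, and here
  \<open>B\<close> must not be empty.\<close>

lemma free_space_spans:
  assumes "cring K" "B \<noteq> {}" shows "spans K (free_space K B) (basis_vec K ` B)"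
proof (rule spansI)
  interpret K: cring K by fact
  interpret F: Module.module K "free_space K B" using free_space_module[OF assms(1)] .
  fix P f assume gen: "\<And>x. x \<in> basis_vec K ` B \<Longrightarrow> P x"
    and add: "\<And>x y. x \<in> carrier (free_space K B) \<Longrightarrow> y \<in> carrier (free_space K B) \<Longrightarrow> P x \<Longrightarrow> P y \<Longrightarrow>
       P (x \<oplus>\<^bsub>free_space K B\<^esub> y)"
    and smult: "\<And>a x. a \<in> carrier K \<Longrightarrow> x \<in> carrier (free_space K B) \<Longrightarrow> P x \<Longrightarrow> P (a \<odot>\<^bsub>free_space K B\<^esub> x)"
    and f: "f \<in> carrier (free_space K B)"
  have "\<lbrakk>finite S; f \<in> carrier (free_space K B); {b. f b \<noteq> \<zero>\<^bsub>K\<^esub>} \<subseteq> S\<rbrakk> \<Longrightarrow> P f" for f S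
  proof (induction S arbitrary: f rule: finite_induct)
    case empty
    obtain b where b: "b \<in> B" using assms(2) by auto
    have "f = \<zero>\<^bsub>K\<^esub> \<odot>\<^bsub>free_space K B\<^esub> basis_vec K b"
      using empty by (intro ext) (auto simp: free_space_def basis_vec_def)
    then show ?case using smult[OF K.zero_closed basis_vec_in[OF assms(1) b]] gen b by auto
  next
    case (insert b S)
    have fb: "f b' \<in> carrier K" for b'
      using insert.prems(1) by (cases "b' \<in> B") (auto simp: free_space_def)
    show ?case
    proof (cases "b \<in> B")
      case False
      then have "f b = \<zero>\<^bsub>K\<^esub>" using insert.prems(1) by (auto simp: free_space_def)
      then show ?thesis using insert by blast
    next
      case True
      define g where "g = f(b := \<zero>\<^bsub>K\<^esub>)"
      have "finite {b. g b \<noteq> \<zero>\<^bsub>K\<^esub>}"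
        by (rule finite_subset[OF _ insert.hyps(1)]) (use insert.prems(2) in \<open>auto simp: g_def\<close>)
      then have g: "g \<in> carrier (free_space K B)" using insert.prems(1) by (auto simp: g_def free_space_def)
      have Pg: "P g" by (rule insert.IH[OF g]) (use insert.prems(2) in \<open>auto simp: g_def\<close>)
      have feq: "g \<oplus>\<^bsub>free_space K B\<^esub> f b \<odot>\<^bsub>free_space K B\<^esub> basis_vec K b = f"
        using fb by (intro ext) (auto simp: g_def free_space_def basis_vec_def)
      have "f b \<odot>\<^bsub>free_space K B\<^esub> basis_vec K b \<in> carrier (free_space K B)"
        using fb basis_vec_in[OF assms(1) True] by simp
      then have "P (g \<oplus>\<^bsub>free_space K B\<^esub> f b \<odot>\<^bsub>free_space K B\<^esub> basis_vec K b)"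
        using add[OF g _ Pg smult[OF fb basis_vec_in[OF assms(1) True] gen]] True by blast
      then show ?thesis unfolding feq .
    qed
  qed
  from this[OF _ f subset_refl] show "P f" using f by (simp add: free_space_def)
qed

lemma free_space_universal:
  assumes U: "Module.module K U" and \<phi>: "\<And>b. b \<in> B \<Longrightarrow> \<phi> b \<in> carrier U"
  obtains l where "l \<in> linear_maps K (free_space K B) U" "\<And>b. b \<in> B \<Longrightarrow> l (basis_vec K b) = \<phi> b"
proof -
  interpret U: Module.module K U by fact
  interpret F: Module.module K "free_space K B" using free_space_module[OF U.is_cring] .
  define l where "l f = finsum U (\<lambda>b. f b \<odot>\<^bsub>U\<^esub> \<phi> b) {b. f b \<noteq> \<zero>\<^bsub>K\<^esub>}" for f
  have supp: "{b. f b \<noteq> \<zero>\<^bsub>K\<^esub>} \<subseteq> B" "finite {b. f b \<noteq> \<zero>\<^bsub>K\<^esub>}" and fb: "b \<in> B \<Longrightarrow> f b \<in> carrier K"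
    if "f \<in> carrier (free_space K B)" for f b
    using that by (auto simp: free_space_def)
  \<comment> \<open>Terms with vanishing coefficient may be added, so that \<open>f\<close>,
    \<open>g\<close> and their sum can be evaluated over one common index set.\<close>
  have l_S: "l f = finsum U (\<lambda>b. f b \<odot>\<^bsub>U\<^esub> \<phi> b) S"
    if f: "f \<in> carrier (free_space K B)" and S: "finite S" "{b. f b \<noteq> \<zero>\<^bsub>K\<^esub>} \<subseteq> S" "S \<subseteq> B" for f S
    unfolding l_def
    by (rule U.add.finprod_mono_neutral_cong_left) (use S fb[OF f] \<phi> in auto)
  show thesis
  proof (rule that)
    show "restrict l (carrier (free_space K B)) \<in> linear_maps K (free_space K B) U"
    proof (rule linear_mapsI_restrict[OF F.module_axioms])
      fix f assume f: "f \<in> carrier (free_space K B)"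
      show "l f \<in> carrier U" unfolding l_def using supp[OF f] fb[OF f] \<phi> by (intro U.finsum_closed) auto
    next
      fix f g assume f: "f \<in> carrier (free_space K B)" and g: "g \<in> carrier (free_space K B)"
      let ?S = "{b. f b \<noteq> \<zero>\<^bsub>K\<^esub>} \<union> {b. g b \<noteq> \<zero>\<^bsub>K\<^esub>}"
      have S: "finite ?S" "?S \<subseteq> B" using supp f g by auto
      have fg: "f \<oplus>\<^bsub>free_space K B\<^esub> g \<in> carrier (free_space K B)" using f g by simp
      have "l (f \<oplus>\<^bsub>free_space K B\<^esub> g) = finsum U (\<lambda>b. (f \<oplus>\<^bsub>free_space K B\<^esub> g) b \<odot>\<^bsub>U\<^esub> \<phi> b) ?S"
        by (rule l_S[OF fg S(1) _ S(2)]) (auto simp: free_space_def)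
      also have "\<dots> = finsum U (\<lambda>b. f b \<odot>\<^bsub>U\<^esub> \<phi> b \<oplus>\<^bsub>U\<^esub> g b \<odot>\<^bsub>U\<^esub> \<phi> b) ?S"
      proof (rule U.finsum_cong')
        fix b assume "b \<in> ?S"
        then have "b \<in> B" using S(2) by blast
        then show "(f \<oplus>\<^bsub>free_space K B\<^esub> g) b \<odot>\<^bsub>U\<^esub> \<phi> b = f b \<odot>\<^bsub>U\<^esub> \<phi> b \<oplus>\<^bsub>U\<^esub> g b \<odot>\<^bsub>U\<^esub> \<phi> b"
          using U.smult_l_distr[OF fb[OF f] fb[OF g] \<phi>] by (simp add: free_space_def)
      qed (use fb[OF f] fb[OF g] \<phi> S(2) in auto)
      also have "\<dots> = finsum U (\<lambda>b. f b \<odot>\<^bsub>U\<^esub> \<phi> b) ?S \<oplus>\<^bsub>U\<^esub> finsum U (\<lambda>b. g b \<odot>\<^bsub>U\<^esub> \<phi> b) ?S"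
        using S(2) fb[OF f] fb[OF g] \<phi> by (intro U.finsum_addf) auto
      also have "\<dots> = l f \<oplus>\<^bsub>U\<^esub> l g"
        using l_S[OF f S(1) _ S(2)] l_S[OF g S(1) _ S(2)] by auto
      finally show "l (f \<oplus>\<^bsub>free_space K B\<^esub> g) = l f \<oplus>\<^bsub>U\<^esub> l g" .
    next
      fix a f assume a: "a \<in> carrier K" and f: "f \<in> carrier (free_space K B)"
      let ?S = "{b. f b \<noteq> \<zero>\<^bsub>K\<^esub>}"
      have af: "a \<odot>\<^bsub>free_space K B\<^esub> f \<in> carrier (free_space K B)" using a f by simp
      have "l (a \<odot>\<^bsub>free_space K B\<^esub> f) = finsum U (\<lambda>b. (a \<odot>\<^bsub>free_space K B\<^esub> f) b \<odot>\<^bsub>U\<^esub> \<phi> b) ?S"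
        by (rule l_S[OF af supp(2)[OF f] _ supp(1)[OF f]]) (use a in \<open>auto simp: free_space_def\<close>)
      also have "\<dots> = finsum U (\<lambda>b. a \<odot>\<^bsub>U\<^esub> (f b \<odot>\<^bsub>U\<^esub> \<phi> b)) ?S"
      proof (rule U.finsum_cong')
        fix b assume "b \<in> ?S"
        then have "b \<in> B" using supp(1)[OF f] by blast
        then show "(a \<odot>\<^bsub>free_space K B\<^esub> f) b \<odot>\<^bsub>U\<^esub> \<phi> b = a \<odot>\<^bsub>U\<^esub> (f b \<odot>\<^bsub>U\<^esub> \<phi> b)"
          using U.smult_assoc1[OF a fb[OF f] \<phi>] by (simp add: free_space_def)
      qed (use fb[OF f] \<phi> supp(1)[OF f] a in auto)
      also have "\<dots> = a \<odot>\<^bsub>U\<^esub> l f"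
        unfolding l_def using supp[OF f] fb[OF f] \<phi> a by (intro U.finsum_smult_ldistr[symmetric]) auto
      finally show "l (a \<odot>\<^bsub>free_space K B\<^esub> f) = a \<odot>\<^bsub>U\<^esub> l f" .
    qed
    fix b assume b: "b \<in> B"
    have bv: "basis_vec K b \<in> carrier (free_space K B)" using basis_vec_in[OF U.is_cring b] .
    have "l (basis_vec K b) = finsum U (\<lambda>b'. basis_vec K b b' \<odot>\<^bsub>U\<^esub> \<phi> b') {b}"
      by (rule l_S[OF bv]) (use b in \<open>auto simp: basis_vec_def\<close>)
    also have "\<dots> = \<phi> b" using \<phi>[OF b] by (simp add: basis_vec_def)
    finally show "restrict l (carrier (free_space K B)) (basis_vec K b) = \<phi> b" using bv by simp
  qed
qed

lemma submoduleD:
  assumes M: "Module.module K M" and H: "submodule H K M"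
  shows "H \<subseteq> carrier M" "\<zero>\<^bsub>M\<^esub> \<in> H"
    and "x \<in> H \<Longrightarrow> y \<in> H \<Longrightarrow> x \<oplus>\<^bsub>M\<^esub> y \<in> H"
    and "a \<in> carrier K \<Longrightarrow> x \<in> H \<Longrightarrow> a \<odot>\<^bsub>M\<^esub> x \<in> H"
    and "x \<in> H \<Longrightarrow> \<ominus>\<^bsub>M\<^esub> x \<in> H"
proof -
  interpret M: Module.module K M by fact
  show "H \<subseteq> carrier M" "x \<in> H \<Longrightarrow> y \<in> H \<Longrightarrow> x \<oplus>\<^bsub>M\<^esub> y \<in> H"
    "a \<in> carrier K \<Longrightarrow> x \<in> H \<Longrightarrow> a \<odot>\<^bsub>M\<^esub> x \<in> H" "x \<in> H \<Longrightarrow> \<ominus>\<^bsub>M\<^esub> x \<in> H"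
    using M.submoduleE[OF H] by blast+
  show "\<zero>\<^bsub>M\<^esub> \<in> H" using subgroup.one_closed[OF submodule.axioms(1)[OF H]] by simp
qed

lemma submodule_submodule_span:
  assumes M: "Module.module K M" and S: "S \<subseteq> carrier M"
  shows "submodule (submodule_span K M S) K M"
proof -
  interpret M: Module.module K M by fact
  have "submodule (carrier M) K M" by (rule M.submoduleI) auto
  then have "submodule_span K M S \<subseteq> carrier M" unfolding submodule_span_def using S by auto
  then show ?thesis
    using submoduleD[OF M] by (intro M.submoduleI) (auto simp: submodule_span_def)
qed

lemma submodule_span_superset: "S \<subseteq> submodule_span K M S"
  by (auto simp: submodule_span_def)

lemma submodule_span_least: "submodule H K M \<Longrightarrow> S \<subseteq> H \<Longrightarrow> submodule_span K M S \<subseteq> H"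
  by (auto simp: submodule_span_def)

context
  fixes K :: "('k, 'm) ring_scheme" and M :: "('k, 'v, 'r) module_scheme" and H
  assumes M: "Module.module K M" and H: "submodule H K M"
begin

interpretation M: Module.module K M by (rule M)

interpretation H: abelian_subgroup H M
  by (rule abelian_subgroupI3[OF additive_subgroup.intro M.abelian_group_axioms])
    (rule submodule.axioms(1)[OF H])

lemma coset_eq:
  assumes "x \<in> carrier M" "y \<in> carrier M" "x \<ominus>\<^bsub>M\<^esub> y \<in> H"
  shows "H +>\<^bsub>M\<^esub> x = H +>\<^bsub>M\<^esub> y"
proof -
  have "x \<in> H +>\<^bsub>M\<^esub> y" using H.a_rcos_module[OF assms(2,1)] assms(3) by (simp add: a_minus_def)
  then show ?thesis
    using M.a_repr_independence[OF _ assms(2) submodule.axioms(1)[OF H]] by simp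
qed

lemma coset_mem:
  assumes "x \<in> carrier M" "y \<in> H +>\<^bsub>M\<^esub> x"
  obtains h where "h \<in> H" "y = h \<oplus>\<^bsub>M\<^esub> x"
  using assms(2) unfolding a_r_coset_def' by auto

text \<open>The definition takes a union over all representatives. They differ from \<open>x\<close>
  by elements of \<open>H\<close>, hence so do their multiples, and all cosets in the union
  coincide.\<close>

lemma quotient_smult:
  assumes a: "a \<in> carrier K" and x: "x \<in> carrier M"
  shows "a \<odot>\<^bsub>quotient_space M H\<^esub> (H +>\<^bsub>M\<^esub> x) = H +>\<^bsub>M\<^esub> (a \<odot>\<^bsub>M\<^esub> x)"
proof -
  have "H +>\<^bsub>M\<^esub> (a \<odot>\<^bsub>M\<^esub> y) = H +>\<^bsub>M\<^esub> (a \<odot>\<^bsub>M\<^esub> x)" if y: "y \<in> H +>\<^bsub>M\<^esub> x" for y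
  proof -
    obtain h where h: "h \<in> H" "y = h \<oplus>\<^bsub>M\<^esub> x" using coset_mem[OF x y] .
    have hc: "h \<in> carrier M" using h(1) submoduleD(1)[OF M H] by blast
    have "a \<odot>\<^bsub>M\<^esub> y \<ominus>\<^bsub>M\<^esub> a \<odot>\<^bsub>M\<^esub> x = a \<odot>\<^bsub>M\<^esub> h"
      using a x hc h(2) by (simp add: M.smult_r_distr a_minus_def M.M.a_assoc M.M.r_neg)
    then show ?thesis
      using a x hc h submoduleD(4)[OF M H a h(1)] by (intro coset_eq) auto
  qed
  then have "(\<Union>y\<in>H +>\<^bsub>M\<^esub> x. H +>\<^bsub>M\<^esub> (a \<odot>\<^bsub>M\<^esub> y)) = (\<Union>y\<in>H +>\<^bsub>M\<^esub> x. H +>\<^bsub>M\<^esub> (a \<odot>\<^bsub>M\<^esub> x))"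
    by (rule SUP_cong[OF refl])
  also have "\<dots> = H +>\<^bsub>M\<^esub> (a \<odot>\<^bsub>M\<^esub> x)"
    by (rule UN_constant_eq) (use H.a_rcos_self[OF x] in \<open>simp_all\<close>)
  finally show ?thesis by (simp add: quotient_space_def)
qed

lemma quotient_space_module: "Module.module K (quotient_space M H)"
proof (rule module_surj[OF M, where p = "\<lambda>x. H +>\<^bsub>M\<^esub> x"])
  show "carrier (quotient_space M H) = (+>\<^bsub>M\<^esub>) H ` carrier M"
    by (auto simp: quotient_space_def A_RCOSETS_def')
  show "\<zero>\<^bsub>quotient_space M H\<^esub> = H +>\<^bsub>M\<^esub> \<zero>\<^bsub>M\<^esub>"
    using submoduleD(1)[OF M H] by (simp add: quotient_space_def)
qed (auto simp: quotient_smult, auto simp: quotient_space_def H.a_rcos_sum)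

lemma quotient_map_linear: "restrict (\<lambda>x. H +>\<^bsub>M\<^esub> x) (carrier M) \<in> linear_maps K M (quotient_space M H)"
  by (rule linear_mapsI_restrict[OF M])
    (auto simp: quotient_smult, auto simp: quotient_space_def H.a_rcos_sum A_RCOSETS_def')

lemma quotient_universal:
  fixes U :: "('k, 'u, 't) module_scheme"
  assumes U: "Module.module K U" and l: "l \<in> linear_maps K M U" and z: "\<And>x. x \<in> H \<Longrightarrow> l x = \<zero>\<^bsub>U\<^esub>"
  obtains l' where "l' \<in> linear_maps K (quotient_space M H) U" "\<And>x. x \<in> carrier M \<Longrightarrow> l' (H +>\<^bsub>M\<^esub> x) = l x"
proof -
  interpret U: Module.module K U by (rule U)
  \<comment> \<open>Any representative will do: \<open>l\<close> vanishes on \<open>H\<close>, so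
    the choice does not affect the value.\<close>
  define l' where "l' A = l (SOME x. x \<in> A)" for A
  have l': "l' (H +>\<^bsub>M\<^esub> x) = l x" if x: "x \<in> carrier M" for x
  proof -
    have "(SOME y. y \<in> H +>\<^bsub>M\<^esub> x) \<in> H +>\<^bsub>M\<^esub> x"
      using someI[of "\<lambda>y. y \<in> H +>\<^bsub>M\<^esub> x", OF H.a_rcos_self[OF x]] .
    then obtain h where h: "h \<in> H" "(SOME y. y \<in> H +>\<^bsub>M\<^esub> x) = h \<oplus>\<^bsub>M\<^esub> x" using coset_mem[OF x] by blast
    have "h \<in> carrier M" using h(1) submoduleD(1)[OF M H] by blast
    then show ?thesis
      unfolding l'_def h(2) using linear_mapsD(1,2)[OF l] x z[OF h(1)] by simp
  qed
  have car: "\<exists>x\<in>carrier M. A = H +>\<^bsub>M\<^esub> x" if "A \<in> carrier (quotient_space M H)" for A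
    using that by (auto simp: quotient_space_def A_RCOSETS_def')
  show thesis
  proof (rule that)
    show "restrict l' (carrier (quotient_space M H)) \<in> linear_maps K (quotient_space M H) U"
    proof (rule linear_mapsI_restrict[OF quotient_space_module])
      fix A assume "A \<in> carrier (quotient_space M H)"
      then show "l' A \<in> carrier U" using car l' linear_mapsD(1)[OF l] by metis
    next
      fix A B assume "A \<in> carrier (quotient_space M H)" "B \<in> carrier (quotient_space M H)"
      then obtain x y where xy: "x \<in> carrier M" "y \<in> carrier M" "A = H +>\<^bsub>M\<^esub> x" "B = H +>\<^bsub>M\<^esub> y" using car by metis
      then have "A \<oplus>\<^bsub>quotient_space M H\<^esub> B = H +>\<^bsub>M\<^esub> (x \<oplus>\<^bsub>M\<^esub> y)"
        by (simp add: quotient_space_def H.a_rcos_sum)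
      then show "l' (A \<oplus>\<^bsub>quotient_space M H\<^esub> B) = l' A \<oplus>\<^bsub>U\<^esub> l' B"
        using l' xy linear_mapsD(2)[OF l] by simp
    next
      fix a A assume a: "a \<in> carrier K" and "A \<in> carrier (quotient_space M H)"
      then obtain x where x: "x \<in> carrier M" "A = H +>\<^bsub>M\<^esub> x" using car by metis
      show "l' (a \<odot>\<^bsub>quotient_space M H\<^esub> A) = a \<odot>\<^bsub>U\<^esub> l' A"
        using quotient_smult[OF a x(1)] l' x linear_mapsD(3)[OF l a] a by simp
    qed
    fix x assume x: "x \<in> carrier M"
    have "H +>\<^bsub>M\<^esub> x \<in> carrier (quotient_space M H)" using x by (auto simp: quotient_space_def A_RCOSETS_def')
    then show "restrict l' (carrier (quotient_space M H)) (H +>\<^bsub>M\<^esub> x) = l x" using l'[OF x] by simp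
  qed
qed

end

section \<open>The tensor product and its universal property\<close>

context
  fixes K :: "('k, 'm) ring_scheme" and V :: "('k, 'v) module" and W :: "('k, 'w) module"
  assumes V: "Module.module K V" and W: "Module.module K W"
begin

interpretation V: Module.module K V by (rule V)
interpretation W: Module.module K W by (rule W)

private abbreviation (input) "F \<equiv> free_space K (carrier V \<times> carrier W)"

interpretation F: Module.module K F by (rule free_space_module[OF V.is_cring])

private lemma bv: "x \<in> carrier V \<Longrightarrow> y \<in> carrier W \<Longrightarrow> basis_vec K (x, y) \<in> carrier F"
  by (rule basis_vec_in[OF V.is_cring]) simp

private lemma relations_carrier: "bilinear_relations K V W \<subseteq> carrier F"
  unfolding bilinear_relations_def Let_def by (auto intro!: F.M.minus_closed F.M.add.m_closed F.smult_closed bv)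

private lemma H: "submodule (tensor_relations K V W) K F"
  unfolding tensor_relations_def by (rule submodule_submodule_span[OF F.module_axioms relations_carrier])

lemma tensor_module: "Module.module K (tensor K V W)"
  unfolding tensor_def by (rule quotient_space_module[OF F.module_axioms H])

private lemma pure_eq:
  "x \<in> carrier V \<Longrightarrow> y \<in> carrier W \<Longrightarrow> pure_tensor K V W x y =
     restrict (\<lambda>f. tensor_relations K V W +>\<^bsub>F\<^esub> f) (carrier F) (basis_vec K (x, y))"
  using bv by (simp add: pure_tensor_def)

private lemma proj: "restrict (\<lambda>f. tensor_relations K V W +>\<^bsub>F\<^esub> f) (carrier F) \<in> linear_maps K F (tensor K V W)"
  unfolding tensor_def by (rule quotient_map_linear[OF F.module_axioms H])

text \<open>A generating relation becomes an equation of cosets; each rule for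
  \<open>pure_tensor\<close> arises in this way from one of the four families of relations.\<close>

private lemma proj_eq:
  assumes "f \<in> carrier F" "g \<in> carrier F" "f \<ominus>\<^bsub>F\<^esub> g \<in> bilinear_relations K V W"
  shows "restrict (\<lambda>f. tensor_relations K V W +>\<^bsub>F\<^esub> f) (carrier F) f =
         restrict (\<lambda>f. tensor_relations K V W +>\<^bsub>F\<^esub> f) (carrier F) g"
proof -
  have "f \<ominus>\<^bsub>F\<^esub> g \<in> tensor_relations K V W"
    unfolding tensor_relations_def by (rule subsetD[OF submodule_span_superset assms(3)])
  then show ?thesis using coset_eq[OF F.module_axioms H assms(1,2)] assms(1,2) by simp
qed

private lemma relations:
  assumes "x \<in> carrier V" "y \<in> carrier W"
  shows "x' \<in> carrier V \<Longrightarrow> basis_vec K (x \<oplus>\<^bsub>V\<^esub> x', y) \<ominus>\<^bsub>F\<^esub> (basis_vec K (x, y) \<oplus>\<^bsub>F\<^esub> basis_vec K (x', y))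
      \<in> bilinear_relations K V W"
    and "y' \<in> carrier W \<Longrightarrow> basis_vec K (x, y \<oplus>\<^bsub>W\<^esub> y') \<ominus>\<^bsub>F\<^esub> (basis_vec K (x, y) \<oplus>\<^bsub>F\<^esub> basis_vec K (x, y'))
      \<in> bilinear_relations K V W"
    and "a \<in> carrier K \<Longrightarrow> basis_vec K (a \<odot>\<^bsub>V\<^esub> x, y) \<ominus>\<^bsub>F\<^esub> a \<odot>\<^bsub>F\<^esub> basis_vec K (x, y) \<in> bilinear_relations K V W"
    and "a \<in> carrier K \<Longrightarrow> basis_vec K (x, a \<odot>\<^bsub>W\<^esub> y) \<ominus>\<^bsub>F\<^esub> a \<odot>\<^bsub>F\<^esub> basis_vec K (x, y) \<in> bilinear_relations K V W"
  using assms unfolding bilinear_relations_def Let_def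
  by (blast intro: UnI1 UnI2 CollectI exI conjI refl)+

lemma pure_tensor_bilinear: "bilinear K V W (tensor K V W) (pure_tensor K V W)"
proof (rule bilinearI[OF V W])
  note L = linear_mapsD[OF proj]
  show "pure_tensor K V W x y \<in> carrier (tensor K V W)" if "x \<in> carrier V" "y \<in> carrier W" for x y
    unfolding pure_eq[OF that] by (rule L(1)[OF bv[OF that]])
  show "pure_tensor K V W (x \<oplus>\<^bsub>V\<^esub> x') y = pure_tensor K V W x y \<oplus>\<^bsub>tensor K V W\<^esub> pure_tensor K V W x' y"
    if "x \<in> carrier V" "x' \<in> carrier V" "y \<in> carrier W" for x x' y
    unfolding pure_eq[OF V.M.add.m_closed[OF that(1,2)] that(3)] pure_eq[OF that(1,3)] pure_eq[OF that(2,3)]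
      L(2)[OF bv[OF that(1,3)] bv[OF that(2,3)], symmetric]
    by (rule proj_eq[OF _ _ relations(1)[OF that(1,3,2)]]) (use that in \<open>simp_all add: bv\<close>)
  show "pure_tensor K V W x (y \<oplus>\<^bsub>W\<^esub> y') = pure_tensor K V W x y \<oplus>\<^bsub>tensor K V W\<^esub> pure_tensor K V W x y'"
    if "x \<in> carrier V" "y \<in> carrier W" "y' \<in> carrier W" for x y y'
    unfolding pure_eq[OF that(1) W.M.add.m_closed[OF that(2,3)]] pure_eq[OF that(1,2)] pure_eq[OF that(1,3)]
      L(2)[OF bv[OF that(1,2)] bv[OF that(1,3)], symmetric]
    by (rule proj_eq[OF _ _ relations(2)[OF that]]) (use that in \<open>simp_all add: bv\<close>)
  show "pure_tensor K V W (a \<odot>\<^bsub>V\<^esub> x) y = a \<odot>\<^bsub>tensor K V W\<^esub> pure_tensor K V W x y"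
    if "a \<in> carrier K" "x \<in> carrier V" "y \<in> carrier W" for a x y
    unfolding pure_eq[OF V.smult_closed[OF that(1,2)] that(3)] pure_eq[OF that(2,3)]
      L(3)[OF that(1) bv[OF that(2,3)], symmetric]
    by (rule proj_eq[OF _ _ relations(3)[OF that(2,3,1)]]) (use that in \<open>simp_all add: bv\<close>)
  show "pure_tensor K V W x (a \<odot>\<^bsub>W\<^esub> y) = a \<odot>\<^bsub>tensor K V W\<^esub> pure_tensor K V W x y"
    if "a \<in> carrier K" "x \<in> carrier V" "y \<in> carrier W" for a x y
    unfolding pure_eq[OF that(2) W.smult_closed[OF that(1,3)]] pure_eq[OF that(2,3)]
      L(3)[OF that(1) bv[OF that(2,3)], symmetric]
    by (rule proj_eq[OF _ _ relations(4)[OF that(2,3,1)]]) (use that in \<open>simp_all add: bv\<close>)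
qed

lemma tensor_spans: "spans K (tensor K V W) {pure_tensor K V W x y | x y. x \<in> carrier V \<and> y \<in> carrier W}"
proof -
  let ?p = "restrict (\<lambda>f. tensor_relations K V W +>\<^bsub>F\<^esub> f) (carrier F)"
  \<comment> \<open>Generation by basis vectors needs an inhabited index set; the two zero vectors
    provide a pair.\<close>
  have ne: "carrier V \<times> carrier W \<noteq> {}" using V.M.zero_closed W.M.zero_closed by auto
  have "spans K (tensor K V W) (?p ` basis_vec K ` (carrier V \<times> carrier W))"
    by (rule spans_surj[OF free_space_spans[OF V.is_cring ne] proj])
      (auto simp: tensor_def quotient_space_def A_RCOSETS_def')
  moreover have "?p ` basis_vec K ` (carrier V \<times> carrier W) =
      (\<lambda>(x, y). pure_tensor K V W x y) ` (carrier V \<times> carrier W)"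
    unfolding image_image by (rule image_cong[OF refl], clarify) (simp only: pure_eq prod.case)
  moreover have "\<dots> = {pure_tensor K V W x y | x y. x \<in> carrier V \<and> y \<in> carrier W}" by auto
  ultimately show ?thesis by simp
qed

lemma tensor_universal:
  fixes U :: "('k, 'u, 't) module_scheme"
  assumes U: "Module.module K U" and b: "bilinear K V W U b"
  obtains l where "l \<in> linear_maps K (tensor K V W) U"
    "\<And>x y. x \<in> carrier V \<Longrightarrow> y \<in> carrier W \<Longrightarrow> l (pure_tensor K V W x y) = b x y"
proof -
  interpret U: Module.module K U by (rule U)
  note B = bilinearD[OF b V W]
  have "\<exists>l\<in>linear_maps K F U. \<forall>z\<in>carrier V \<times> carrier W. l (basis_vec K z) = (\<lambda>(x, y). b x y) z"
    by (rule free_space_universal[OF U, of "carrier V \<times> carrier W" "\<lambda>(x, y). b x y"]) (use B(1) in auto)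
  then obtain l where l: "l \<in> linear_maps K F U"
    and lb: "\<And>z. z \<in> carrier V \<times> carrier W \<Longrightarrow> l (basis_vec K z) = (\<lambda>(x, y). b x y) z"
    by blast
  have lbv: "l (basis_vec K (x, y)) = b x y" if "x \<in> carrier V" "y \<in> carrier W" for x y
    using lb[of "(x, y)"] that by simp
  note L = linear_mapsD[OF l]
  have ab: "abelian_group_hom F U l"
    by (rule abelian_group_homI[OF F.abelian_group_axioms U.abelian_group_axioms])
      (auto intro!: group_hom.intro group_hom_axioms.intro F.a_group U.a_group homI L)
  have l_minus: "l (f \<ominus>\<^bsub>F\<^esub> g) = \<zero>\<^bsub>U\<^esub>" if "f \<in> carrier F" "g \<in> carrier F" "l f = l g" for f g
    using that abelian_group_hom.hom_a_inv[OF ab that(2)] L(1,2) by (simp add: a_minus_def U.M.r_neg)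
  \<comment> \<open>The kernel of \<open>l\<close> is a submodule. Containing the bilinear
    relations, it contains their span, so \<open>l\<close> descends to the quotient.\<close>
  let ?N = "{f \<in> carrier F. l f = \<zero>\<^bsub>U\<^esub>}"
  have N: "submodule ?N K F"
    using L abelian_group_hom.hom_a_inv[OF ab] linear_maps_zero[OF F.module_axioms U l]
    by (intro F.submoduleI) auto
  have "bilinear_relations K V W \<subseteq> ?N"
    unfolding bilinear_relations_def Let_def
    by (auto intro!: F.M.minus_closed F.M.add.m_closed F.smult_closed bv l_minus simp: L bv lbv B)
  then have "tensor_relations K V W \<subseteq> ?N"
    unfolding tensor_relations_def by (rule submodule_span_least[OF N])
  then have z: "l f = \<zero>\<^bsub>U\<^esub>" if "f \<in> tensor_relations K V W" for f using that by blast
  obtain l' where "l' \<in> linear_maps K (tensor K V W) U"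
    "\<And>f. f \<in> carrier F \<Longrightarrow> l' (tensor_relations K V W +>\<^bsub>F\<^esub> f) = l f"
    using quotient_universal[OF F.module_axioms H U l z] unfolding tensor_def by blast
  then show thesis using that[of l'] lbv bv by (simp add: pure_tensor_def)
qed

end

section \<open>Tensor powers\<close>

lemma linear_maps_add:
  assumes V: "Module.module K V" and W: "Module.module K W" and f: "f \<in> linear_maps K V W" and g: "g \<in> linear_maps K V W"
  shows "restrict (\<lambda>x. f x \<oplus>\<^bsub>W\<^esub> g x) (carrier V) \<in> linear_maps K V W"
proof -
  interpret W: Module.module K W by (rule W)
  show ?thesis
    using linear_mapsD[OF f] linear_mapsD[OF g]
    by (intro linear_mapsI_restrict[OF V]) (auto simp: W.M.a_ac W.smult_r_distr)
qed

lemma linear_maps_smult: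
  assumes V: "Module.module K V" and W: "Module.module K W" and f: "f \<in> linear_maps K V W" and c: "c \<in> carrier K"
  shows "restrict (\<lambda>x. c \<odot>\<^bsub>W\<^esub> f x) (carrier V) \<in> linear_maps K V W"
proof -
  interpret W: Module.module K W by (rule W)
  have "c \<odot>\<^bsub>W\<^esub> (a \<odot>\<^bsub>W\<^esub> y) = a \<odot>\<^bsub>W\<^esub> (c \<odot>\<^bsub>W\<^esub> y)" if "a \<in> carrier K" "y \<in> carrier W" for a y
    using W.smult_assoc1[OF c that] W.smult_assoc1[OF that(1) c that(2)] W.R.m_comm[OF c that(1)] by simp
  then show ?thesis
    using linear_mapsD[OF f] c by (intro linear_mapsI_restrict[OF V]) (auto simp: W.smult_r_distr)
qed

lemma linear_maps_restrict_compose: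
  assumes V: "Module.module K V" and f: "restrict f (carrier V) \<in> linear_maps K V W" and h: "h \<in> linear_maps K W U"
  shows "restrict (\<lambda>x. h (f x)) (carrier V) \<in> linear_maps K V U"
proof -
  have "compose (carrier V) h (restrict f (carrier V)) = restrict (\<lambda>x. h (f x)) (carrier V)"
    by (auto simp: compose_def restrict_def)
  then show ?thesis using linear_maps_compose[OF V f h] by simp
qed

definition tuples :: "('a, 'x) partial_object_scheme \<Rightarrow> nat \<Rightarrow> 'a list set" where
  "tuples A n = {as. set as \<subseteq> carrier A \<and> length as = n}"

lemma tuples_append: "as \<in> tuples A m \<Longrightarrow> bs \<in> tuples A n \<Longrightarrow> as @ bs \<in> tuples A (m + n)"
  by (auto simp: tuples_def)

lemma tuples_split:
  assumes "as \<in> tuples A (m + n)" shows "take m as \<in> tuples A m" "drop m as \<in> tuples A n"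
  using assms set_take_subset[of m as] set_drop_subset[of m as] by (auto simp: tuples_def)

text \<open>A slot is singled out by splitting the tuple around it. For \<open>n = 0\<close> there
  is no slot, and only the value at \<open>[]\<close> remains.\<close>

definition multilinear ::
  "('k, 'm) ring_scheme \<Rightarrow> ('k, 'v) module \<Rightarrow> nat \<Rightarrow> ('k, 'w) module \<Rightarrow> ('v list \<Rightarrow> 'w) \<Rightarrow> bool" where
  "multilinear K A n W \<phi> \<longleftrightarrow> (\<forall>as\<in>tuples A n. \<phi> as \<in> carrier W) \<and>
     (\<forall>us vs. set us \<subseteq> carrier A \<longrightarrow> set vs \<subseteq> carrier A \<longrightarrow> length us + 1 + length vs = n \<longrightarrow>
        restrict (\<lambda>x. \<phi> (us @ x # vs)) (carrier A) \<in> linear_maps K A W)"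

lemma multilinearD:
  assumes "multilinear K A n W \<phi>"
  shows "as \<in> tuples A n \<Longrightarrow> \<phi> as \<in> carrier W"
    and "set us \<subseteq> carrier A \<Longrightarrow> set vs \<subseteq> carrier A \<Longrightarrow> length us + 1 + length vs = n \<Longrightarrow>
        restrict (\<lambda>x. \<phi> (us @ x # vs)) (carrier A) \<in> linear_maps K A W"
  using assms unfolding multilinear_def by blast+

lemma multilinearI:
  assumes "\<And>as. as \<in> tuples A n \<Longrightarrow> \<phi> as \<in> carrier W"
    and "\<And>us vs. set us \<subseteq> carrier A \<Longrightarrow> set vs \<subseteq> carrier A \<Longrightarrow> length us + 1 + length vs = n \<Longrightarrow>
        restrict (\<lambda>x. \<phi> (us @ x # vs)) (carrier A) \<in> linear_maps K A W"
  shows "multilinear K A n W \<phi>"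
  using assms unfolding multilinear_def by blast

text \<open>The universal property ranges over targets with vectors in \<open>'v\<close>, as a
  formula cannot quantify over types. Generation by the image of \<open>g\<close> is a separate
  clause: it makes factorisations unique and allows linear maps to be compared on tuples.\<close>

definition tensor_power ::
  "('k, 'm) ring_scheme \<Rightarrow> ('k, 'v) module \<Rightarrow> nat \<Rightarrow> ('k, 'v) module \<Rightarrow> ('v list \<Rightarrow> 'v) \<Rightarrow> bool" where
  "tensor_power K A n T g \<longleftrightarrow> Module.module K T \<and> multilinear K A n T g \<and> spans K T (g ` tuples A n) \<and>
     (\<forall>(W :: ('k, 'v) module) \<phi>. Module.module K W \<longrightarrow> multilinear K A n W \<phi> \<longrightarrow>
        (\<exists>l\<in>linear_maps K T W. \<forall>as\<in>tuples A n. l (g as) = \<phi> as))"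

lemma tensor_powerD:
  assumes "tensor_power K A n T g"
  shows "Module.module K T" "multilinear K A n T g" "spans K T (g ` tuples A n)"
    "as \<in> tuples A n \<Longrightarrow> g as \<in> carrier T"
  using assms multilinearD(1) unfolding tensor_power_def by blast+

lemma tensor_power_universal:
  fixes W :: "('k, 'v) module" and T :: "('k, 'v) module"
  assumes "tensor_power K A n T g" "Module.module K W" "multilinear K A n W \<phi>"
  obtains l where "l \<in> linear_maps K T W" "\<And>as. as \<in> tuples A n \<Longrightarrow> l (g as) = \<phi> as"
  using assms unfolding tensor_power_def by blast

lemma tensor_power_agree:
  assumes "tensor_power K A n T g" "f \<in> linear_maps K T W" "f' \<in> linear_maps K T W"
    "\<And>as. as \<in> tuples A n \<Longrightarrow> f (g as) = f' (g as)"
  shows "f = f'"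
proof (rule extensionalityI[OF linear_mapsD(4)[OF assms(2)] linear_mapsD(4)[OF assms(3)]])
  fix x assume "x \<in> carrier T"
  then show "f x = f' x"
    using spans_linear_agree[OF tensor_powerD(3)[OF assms(1)] assms(2,3)] assms(4) by blast
qed

text \<open>Each power maps to the other by its universal property, and both composites fix the
  generators, so they are identities.\<close>

lemma tensor_power_unique:
  fixes T :: "('k, 'v) module"
  assumes T: "tensor_power K A n T g" and T': "tensor_power K A n T' g'"
  obtains f where "f \<in> linear_isos K T T'" "\<And>as. as \<in> tuples A n \<Longrightarrow> f (g as) = g' as"
proof -
  note D = tensor_powerD[OF T] and D' = tensor_powerD[OF T']
  obtain f where f: "f \<in> linear_maps K T T'" "\<And>as. as \<in> tuples A n \<Longrightarrow> f (g as) = g' as"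
    using tensor_power_universal[OF T D'(1,2)] by blast
  obtain f' where f': "f' \<in> linear_maps K T' T" "\<And>as. as \<in> tuples A n \<Longrightarrow> f' (g' as) = g as"
    using tensor_power_universal[OF T' D(1,2)] by blast
  have "compose (carrier T) f' f = restrict (\<lambda>x. x) (carrier T)"
    using D(4) f(2) f'(2)
    by (intro tensor_power_agree[OF T linear_maps_compose[OF D(1) f(1) f'(1)] linear_maps_ident[OF D(1)]])
      (simp add: compose_def)
  then have 1: "f' (f x) = x" if "x \<in> carrier T" for x
    using that by (metis compose_eq restrict_apply')
  have "compose (carrier T') f f' = restrict (\<lambda>x. x) (carrier T')"
    using D'(4) f(2) f'(2)
    by (intro tensor_power_agree[OF T' linear_maps_compose[OF D'(1) f'(1) f(1)] linear_maps_ident[OF D'(1)]])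
      (simp add: compose_def)
  then have 2: "f (f' x) = x" if "x \<in> carrier T'" for x
    using that by (metis compose_eq restrict_apply')
  have "bij_betw f (carrier T) (carrier T')"
    using 1 2 linear_mapsD(1)[OF f(1)] linear_mapsD(1)[OF f'(1)]
    by (intro bij_betw_byWitness[where f' = f']) auto
  then show thesis using that f by (simp add: linear_isos_def)
qed

text \<open>Formulated for an isomorphic copy \<open>T\<close> of \<open>A\<close>, so that it also
  covers \<open>F [E]\<close> for a disk \<open>E\<close> other than \<open>D\<close>.\<close>

lemma tensor_power_one:
  fixes A :: "('k, 'v) module"
  assumes A: "Module.module K A" and T: "Module.module K T" and f: "f \<in> linear_isos K A T"
  shows "tensor_power K A 1 T (\<lambda>as. f (hd as))"
  unfolding tensor_power_def
proof (intro conjI T allI impI)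
  note fl = linear_isosD(1)[OF f]
  have tup: "tuples A 1 = (\<lambda>x. [x]) ` carrier A"
    by (auto simp: tuples_def length_Suc_conv)
  note tup' = tup[unfolded One_nat_def]
  have f': "f \<in> extensional (carrier A)" using linear_mapsD(4)[OF fl] .
  show "multilinear K A 1 T (\<lambda>as. f (hd as))"
    using linear_mapsD(1)[OF fl] fl f' by (intro multilinearI) (auto simp: tup' extensional_restrict)
  have "(\<lambda>as. f (hd as)) ` tuples A 1 = f ` carrier A" unfolding tup image_image by simp
  also have "\<dots> = carrier T" using linear_isosD(2)[OF f] by (simp add: bij_betw_imp_surj_on)
  finally show "spans K T ((\<lambda>as. f (hd as)) ` tuples A 1)" by (auto intro: spansI)
  fix W :: "('k, 'v) module" and \<phi> assume W: "Module.module K W" and \<phi>: "multilinear K A 1 W \<phi>"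
  obtain f' where f': "f' \<in> linear_isos K T A" "\<forall>x\<in>carrier A. f' (f x) = x"
    by (rule linear_isos_inverse[OF A T f]) (rule that)
  have "restrict (\<lambda>x. \<phi> [x]) (carrier A) \<in> linear_maps K A W"
    using multilinearD(2)[OF \<phi>, of "[]" "[]"] by simp
  note lin = linear_maps_compose[OF T linear_isosD(1)[OF f'(1)] this]
  show "\<exists>l\<in>linear_maps K T W. \<forall>as\<in>tuples A 1. l (f (hd as)) = \<phi> as"
    using linear_mapsD(1)[OF fl] f'(2) by (intro bexI[OF _ lin]) (simp add: tup' compose_def)
qed

lemma ground_space_module:
  assumes "cring K" shows "Module.module K (ground_space K)"
proof -
  interpret cring K by fact
  have "abelian_group (ground_space K)"
    by (rule abelian_groupI) (auto simp: ground_space_def a_ac intro: l_neg exI[of _ "\<ominus>\<^bsub>K\<^esub> _"])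
  then show ?thesis
    by (intro moduleI assms) (auto simp: ground_space_def l_distr r_distr m_assoc)
qed

text \<open>The only tuple of length \<open>0\<close> is \<open>[]\<close>, and a linear map out of
  the ground space is fixed by its value at \<open>\<one>\<close>; the image of
  \<open>\<one>\<close> therefore serves as the empty pure tensor.\<close>

lemma tensor_power_zero:
  fixes T :: "('k, 'v) module"
  assumes K: "cring K" and T: "Module.module K T" and f: "f \<in> linear_isos K (ground_space K) T"
  shows "tensor_power K A 0 T (\<lambda>as. f \<one>\<^bsub>K\<^esub>)"
  unfolding tensor_power_def
proof (intro conjI T allI impI)
  interpret K: cring K by (rule K)
  note fl = linear_isosD(1)[OF f] and G = ground_space_module[OF K]
  have tup: "tuples A 0 = {[]}" by (auto simp: tuples_def)
  have one: "\<one>\<^bsub>K\<^esub> \<in> carrier (ground_space K)" by (simp add: ground_space_def)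
  show "multilinear K A 0 T (\<lambda>as. f \<one>\<^bsub>K\<^esub>)"
    using linear_mapsD(1)[OF fl one] by (intro multilinearI) auto
  have gen: "spans K (ground_space K) {\<one>\<^bsub>K\<^esub>}"
  proof (rule spansI)
    fix P x assume P1: "\<And>x. x \<in> {\<one>\<^bsub>K\<^esub>} \<Longrightarrow> P x"
      and smult: "\<And>a x. a \<in> carrier K \<Longrightarrow> x \<in> carrier (ground_space K) \<Longrightarrow> P x \<Longrightarrow> P (a \<odot>\<^bsub>ground_space K\<^esub> x)"
      and x: "x \<in> carrier (ground_space K)"
    show "P x" using smult[OF _ one P1, of x] x by (simp add: ground_space_def)
  qed
  have "spans K T (f ` {\<one>\<^bsub>K\<^esub>})"
    using linear_isosD(2)[OF f] by (intro spans_surj[OF gen fl]) (simp add: bij_betw_imp_surj_on)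
  then show "spans K T ((\<lambda>as. f \<one>\<^bsub>K\<^esub>) ` tuples A 0)" by (simp add: tup)
  fix W :: "('k, 'v) module" and \<phi> :: "'v list \<Rightarrow> 'v" assume W: "Module.module K W" and \<phi>: "multilinear K A 0 W \<phi>"
  interpret W: Module.module K W by (rule W)
  have w: "\<phi> [] \<in> carrier W" using multilinearD(1)[OF \<phi>] by (simp add: tup)
  obtain f' where f': "f' \<in> linear_isos K T (ground_space K)" "\<forall>x\<in>carrier (ground_space K). f' (f x) = x"
    by (rule linear_isos_inverse[OF G T f]) (rule that)
  have "restrict (\<lambda>a. a \<odot>\<^bsub>W\<^esub> \<phi> []) (carrier (ground_space K)) \<in> linear_maps K (ground_space K) W"
    using w by (intro linear_mapsI_restrict[OF G]) (auto simp: ground_space_def W.smult_l_distr W.smult_assoc1)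
  note lin = linear_maps_compose[OF T linear_isosD(1)[OF f'(1)] this]
  show "\<exists>l\<in>linear_maps K T W. \<forall>as\<in>tuples A 0. l (f \<one>\<^bsub>K\<^esub>) = \<phi> as"
    using linear_mapsD(1)[OF fl one] f'(2) w one by (intro bexI[OF _ lin]) (simp add: tup compose_def)
qed

lemma bilinear_linear:
  assumes V: "Module.module K V" and W: "Module.module K W" and b: "bilinear K V W U b" and h: "h \<in> linear_maps K U U'"
  shows "bilinear K V W U' (\<lambda>x y. h (b x y))"
  using b linear_maps_restrict_compose[OF V _ h] linear_maps_restrict_compose[OF W _ h]
  unfolding bilinear_def by auto

text \<open>The universal property is obtained by currying. A multilinear \<open>\<phi>\<close> is
  factored through \<open>T\<close> for each fixed right half (\<open>L\<close>), then through
  \<open>T'\<close> for each \<open>t\<close> (\<open>M\<close>); the result is bilinear and factors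
  through \<open>tensor K T T'\<close>. Linearity of \<open>L\<close> and \<open>M\<close> in the
  remaining argument is checked on generators, by uniqueness of factorisations.\<close>

lemma tensor_power_tensor:
  fixes T T' S :: "('k, 'v) module"
  assumes A: "Module.module K A" and T: "tensor_power K A m T g" and T': "tensor_power K A n T' g'"
    and S: "Module.module K S" and \<mu>: "\<mu> \<in> linear_isos K (tensor K T T') S"
  shows "tensor_power K A (m + n) S
     (\<lambda>as. \<mu> (pure_tensor K T T' (g (take m as)) (g' (drop m as))))"
proof -
  note D = tensor_powerD[OF T] and D' = tensor_powerD[OF T']
  define b where "b x y = \<mu> (pure_tensor K T T' x y)" for x y
  define G where "G as = b (g (take m as)) (g' (drop m as))" for as
  have b: "bilinear K T T' S b"
    unfolding b_def
    by (rule bilinear_linear[OF D(1) D'(1) pure_tensor_bilinear[OF D(1) D'(1)] linear_isosD(1)[OF \<mu>]])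
  have bl: "restrict (\<lambda>x. b x y) (carrier T) \<in> linear_maps K T S" if "y \<in> carrier T'" for y
    using b that unfolding bilinear_def by blast
  have br: "restrict (b x) (carrier T') \<in> linear_maps K T' S" if "x \<in> carrier T" for x
    using b that unfolding bilinear_def by blast
  have G: "G (as @ bs) = b (g as) (g' bs)" if "as \<in> tuples A m" for as bs
    using that by (simp add: G_def tuples_def)
  have tup: "tuples A (m + n) = (\<lambda>(as, bs). as @ bs) ` (tuples A m \<times> tuples A n)"
  proof (intro equalityI subsetI)
    fix as assume "as \<in> tuples A (m + n)"
    then show "as \<in> (\<lambda>(as, bs). as @ bs) ` (tuples A m \<times> tuples A n)"
      using tuples_split[of as A m n] by (intro image_eqI[of _ _ "(take m as, drop m as)"]) auto
  qed (auto intro: tuples_append)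
  have ml: "multilinear K A (m + n) S G"
  proof (rule multilinearI)
    show "G as \<in> carrier S" if "as \<in> tuples A (m + n)" for as
      unfolding G_def using bilinearD(1)[OF b D(1) D'(1) D(4) D'(4)] tuples_split[OF that] by blast
    fix us vs assume us: "set us \<subseteq> carrier A" and vs: "set vs \<subseteq> carrier A" and len: "length us + 1 + length vs = m + n"
    show "restrict (\<lambda>x. G (us @ x # vs)) (carrier A) \<in> linear_maps K A S"
    proof (cases "length us < m")
      case True
      \<comment> \<open>The slot lies in the left half; \<open>k\<close> counts the entries of
        \<open>vs\<close> that still belong to it.\<close>
      define k where "k = m - length us - 1"
      have split: "take m (us @ x # vs) = us @ x # take k vs" "drop m (us @ x # vs) = drop k vs" for x
        using True by (auto simp: k_def take_Cons' drop_Cons')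
      have vs1: "set (take k vs) \<subseteq> carrier A" "set (drop k vs) \<subseteq> carrier A"
        using vs set_take_subset set_drop_subset by fast+
      have len1: "length us + 1 + length (take k vs) = m" using True len by (simp add: k_def)
      have y: "g' (drop k vs) \<in> carrier T'"
        using D'(4) vs1 True len by (simp add: tuples_def k_def)
      have gx: "g (us @ x # take k vs) \<in> carrier T" if "x \<in> carrier A" for x
        using D(4) that us vs1 len1 by (simp add: tuples_def)
      have "restrict (\<lambda>x. restrict (\<lambda>x. b x (g' (drop k vs))) (carrier T) (g (us @ x # take k vs))) (carrier A) \<in> linear_maps K A S"
        by (rule linear_maps_restrict_compose[OF A multilinearD(2)[OF D(2) us vs1(1) len1] bl[OF y]])
      moreover have "restrict (\<lambda>x. restrict (\<lambda>x. b x (g' (drop k vs))) (carrier T) (g (us @ x # take k vs))) (carrier A) =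
          restrict (\<lambda>x. G (us @ x # vs)) (carrier A)"
        using gx by (intro restrict_ext) (simp only: G_def split restrict_apply')
      ultimately show ?thesis by simp
    next
      case False
      have split: "take m (us @ x # vs) = take m us" "drop m (us @ x # vs) = drop m us @ x # vs" for x
        using False by auto
      have us1: "set (take m us) \<subseteq> carrier A" "set (drop m us) \<subseteq> carrier A"
        using us set_take_subset set_drop_subset by fast+
      have len1: "length (drop m us) + 1 + length vs = n" using False len by simp
      have y: "g (take m us) \<in> carrier T"
        using D(4) us1 False by (simp add: tuples_def)
      have gx: "g' (drop m us @ x # vs) \<in> carrier T'" if "x \<in> carrier A" for x
        using D'(4) that us1 vs len1 by (simp add: tuples_def)
      have "restrict (\<lambda>x. restrict (b (g (take m us))) (carrier T') (g' (drop m us @ x # vs))) (carrier A) \<in> linear_maps K A S"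
        by (rule linear_maps_restrict_compose[OF A multilinearD(2)[OF D'(2) us1(2) vs len1] br[OF y]])
      moreover have "restrict (\<lambda>x. restrict (b (g (take m us))) (carrier T') (g' (drop m us @ x # vs))) (carrier A) =
          restrict (\<lambda>x. G (us @ x # vs)) (carrier A)"
        using gx by (intro restrict_ext) (simp only: G_def split restrict_apply')
      ultimately show ?thesis by simp
    qed
  qed
  let ?P = "{pure_tensor K T T' (g as) (g' bs) | as bs. as \<in> tuples A m \<and> bs \<in> tuples A n}"
  note B = bilinearD[OF pure_tensor_bilinear[OF D(1) D'(1)] D(1) D'(1)]
  \<comment> \<open>Generators of the factors suffice: \<open>x\<close> is extended linearly against
    a fixed \<open>g' bs\<close>, then \<open>y\<close> against any \<open>x\<close>, and pure
    tensors generate the rest.\<close>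
  have "spans K (tensor K T T') ?P"
  proof (rule spansI)
    fix P z
    assume gen: "\<And>x. x \<in> ?P \<Longrightarrow> P x"
      and add: "\<And>x y. x \<in> carrier (tensor K T T') \<Longrightarrow> y \<in> carrier (tensor K T T') \<Longrightarrow> P x \<Longrightarrow> P y \<Longrightarrow>
         P (x \<oplus>\<^bsub>tensor K T T'\<^esub> y)"
      and smult: "\<And>a x. a \<in> carrier K \<Longrightarrow> x \<in> carrier (tensor K T T') \<Longrightarrow> P x \<Longrightarrow> P (a \<odot>\<^bsub>tensor K T T'\<^esub> x)"
      and z: "z \<in> carrier (tensor K T T')"
    have 1: "P (pure_tensor K T T' x (g' bs))" if x: "x \<in> carrier T" and bs: "bs \<in> tuples A n" for x bs
      using D(3) x
    proof (induction rule: spans_induct)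
      case (gen x)
      then show ?case using bs \<open>\<And>x. x \<in> ?P \<Longrightarrow> P x\<close> by blast
    next
      case (add x y)
      then show ?case
        using B(1,2)[OF _ D'(4)[OF bs]] \<open>\<And>x y. _ \<Longrightarrow> _ \<Longrightarrow> P x \<Longrightarrow> P y \<Longrightarrow> P (x \<oplus>\<^bsub>tensor K T T'\<^esub> y)\<close> by simp
    next
      case (smult a x)
      then show ?case
        using B(1,4)[OF _ D'(4)[OF bs]] \<open>\<And>a x. _ \<Longrightarrow> _ \<Longrightarrow> P x \<Longrightarrow> P (a \<odot>\<^bsub>tensor K T T'\<^esub> x)\<close> by simp
    qed
    have 2: "P (pure_tensor K T T' x y)" if x: "x \<in> carrier T" and y: "y \<in> carrier T'" for x y
      using D'(3) y
    proof (induction rule: spans_induct)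
      case (gen y)
      then show ?case using 1 x by blast
    next
      case (add y y')
      then show ?case
        using B(1,3)[OF x] \<open>\<And>x y. _ \<Longrightarrow> _ \<Longrightarrow> P x \<Longrightarrow> P y \<Longrightarrow> P (x \<oplus>\<^bsub>tensor K T T'\<^esub> y)\<close> by simp
    next
      case (smult a y)
      then show ?case
        using B(1,5)[OF x] \<open>\<And>a x. _ \<Longrightarrow> _ \<Longrightarrow> P x \<Longrightarrow> P (a \<odot>\<^bsub>tensor K T T'\<^esub> x)\<close> by simp
    qed
    show "P z"
      using tensor_spans[OF D(1) D'(1)] z by (induction rule: spans_induct) (use 2 add smult in auto)
  qed
  then have "spans K S (\<mu> ` ?P)"
    by (rule spans_surj[OF _ linear_isosD(1)[OF \<mu>] bij_betw_imp_surj_on[OF linear_isosD(2)[OF \<mu>]]])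
  moreover have "\<mu> ` ?P = G ` tuples A (m + n)"
  proof -
    have "G ` tuples A (m + n) = {G (as @ bs) | as bs. as \<in> tuples A m \<and> bs \<in> tuples A n}"
      unfolding tup by auto
    also have "\<dots> = {\<mu> (pure_tensor K T T' (g as) (g' bs)) | as bs. as \<in> tuples A m \<and> bs \<in> tuples A n}"
      by (rule Collect_cong) (metis G b_def)
    also have "\<dots> = \<mu> ` ?P" by blast
    finally show ?thesis ..
  qed
  ultimately have sp: "spans K S (G ` tuples A (m + n))" by simp
  have univ: "\<exists>l\<in>linear_maps K S W. \<forall>as\<in>tuples A (m + n). l (G as) = \<phi> as"
    if W: "Module.module K W" and \<phi>: "multilinear K A (m + n) W \<phi>" for W :: "('k, 'v) module" and \<phi>
  proof -
    have "\<forall>bs\<in>tuples A n. \<exists>l. l \<in> linear_maps K T W \<and> (\<forall>as\<in>tuples A m. l (g as) = \<phi> (as @ bs))"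
    proof
      fix bs assume bs: "bs \<in> tuples A n"
      have "multilinear K A m W (\<lambda>as. \<phi> (as @ bs))"
      proof (rule multilinearI)
        show "\<phi> (as @ bs) \<in> carrier W" if "as \<in> tuples A m" for as
          using multilinearD(1)[OF \<phi>] tuples_append[OF that bs] by blast
        show "restrict (\<lambda>x. \<phi> ((us @ x # vs) @ bs)) (carrier A) \<in> linear_maps K A W"
          if "set us \<subseteq> carrier A" "set vs \<subseteq> carrier A" "length us + 1 + length vs = m" for us vs
          using multilinearD(2)[OF \<phi>, of us "vs @ bs"] that bs by (simp add: tuples_def)
      qed
      then obtain l where "l \<in> linear_maps K T W" "\<And>as. as \<in> tuples A m \<Longrightarrow> l (g as) = \<phi> (as @ bs)"
        using tensor_power_universal[OF T W] by blast
      then show "\<exists>l. l \<in> linear_maps K T W \<and> (\<forall>as\<in>tuples A m. l (g as) = \<phi> (as @ bs))" by blast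
    qed
    from bchoice[OF this] obtain L where L: "\<And>bs. bs \<in> tuples A n \<Longrightarrow> L bs \<in> linear_maps K T W"
      "\<And>as bs. as \<in> tuples A m \<Longrightarrow> bs \<in> tuples A n \<Longrightarrow> L bs (g as) = \<phi> (as @ bs)"
      by blast
    have "\<forall>t\<in>carrier T. \<exists>l. l \<in> linear_maps K T' W \<and> (\<forall>bs\<in>tuples A n. l (g' bs) = L bs t)"
    proof
      fix t assume t: "t \<in> carrier T"
      have "multilinear K A n W (\<lambda>bs. L bs t)"
      proof (rule multilinearI)
        show "L bs t \<in> carrier W" if "bs \<in> tuples A n" for bs
          using linear_mapsD(1)[OF L(1)[OF that] t] .
        fix us vs assume us: "set us \<subseteq> carrier A" and vs: "set vs \<subseteq> carrier A" and len: "length us + 1 + length vs = n"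
        have tn: "us @ x # vs \<in> tuples A n" if "x \<in> carrier A" for x
          using us vs len that by (simp add: tuples_def)
        have \<phi>l: "restrict (\<lambda>x. \<phi> (as @ us @ x # vs)) (carrier A) \<in> linear_maps K A W" if "as \<in> tuples A m" for as
          using multilinearD(2)[OF \<phi>, of "as @ us" vs] that us vs len by (simp add: tuples_def)
        show "restrict (\<lambda>x. L (us @ x # vs) t) (carrier A) \<in> linear_maps K A W"
        proof (rule linear_mapsI_restrict[OF A])
          show "L (us @ x # vs) t \<in> carrier W" if "x \<in> carrier A" for x
            using linear_mapsD(1)[OF L(1)[OF tn[OF that]] t] .
          fix x y assume x: "x \<in> carrier A" and y: "y \<in> carrier A"
          note xy = module_closed(1)[OF A x y]
          \<comment> \<open>\<open>\<phi>\<close> is additive in this slot, so both linear maps have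
            the same values at the generators \<open>g as\<close>.\<close>
          have "L (us @ (x \<oplus>\<^bsub>A\<^esub> y) # vs) =
              restrict (\<lambda>t. L (us @ x # vs) t \<oplus>\<^bsub>W\<^esub> L (us @ y # vs) t) (carrier T)"
          proof (rule tensor_power_agree[OF T L(1)[OF tn[OF xy]] linear_maps_add[OF D(1) W L(1)[OF tn[OF x]] L(1)[OF tn[OF y]]]])
            fix as assume as: "as \<in> tuples A m"
            show "L (us @ (x \<oplus>\<^bsub>A\<^esub> y) # vs) (g as) =
                restrict (\<lambda>t. L (us @ x # vs) t \<oplus>\<^bsub>W\<^esub> L (us @ y # vs) t) (carrier T) (g as)"
              using linear_mapsD(2)[OF \<phi>l[OF as] x y] x y xy L(2)[OF as tn] D(4)[OF as] by simp
          qed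
          then show "L (us @ (x \<oplus>\<^bsub>A\<^esub> y) # vs) t = L (us @ x # vs) t \<oplus>\<^bsub>W\<^esub> L (us @ y # vs) t"
            using t by simp
        next
          fix a x assume a: "a \<in> carrier K" and x: "x \<in> carrier A"
          note ax = module_closed(2)[OF A a x]
          have "L (us @ (a \<odot>\<^bsub>A\<^esub> x) # vs) = restrict (\<lambda>t. a \<odot>\<^bsub>W\<^esub> L (us @ x # vs) t) (carrier T)"
          proof (rule tensor_power_agree[OF T L(1)[OF tn[OF ax]] linear_maps_smult[OF D(1) W L(1)[OF tn[OF x]] a]])
            fix as assume as: "as \<in> tuples A m"
            show "L (us @ (a \<odot>\<^bsub>A\<^esub> x) # vs) (g as) = restrict (\<lambda>t. a \<odot>\<^bsub>W\<^esub> L (us @ x # vs) t) (carrier T) (g as)"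
              using linear_mapsD(3)[OF \<phi>l[OF as] a x] x ax L(2)[OF as tn] D(4)[OF as] by simp
          qed
          then show "L (us @ (a \<odot>\<^bsub>A\<^esub> x) # vs) t = a \<odot>\<^bsub>W\<^esub> L (us @ x # vs) t"
            using t by simp
        qed
      qed
      then obtain l where "l \<in> linear_maps K T' W" "\<And>bs. bs \<in> tuples A n \<Longrightarrow> l (g' bs) = L bs t"
        using tensor_power_universal[OF T' W] by blast
      then show "\<exists>l. l \<in> linear_maps K T' W \<and> (\<forall>bs\<in>tuples A n. l (g' bs) = L bs t)" by blast
    qed
    from bchoice[OF this] obtain M where M: "\<And>t. t \<in> carrier T \<Longrightarrow> M t \<in> linear_maps K T' W"
      "\<And>t bs. t \<in> carrier T \<Longrightarrow> bs \<in> tuples A n \<Longrightarrow> M t (g' bs) = L bs t"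
      by blast
    have "bilinear K T T' W M"
      unfolding bilinear_def
    proof (intro conjI ballI)
      show "restrict (M t) (carrier T') \<in> linear_maps K T' W" if "t \<in> carrier T" for t
        using M(1)[OF that] linear_mapsD(4)[OF M(1)[OF that]] by (simp add: extensional_restrict)
      fix s assume s: "s \<in> carrier T'"
      show "restrict (\<lambda>t. M t s) (carrier T) \<in> linear_maps K T W"
      proof (rule linear_mapsI_restrict[OF D(1)])
        show "M t s \<in> carrier W" if "t \<in> carrier T" for t using linear_mapsD(1)[OF M(1)[OF that] s] .
        fix x y assume x: "x \<in> carrier T" and y: "y \<in> carrier T"
        note xy = module_closed(1)[OF D(1) x y]
        have "M (x \<oplus>\<^bsub>T\<^esub> y) = restrict (\<lambda>s. M x s \<oplus>\<^bsub>W\<^esub> M y s) (carrier T')"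
        proof (rule tensor_power_agree[OF T' M(1)[OF xy] linear_maps_add[OF D'(1) W M(1)[OF x] M(1)[OF y]]])
          fix bs assume bs: "bs \<in> tuples A n"
          show "M (x \<oplus>\<^bsub>T\<^esub> y) (g' bs) = restrict (\<lambda>s. M x s \<oplus>\<^bsub>W\<^esub> M y s) (carrier T') (g' bs)"
            using linear_mapsD(2)[OF L(1)[OF bs] x y] M(2) x y xy bs D'(4)[OF bs] by simp
        qed
        then show "M (x \<oplus>\<^bsub>T\<^esub> y) s = M x s \<oplus>\<^bsub>W\<^esub> M y s" using s by simp
      next
        fix a x assume a: "a \<in> carrier K" and x: "x \<in> carrier T"
        note ax = module_closed(2)[OF D(1) a x]
        have "M (a \<odot>\<^bsub>T\<^esub> x) = restrict (\<lambda>s. a \<odot>\<^bsub>W\<^esub> M x s) (carrier T')"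
        proof (rule tensor_power_agree[OF T' M(1)[OF ax] linear_maps_smult[OF D'(1) W M(1)[OF x] a]])
          fix bs assume bs: "bs \<in> tuples A n"
          show "M (a \<odot>\<^bsub>T\<^esub> x) (g' bs) = restrict (\<lambda>s. a \<odot>\<^bsub>W\<^esub> M x s) (carrier T') (g' bs)"
            using linear_mapsD(3)[OF L(1)[OF bs] a x] M(2) x ax bs D'(4)[OF bs] by simp
        qed
        then show "M (a \<odot>\<^bsub>T\<^esub> x) s = a \<odot>\<^bsub>W\<^esub> M x s" using s by simp
      qed
    qed
    then obtain l where l: "l \<in> linear_maps K (tensor K T T') W"
      "\<And>x y. x \<in> carrier T \<Longrightarrow> y \<in> carrier T' \<Longrightarrow> l (pure_tensor K T T' x y) = M x y"
      using tensor_universal[OF D(1) D'(1) W] by blast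
    obtain \<nu> where \<nu>: "\<nu> \<in> linear_isos K S (tensor K T T')" "\<forall>z\<in>carrier (tensor K T T'). \<nu> (\<mu> z) = z"
      by (rule linear_isos_inverse[OF tensor_module[OF D(1) D'(1)] S \<mu>]) (rule that)
    show ?thesis
    proof (intro bexI ballI)
      show "compose (carrier S) l \<nu> \<in> linear_maps K S W"
        by (rule linear_maps_compose[OF S linear_isosD(1)[OF \<nu>(1)] l(1)])
      fix as assume as: "as \<in> tuples A (m + n)"
      note split = tuples_split[OF as]
      have z: "pure_tensor K T T' (g (take m as)) (g' (drop m as)) \<in> carrier (tensor K T T')"
        using B(1) D(4) D'(4) split by blast
      have "G as \<in> carrier S" using multilinearD(1)[OF ml as] .
      then have "compose (carrier S) l \<nu> (G as) = l (pure_tensor K T T' (g (take m as)) (g' (drop m as)))"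
        using \<nu>(2) z by (simp add: compose_def G_def b_def)
      also have "\<dots> = \<phi> as"
        using l(2) M(2) L(2) D(4) D'(4) split by simp
      finally show "compose (carrier S) l \<nu> (G as) = \<phi> as" .
    qed
  qed
  have "tensor_power K A (m + n) S G"
    unfolding tensor_power_def using S ml sp univ by blast
  then show ?thesis unfolding G_def b_def .
qed

section \<open>Room for tensor powers in the universe \<open>'v\<close>\<close>

lemma inj_pair:
  assumes "infinite (UNIV :: 'v set)"
  obtains p :: "'v \<times> 'v \<Rightarrow> 'v" where "inj p"
proof -
  obtain p :: "'v \<times> 'v \<Rightarrow> 'v" where "bij_betw p (UNIV \<times> UNIV) UNIV"
    using card_of_Times_same_infinite[OF assms] unfolding card_of_ordIso[symmetric] by blast
  then show thesis using that[of p] by (simp add: bij_betw_def)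
qed

lemma inj_list:
  assumes inf: "infinite (UNIV :: 'v set)"
  obtains e :: "'v list \<Rightarrow> 'v" where "inj e"
proof -
  obtain p :: "'v \<times> 'v \<Rightarrow> 'v" where p: "inj p" using inj_pair[OF inf] .
  obtain q :: "nat \<Rightarrow> 'v" where q: "inj q" using infinite_countable_subset[OF inf] by blast
  \<comment> \<open>Nested pairs alone do not reveal the length of the list, since the end marker
    \<open>q 0\<close> may itself be the code of a pair; the length is therefore coded
    separately.\<close>
  define c where "c xs = foldr (\<lambda>x y. p (x, y)) xs (q 0)" for xs
  have c: "xs = ys" if "length xs = length ys" "c xs = c ys" for xs ys
    using that by (induction rule: list_induct2) (auto simp: c_def dest: injD[OF p])
  have "inj (\<lambda>xs. p (q (length xs), c xs))"
  proof (rule injI)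
    fix xs ys assume "p (q (length xs), c xs) = p (q (length ys), c ys)"
    then have "q (length xs) = q (length ys)" "c xs = c ys" using injD[OF p] by auto
    then show "xs = ys" using c injD[OF q] by blast
  qed
  then show thesis using that by blast
qed

lemma transport_module:
  fixes M :: "('k, 'w) module"
  assumes M: "Module.module K M" and le: "carrier M \<lesssim> (UNIV :: 'v set)"
  obtains S :: "('k, 'v) module" and \<mu> where "Module.module K S" "\<mu> \<in> linear_isos K M S"
proof -
  obtain e :: "'w \<Rightarrow> 'v" where e: "inj_on e (carrier M)" using le unfolding lepoll_def by blast
  define d where "d = inv_into (carrier M) e"
  have d: "d (e x) = x" if "x \<in> carrier M" for x using inv_into_f_f[OF e that] by (simp add: d_def)
  define S :: "('k, 'v) module" where "S = \<lparr>carrier = e ` carrier M, mult = undefined, one = undefined,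
     zero = e \<zero>\<^bsub>M\<^esub>, add = (\<lambda>x y. e (d x \<oplus>\<^bsub>M\<^esub> d y)), smult = (\<lambda>a x. e (a \<odot>\<^bsub>M\<^esub> d x))\<rparr>"
  have S: "Module.module K S"
    by (rule module_surj[OF M, of S e]) (simp_all add: S_def d)
  have "restrict e (carrier M) \<in> linear_maps K M S"
    by (rule linear_mapsI_restrict[OF M]) (simp_all add: S_def d)
  moreover have "bij_betw (restrict e (carrier M)) (carrier M) (carrier S)"
    using e by (simp add: S_def bij_betw_def)
  ultimately show thesis using that[OF S, of "restrict e (carrier M)"] by (simp add: linear_isos_def)
qed

text \<open>Every tensor is a finite sum of pure tensors, scalars being absorbed into the first
  entries. So lists of pairs of vectors map onto the tensor product, and an infinite
  \<open>'v\<close> has room for such lists.\<close>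

lemma tensor_lepoll:
  fixes V W :: "('k, 'v) module"
  assumes V: "Module.module K V" and W: "Module.module K W" and inf: "infinite (UNIV :: 'v set)"
  shows "carrier (tensor K V W) \<lesssim> (UNIV :: 'v set)"
proof -
  note T = tensor_module[OF V W] and B = bilinearD[OF pure_tensor_bilinear[OF V W] V W]
  interpret T: Module.module K "tensor K V W" by (rule T)
  interpret V: Module.module K V by (rule V)
  define S where "S ps = foldr (\<lambda>(x, y) z. pure_tensor K V W x y \<oplus>\<^bsub>tensor K V W\<^esub> z) ps \<zero>\<^bsub>tensor K V W\<^esub>" for ps
  have S_simps: "S [] = \<zero>\<^bsub>tensor K V W\<^esub>" "S ((x, y) # ps) = pure_tensor K V W x y \<oplus>\<^bsub>tensor K V W\<^esub> S ps" for x y ps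
    by (simp_all add: S_def)
  define L where "L = {ps. set ps \<subseteq> carrier V \<times> carrier W}"
  have Sc: "S ps \<in> carrier (tensor K V W)" if "ps \<in> L" for ps
    using that by (induction ps) (auto simp: L_def S_simps B(1))
  have app: "S (ps @ qs) = S ps \<oplus>\<^bsub>tensor K V W\<^esub> S qs" if "ps \<in> L" "qs \<in> L" for ps qs
    using that(1)
  proof (induction ps)
    case (Cons p ps)
    then show ?case using Sc[of ps] Sc[OF that(2)] B(1)
      by (cases p) (auto simp: L_def S_simps T.M.a_assoc)
  qed (use Sc[OF that(2)] in \<open>simp add: S_simps\<close>)
  have sm: "a \<odot>\<^bsub>tensor K V W\<^esub> S ps = S (map (\<lambda>(x, y). (a \<odot>\<^bsub>V\<^esub> x, y)) ps)" if "ps \<in> L" "a \<in> carrier K" for ps a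
    using that(1)
  proof (induction ps)
    case (Cons p ps)
    then show ?case using Sc[of ps] B(1) B(4)[OF _ _ that(2)] that(2)
      by (cases p) (auto simp: L_def S_simps T.smult_r_distr)
  qed (use that(2) in \<open>simp add: S_simps\<close>)
  have "z \<in> S ` L" if "z \<in> carrier (tensor K V W)" for z
    using tensor_spans[OF V W] that
  proof (induction rule: spans_induct)
    case (gen z)
    then obtain x y where xy: "x \<in> carrier V" "y \<in> carrier W" "z = pure_tensor K V W x y" by blast
    then have "z = S [(x, y)]" using B(1) by (simp add: S_simps)
    then show ?case using xy by (auto simp: L_def)
  next
    case (add z z')
    then obtain ps qs where pq: "ps \<in> L" "z = S ps" "qs \<in> L" "z' = S qs" by blast
    then have "z \<oplus>\<^bsub>tensor K V W\<^esub> z' = S (ps @ qs)" using app by simp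
    then show ?case using pq by (auto simp: L_def)
  next
    case (smult a z)
    then obtain ps where ps: "ps \<in> L" "z = S ps" by blast
    then have "a \<odot>\<^bsub>tensor K V W\<^esub> z = S (map (\<lambda>(x, y). (a \<odot>\<^bsub>V\<^esub> x, y)) ps)" using sm smult by simp
    moreover have "map (\<lambda>(x, y). (a \<odot>\<^bsub>V\<^esub> x, y)) ps \<in> L" using ps smult(1) by (auto simp: L_def)
    ultimately show ?case by blast
  qed
  then have "carrier (tensor K V W) \<lesssim> S ` L" by (intro subset_imp_lepoll) blast
  also have "S ` L \<lesssim> L" by (rule image_lepoll)
  also have "L \<lesssim> (UNIV :: 'v set)"
  proof -
    obtain p :: "'v \<times> 'v \<Rightarrow> 'v" where p: "inj p" using inj_pair[OF inf] .
    obtain e :: "'v list \<Rightarrow> 'v" where e: "inj e" using inj_list[OF inf] .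
    have "inj (e \<circ> map p)" using e p by (intro inj_compose) simp_all
    then have "inj_on (e \<circ> map p) L" using inj_on_subset subset_UNIV by metis
    moreover have "(e \<circ> map p) ` L \<subseteq> UNIV" by (rule subset_UNIV)
    ultimately show ?thesis unfolding lepoll_def by (intro exI[of _ "e \<circ> map p"] conjI)
  qed
  finally show ?thesis .
qed

text \<open>One factor is added at a time, and each tensor product is copied back into
  \<open>'v\<close> before the next one is formed. The bound on \<open>carrier K\<close> places the
  power \<open>0\<close>, a copy of the ground space.\<close>

lemma tensor_power_exists:
  fixes A :: "('k, 'v) module"
  assumes A: "Module.module K A" and inf: "infinite (UNIV :: 'v set)" and le: "carrier K \<lesssim> (UNIV :: 'v set)"
  shows "\<exists>T g. tensor_power K A n T g"
proof (induction n)
  case 0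
  interpret A: Module.module K A by (rule A)
  have "carrier (ground_space K) \<lesssim> (UNIV :: 'v set)" using le by (simp add: ground_space_def)
  then obtain T :: "('k, 'v) module" and f where "Module.module K T" "f \<in> linear_isos K (ground_space K) T"
    using transport_module[OF ground_space_module[OF A.is_cring]] by blast
  then show ?case using tensor_power_zero[OF A.is_cring] by blast
next
  case (Suc n)
  then obtain T g where T: "tensor_power K A n T g" by blast
  have "restrict (\<lambda>x. x) (carrier A) \<in> linear_isos K A A"
    using linear_maps_ident[OF A] by (simp add: linear_isos_def bij_betw_def inj_on_def)
  then have 1: "tensor_power K A 1 A (\<lambda>as. restrict (\<lambda>x. x) (carrier A) (hd as))"
    using tensor_power_one[OF A A] by blast
  note TM = tensor_powerD(1)[OF T]
  obtain S :: "('k, 'v) module" and \<mu> where "Module.module K S" "\<mu> \<in> linear_isos K (tensor K A T) S"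
    using transport_module[OF tensor_module[OF A TM] tensor_lepoll[OF A TM inf]] by blast
  then show ?case using tensor_power_tensor[OF A 1 T] by fastforce
qed

section \<open>The algebra of an isotopy invariant functor\<close>

text \<open>Linearity does not see the product and the unit, so the algebra and the underlying space
  have the same linear maps.\<close>

lemma linear_maps_functor_algebra:
  "linear_maps K (functor_algebra K D F) = linear_maps K (fobj F [D])"
  "linear_maps K V (functor_algebra K D F) = linear_maps K V (fobj F [D])"
  by (auto simp: linear_maps_def functor_algebra_def fun_eq_iff)

locale isotopy_functor =
  fixes K :: "('k, 'm) ring_scheme" and D :: "'p disk" and F :: "('p, 'k, 'v) sm_functor"
  assumes K: "cring K" and D: "oriented_disk D" and F: "is_sm_functor K F" and invariant: "isotopy_invariant F"
begin

text \<open>Indexing arrows by their coordinates lets composition, union and isotopy be computed on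
  \<open>\<kappa>\<close> and \<open>f\<close>.\<close>

definition mor :: "'p disk list \<Rightarrow> 'p disk list \<Rightarrow> (nat \<Rightarrow> nat) \<Rightarrow> (nat \<Rightarrow> real \<Rightarrow> real) \<Rightarrow> 'v \<Rightarrow> 'v" where
  "mor X Y \<kappa> f = fmor F X Y (coord_map X Y \<kappa> f)"

abbreviation "A \<equiv> functor_algebra K D F"

lemmas sm_functor = F[unfolded is_sm_functor_def]

lemma is_functor: "is_functor disk_cat (vect_cat K) (fobj F) (fmor F)"
  using sm_functor by (elim conjE)

lemma fobj_module [simp, intro]: "disks X \<Longrightarrow> Module.module K (fobj F X)"
  using functorD(1)[OF is_functor] by (simp add: vect_cat_def)

lemma fmor_linear:
  "disks X \<Longrightarrow> disks Y \<Longrightarrow> j \<in> oriented_embeddings X Y \<Longrightarrow> fmor F X Y j \<in> linear_maps K (fobj F X) (fobj F Y)"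
  using functorD(3)[OF is_functor, of X Y j] by (simp add: vect_cat_def disk_cat_def)

lemma mor_linear:
  "disks X \<Longrightarrow> disks Y \<Longrightarrow> coord_embedding (length X) (length Y) \<kappa> f \<Longrightarrow>
    mor X Y \<kappa> f \<in> linear_maps K (fobj F X) (fobj F Y)"
  unfolding mor_def using fmor_linear coord_map_in_embeddings by blast

lemma mor_closed [intro]:
  "disks X \<Longrightarrow> disks Y \<Longrightarrow> coord_embedding (length X) (length Y) \<kappa> f \<Longrightarrow> x \<in> carrier (fobj F X) \<Longrightarrow>
    mor X Y \<kappa> f x \<in> carrier (fobj F Y)"
  using linear_mapsD(1)[OF mor_linear] .

lemma mor_compose:
  assumes X: "disks X" and Y: "disks Y" and Z: "disks Z"
    and e: "coord_embedding (length X) (length Y) \<kappa> f" and e': "coord_embedding (length Y) (length Z) \<kappa>' f'"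
    and x: "x \<in> carrier (fobj F X)"
  shows "mor Y Z \<kappa>' f' (mor X Y \<kappa> f x) = mor X Z (\<lambda>i. \<kappa>' (\<kappa> i)) (\<lambda>i t. f' (\<kappa> i) (f i t)) x"
proof -
  have "fmor F X Z (compose (pts X) (coord_map Y Z \<kappa>' f') (coord_map X Y \<kappa> f)) =
        compose (carrier (fobj F X)) (mor Y Z \<kappa>' f') (mor X Y \<kappa> f)"
    using functorD(4)[OF is_functor X Y Z] coord_map_in_embeddings[OF X Y e] coord_map_in_embeddings[OF Y Z e']
    by (simp add: disk_cat_def vect_cat_def mor_def)
  then have "mor X Z (\<lambda>i. \<kappa>' (\<kappa> i)) (\<lambda>i t. f' (\<kappa> i) (f i t)) = compose (carrier (fobj F X)) (mor Y Z \<kappa>' f') (mor X Y \<kappa> f)"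
    unfolding coord_map_compose[OF X Y e] by (simp add: mor_def)
  then show ?thesis using x by (simp add: compose_eq)
qed

lemma mor_ident:
  assumes X: "disks X" and x: "x \<in> carrier (fobj F X)"
  shows "mor X X (\<lambda>i. i) (\<lambda>i t. t) x = x"
  using functorD(2)[OF is_functor X] x ident_coord[OF X]
  by (simp add: disk_cat_def vect_cat_def mor_def)

text \<open>Isotopy invariance is applied to the straight-line isotopy; from here on only the
  components and the order of the disks count.\<close>

lemma mor_same_order:
  assumes X: "disks X" and Y: "disks Y"
    and e: "coord_embedding (length X) (length Y) \<kappa> f" and e': "coord_embedding (length X) (length Y) \<kappa>' f'"
    and so: "same_order (length X) \<kappa> f \<kappa>' f'"
  shows "mor X Y \<kappa> f = mor X Y \<kappa>' f'"
proof -
  have "coord_map X Y \<kappa> f \<in> Arr disk_cat X Y" "coord_map X Y \<kappa>' f' \<in> Arr disk_cat X Y"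
    using coord_map_in_embeddings[OF X Y e] coord_map_in_embeddings[OF X Y e'] by (simp_all add: disk_cat_def)
  then show ?thesis
    using invariant X Y isotopicI[OF X Y e e' so] unfolding isotopy_invariant_def mor_def by blast
qed

lemma fmu_iso: "disks X \<Longrightarrow> disks Y \<Longrightarrow> fmu F X Y \<in> linear_isos K (tensor K (fobj F X) (fobj F Y)) (fobj F (X @ Y))"
  using sm_functor[THEN conjunct2, THEN conjunct2, THEN conjunct1] by blast

lemma feps_iso: "feps F \<in> linear_isos K (ground_space K) (fobj F [])"
  using sm_functor by (elim conjE)

lemma fprod_bilinear: "disks X \<Longrightarrow> disks Y \<Longrightarrow> bilinear K (fobj F X) (fobj F Y) (fobj F (X @ Y)) (fprod K F X Y)"
  unfolding fprod_def[abs_def]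
  by (rule bilinear_linear[OF _ _ pure_tensor_bilinear linear_isosD(1)[OF fmu_iso]]) auto

lemma fprod_closed [intro]:
  "disks X \<Longrightarrow> disks Y \<Longrightarrow> x \<in> carrier (fobj F X) \<Longrightarrow> y \<in> carrier (fobj F Y) \<Longrightarrow>
    fprod K F X Y x y \<in> carrier (fobj F (X @ Y))"
  using bilinearD(1)[OF fprod_bilinear] by blast

lemma fprod_assoc:
  "disks X \<Longrightarrow> disks Y \<Longrightarrow> disks Z \<Longrightarrow> x \<in> carrier (fobj F X) \<Longrightarrow> y \<in> carrier (fobj F Y) \<Longrightarrow>
    z \<in> carrier (fobj F Z) \<Longrightarrow>
    fprod K F (X @ Y) Z (fprod K F X Y x y) z = fprod K F X (Y @ Z) x (fprod K F Y Z y z)"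
  using sm_functor[THEN conjunct2, THEN conjunct2, THEN conjunct2, THEN conjunct2, THEN conjunct1] by blast

lemma one_K [simp]: "\<one>\<^bsub>K\<^esub> \<in> carrier K"
  using K by (simp add: cring.axioms(1) ring.ring_simprules(6))

lemma fprod_unit:
  assumes X: "disks X" and x: "x \<in> carrier (fobj F X)"
  shows "fprod K F [] X (feps F \<one>\<^bsub>K\<^esub>) x = x" "fprod K F X [] x (feps F \<one>\<^bsub>K\<^esub>) = x"
proof -
  interpret M: Module.module K "fobj F X" using X by simp
  have l: "\<forall>X\<in>Obj disk_cat. \<forall>a\<in>carrier K. \<forall>x\<in>carrier (fobj F X).
      fprod K F [] X (feps F a) x = a \<odot>\<^bsub>fobj F X\<^esub> x"
    using sm_functor by (elim conjE)
  have r: "\<forall>X\<in>Obj disk_cat. \<forall>a\<in>carrier K. \<forall>x\<in>carrier (fobj F X).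
      fprod K F X [] x (feps F a) = a \<odot>\<^bsub>fobj F X\<^esub> x"
    using sm_functor by (elim conjE)
  show "fprod K F [] X (feps F \<one>\<^bsub>K\<^esub>) x = x" "fprod K F X [] x (feps F \<one>\<^bsub>K\<^esub>) = x"
    using l[rule_format, OF X one_K x] r[rule_format, OF X one_K x] M.smult_one[OF x] by simp_all
qed

lemma feps_closed [simp]: "a \<in> carrier K \<Longrightarrow> feps F a \<in> carrier (fobj F [])"
  using linear_mapsD(1)[OF linear_isosD(1)[OF feps_iso], of a] by (simp add: ground_space_def)

lemma mor_union:
  assumes X: "disks X" "disks X'" and Y: "disks Y" "disks Y'"
    and e: "coord_embedding (length X) (length X') \<kappa> f" and e': "coord_embedding (length Y) (length Y') \<kappa>' f'"
    and x: "x \<in> carrier (fobj F X)" and y: "y \<in> carrier (fobj F Y)"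
  shows "mor (X @ Y) (X' @ Y') (union_index (length X) (length X') \<kappa> \<kappa>') (union_fun (length X) f f') (fprod K F X Y x y)
       = fprod K F X' Y' (mor X X' \<kappa> f x) (mor Y Y' \<kappa>' f' y)"
proof -
  have "coord_map X X' \<kappa> f \<in> Arr disk_cat X X'" "coord_map Y Y' \<kappa>' f' \<in> Arr disk_cat Y Y'"
    using coord_map_in_embeddings[OF X e] coord_map_in_embeddings[OF Y e'] by (simp_all add: disk_cat_def)
  moreover have "\<forall>X\<in>Obj disk_cat. \<forall>Y\<in>Obj disk_cat. \<forall>X'\<in>Obj disk_cat. \<forall>Y'\<in>Obj disk_cat.
        \<forall>j\<in>Arr disk_cat X X'. \<forall>j'\<in>Arr disk_cat Y Y'.
        \<forall>x\<in>carrier (fobj F X). \<forall>y\<in>carrier (fobj F Y).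
          fmor F (X @ Y) (X' @ Y') (disj_union_map X Y X' j j') (fprod K F X Y x y) =
          fprod K F X' Y' (fmor F X X' j x) (fmor F Y Y' j' y)"
    using sm_functor by (elim conjE)
  ultimately have "fmor F (X @ Y) (X' @ Y') (disj_union_map X Y X' (coord_map X X' \<kappa> f) (coord_map Y Y' \<kappa>' f')) (fprod K F X Y x y) =
          fprod K F X' Y' (fmor F X X' (coord_map X X' \<kappa> f) x) (fmor F Y Y' (coord_map Y Y' \<kappa>' f') y)"
    using X Y x y by blast
  then show ?thesis unfolding coord_map_union[OF X(1) Y(1) e] mor_def .
qed

lemma mor_swap:
  assumes X: "disks X" and Y: "disks Y" and x: "x \<in> carrier (fobj F X)" and y: "y \<in> carrier (fobj F Y)"
  shows "mor (X @ Y) (Y @ X) (swap_index (length X) (length Y)) (\<lambda>i t. t) (fprod K F X Y x y) = fprod K F Y X y x"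
proof -
  have "\<forall>X\<in>Obj disk_cat. \<forall>Y\<in>Obj disk_cat.
        \<forall>x\<in>carrier (fobj F X). \<forall>y\<in>carrier (fobj F Y).
          fmor F (X @ Y) (Y @ X) (swap_map X Y) (fprod K F X Y x y) = fprod K F Y X y x"
    using sm_functor by (elim conjE)
  then show ?thesis using assms unfolding mor_def swap_map_coord[OF X Y, symmetric] by blast
qed

lemma algebra_simps_F:
  "carrier A = carrier (fobj F [D])" "\<zero>\<^bsub>A\<^esub> = \<zero>\<^bsub>fobj F [D]\<^esub>" "x \<oplus>\<^bsub>A\<^esub> y = x \<oplus>\<^bsub>fobj F [D]\<^esub> y"
  "a \<odot>\<^bsub>A\<^esub> x = a \<odot>\<^bsub>fobj F [D]\<^esub> x"
  by (simp_all add: functor_algebra_def)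

lemma algebra_mult: "x \<otimes>\<^bsub>A\<^esub> y = mor [D, D] [D] (\<lambda>i. 0) fold_fun (fprod K F [D] [D] x y)"
  by (simp add: functor_algebra_def mor_def fold_embedding_coord[OF D])

lemma algebra_one: "\<one>\<^bsub>A\<^esub> = mor [] [D] \<kappa> f (feps F \<one>\<^bsub>K\<^esub>)"
  by (simp add: functor_algebra_def mor_def flip: empty_coord)

lemma algebra_module: "Module.module K A"
  by (rule module_surj[of K "fobj F [D]" _ "\<lambda>x. x"]) (simp_all add: algebra_simps_F D)

lemma same_order_increasing:
  assumes "\<And>i. i < n \<Longrightarrow> \<kappa> i = \<kappa>' i" "\<And>i i'. i < i' \<Longrightarrow> i' < n \<Longrightarrow> f i 0 < f i' 0"
    "\<And>i i'. i < i' \<Longrightarrow> i' < n \<Longrightarrow> f' i 0 < f' i' 0"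
  shows "same_order n \<kappa> f \<kappa>' f'"
proof -
  have "f i 0 < f i' 0 \<longleftrightarrow> i < i'" "f' i 0 < f' i' 0 \<longleftrightarrow> i < i'" if "i < n" "i' < n" for i i'
    using assms(2)[of i i'] assms(2)[of i' i] assms(3)[of i i'] assms(3)[of i' i] that
    by (cases i i' rule: linorder_cases; force)+
  then show ?thesis using assms(1) by (simp add: same_order_def)
qed

lemma disk_D [simp]: "oriented_disk D" by (rule D)

lemma fold_emb: "coord_embedding (length [Z, Z]) (length [Z]) (\<lambda>i. 0) fold_fun"
  using coord_embedding_fold by (simp add: numeral_2_eq_2)

text \<open>Both bracketings evaluate \<open>F\<close> at an embedding of three disks into one that
  keeps them in order, and \<open>fprod_assoc\<close> makes the arguments equal. Two such embeddings
  are isotopic.\<close>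

lemma algebra_assoc:
  assumes x: "x \<in> carrier A" and y: "y \<in> carrier A" and z: "z \<in> carrier A"
  shows "(x \<otimes>\<^bsub>A\<^esub> y) \<otimes>\<^bsub>A\<^esub> z = x \<otimes>\<^bsub>A\<^esub> (y \<otimes>\<^bsub>A\<^esub> z)"
proof -
  note car = x[unfolded algebra_simps_F] y[unfolded algebra_simps_F] z[unfolded algebra_simps_F]
  let ?id = "\<lambda>i::nat. i" and ?idf = "\<lambda>(i::nat) t::real. t" and ?z = "\<lambda>i::nat. 0::nat"
  have D2: "disks [D, D]" "disks [D]" "disks ([D, D] @ [D])" "disks ([D] @ [D, D])" "disks ([D] @ [D])" by simp_all
  have e1: "coord_embedding (length [D]) (length [D]) ?id ?idf" by (rule coord_embedding_ident)
  have eL: "coord_embedding (length ([D, D] @ [D])) (length ([D] @ [D])) (union_index 2 1 ?z ?id) (union_fun 2 fold_fun ?idf)"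
    using coord_embedding_union[OF fold_emb[of D] e1] by (simp add: numeral_2_eq_2 numeral_3_eq_3)
  have eR: "coord_embedding (length ([D] @ [D, D])) (length ([D] @ [D])) (union_index 1 1 ?id ?z) (union_fun 1 ?idf fold_fun)"
    using coord_embedding_union[OF e1 fold_emb[of D]] by simp
  have fe: "coord_embedding (length ([D] @ [D])) (length [D]) ?z fold_fun" using fold_emb by simp
  have xy: "fprod K F [D] [D] x y \<in> carrier (fobj F [D, D])" and yz: "fprod K F [D] [D] y z \<in> carrier (fobj F [D, D])"
    using fprod_closed[of "[D]" "[D]"] car by simp_all
  have "(x \<otimes>\<^bsub>A\<^esub> y) \<otimes>\<^bsub>A\<^esub> z = mor ([D] @ [D]) [D] ?z fold_fun
      (mor ([D, D] @ [D]) ([D] @ [D]) (union_index 2 1 ?z ?id) (union_fun 2 fold_fun ?idf)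
        (fprod K F [D, D] [D] (fprod K F [D] [D] x y) z))"
    using mor_union[OF D2(1,2,2,2) fold_emb[of D] e1 xy car(3)] mor_ident[OF D2(2) car(3)]
    by (simp add: algebra_mult numeral_2_eq_2)
  also have "\<dots> = mor ([D, D] @ [D]) [D] (\<lambda>i. ?z (union_index 2 1 ?z ?id i))
     (\<lambda>i t. fold_fun (union_index 2 1 ?z ?id i) (union_fun 2 fold_fun ?idf i t)) (fprod K F [D, D] [D] (fprod K F [D] [D] x y) z)"
    using fprod_closed[OF D2(1,2) xy car(3)] by (intro mor_compose D2 eL fe)
  also have "\<dots> = mor ([D] @ [D, D]) [D] (\<lambda>i. ?z (union_index 1 1 ?id ?z i))
     (\<lambda>i t. fold_fun (union_index 1 1 ?id ?z i) (union_fun 1 ?idf fold_fun i t)) (fprod K F [D, D] [D] (fprod K F [D] [D] x y) z)"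
  proof -
    have "same_order (length ([D, D] @ [D])) (\<lambda>i. ?z (union_index 2 1 ?z ?id i))
       (\<lambda>i t. fold_fun (union_index 2 1 ?z ?id i) (union_fun 2 fold_fun ?idf i t)) (\<lambda>i. ?z (union_index 1 1 ?id ?z i))
       (\<lambda>i t. fold_fun (union_index 1 1 ?id ?z i) (union_fun 1 ?idf fold_fun i t))"
    proof (rule same_order_increasing)
      fix i i' :: nat assume "i < i'" "i' < length ([D, D] @ [D])"
      \<comment> \<open>The coordinate \<open>0\<close> of the three disks goes to
        \<open>- exp 1\<close>, \<open>- exp (- 1)\<close>, \<open>1\<close> under the left
        bracketing and to \<open>- 1\<close>, \<open>exp (- 1)\<close>, \<open>exp 1\<close> under
        the right one.\<close>
      then consider "i = 0" "i' = 1" | "i = 0" "i' = 2" | "i = 1" "i' = 2" by fastforce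
      then show "fold_fun (union_index 2 1 ?z ?id i) (union_fun 2 fold_fun ?idf i 0)
          < fold_fun (union_index 2 1 ?z ?id i') (union_fun 2 fold_fun ?idf i' 0)"
        "fold_fun (union_index 1 1 ?id ?z i) (union_fun 1 ?idf fold_fun i 0)
          < fold_fun (union_index 1 1 ?id ?z i') (union_fun 1 ?idf fold_fun i' 0)"
        by (cases; simp add: union_index_def union_fun_def fold_fun_def;
          meson exp_gt_zero less_trans neg_less_0_iff_less zero_less_one)+
    qed simp
    moreover have "coord_embedding (length ([D, D] @ [D])) (length [D]) (\<lambda>i. ?z (union_index 1 1 ?id ?z i))
       (\<lambda>i t. fold_fun (union_index 1 1 ?id ?z i) (union_fun 1 ?idf fold_fun i t))"
      using coord_embedding_compose[OF eR fe] by simp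
    ultimately show ?thesis
      using mor_same_order[OF D2(3,2) coord_embedding_compose[OF eL fe]] by simp
  qed
  also have "\<dots> = mor ([D] @ [D, D]) [D] (\<lambda>i. ?z (union_index 1 1 ?id ?z i))
     (\<lambda>i t. fold_fun (union_index 1 1 ?id ?z i) (union_fun 1 ?idf fold_fun i t)) (fprod K F [D] [D, D] x (fprod K F [D] [D] y z))"
    using fprod_assoc[OF D2(2,2,2) car] by simp
  also have "\<dots> = mor ([D] @ [D]) [D] ?z fold_fun
      (mor ([D] @ [D, D]) ([D] @ [D]) (union_index 1 1 ?id ?z) (union_fun 1 ?idf fold_fun)
        (fprod K F [D] [D, D] x (fprod K F [D] [D] y z)))"
    using fprod_closed[OF D2(2,1) car(1) yz] by (intro mor_compose[symmetric] D2 eR fe)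
  also have "\<dots> = x \<otimes>\<^bsub>A\<^esub> (y \<otimes>\<^bsub>A\<^esub> z)"
    using mor_union[OF D2(2,2,1,2) e1 fold_emb[of D] car(1) yz] mor_ident[OF D2(2) car(1)]
    by (simp add: algebra_mult)
  finally show ?thesis .
qed

text \<open>The factor \<open>\<one>\<close> comes from the empty union, so the product evaluates
  \<open>F\<close> at an embedding of one disk into one disk. With a single source disk there is no
  order to compare, and the embedding is isotopic to the identity.\<close>

lemma algebra_unit:
  assumes x: "x \<in> carrier A"
  shows "\<one>\<^bsub>A\<^esub> \<otimes>\<^bsub>A\<^esub> x = x" "x \<otimes>\<^bsub>A\<^esub> \<one>\<^bsub>A\<^esub> = x"
proof -
  note car = x[unfolded algebra_simps_F]
  let ?id = "\<lambda>i::nat. i" and ?idf = "\<lambda>(i::nat) t::real. t" and ?z = "\<lambda>i::nat. 0::nat"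
  have D2: "disks [D]" "disks []" "disks ([D] @ [D])" by simp_all
  have e1: "coord_embedding (length [D]) (length [D]) ?id ?idf" by (rule coord_embedding_ident)
  have e0: "coord_embedding (length []) (length [D]) ?id ?idf" by (simp add: coord_embedding_empty)
  have eL: "coord_embedding (length ([] @ [D])) (length ([D] @ [D])) (union_index 0 1 ?id ?id) (union_fun 0 ?idf ?idf)"
    using coord_embedding_union[OF e0 e1] by simp
  have eR: "coord_embedding (length ([D] @ [])) (length ([D] @ [D])) (union_index 1 1 ?id ?id) (union_fun 1 ?idf ?idf)"
    using coord_embedding_union[OF e1 e0] by simp
  have fe: "coord_embedding (length ([D] @ [D])) (length [D]) ?z fold_fun" using fold_emb by simp
  have so: "same_order (length [D]) (\<lambda>i. ?z (u i)) g ?id ?idf" for u g by (simp add: same_order_def)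
  have "\<one>\<^bsub>A\<^esub> \<otimes>\<^bsub>A\<^esub> x = mor ([D] @ [D]) [D] ?z fold_fun
      (mor ([] @ [D]) ([D] @ [D]) (union_index 0 1 ?id ?id) (union_fun 0 ?idf ?idf) x)"
    using mor_union[OF D2(2,1,1,1) e0 e1 feps_closed[OF one_K] car] mor_ident[OF D2(1) car] fprod_unit(1)[OF D2(1) car]
    by (simp add: algebra_mult algebra_one[of ?id ?idf])
  also have "\<dots> = mor [D] [D] ?id ?idf x"
    using mor_compose[OF _ D2(3,1) eL fe] mor_same_order[OF D2(1,1) _ e1 so] coord_embedding_compose[OF eL fe] car
    by simp
  finally show "\<one>\<^bsub>A\<^esub> \<otimes>\<^bsub>A\<^esub> x = x" using mor_ident[OF D2(1) car] by simp
  have "x \<otimes>\<^bsub>A\<^esub> \<one>\<^bsub>A\<^esub> = mor ([D] @ [D]) [D] ?z fold_fun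
      (mor ([D] @ []) ([D] @ [D]) (union_index 1 1 ?id ?id) (union_fun 1 ?idf ?idf) x)"
    using mor_union[OF D2(1,1,2,1) e1 e0 car feps_closed[OF one_K]] mor_ident[OF D2(1) car] fprod_unit(2)[OF D2(1) car]
    by (simp add: algebra_mult algebra_one[of ?id ?idf])
  also have "\<dots> = mor [D] [D] ?id ?idf x"
    using mor_compose[OF _ D2(3,1) eR fe] mor_same_order[OF D2(1,1) _ e1 so] coord_embedding_compose[OF eR fe] car
    by simp
  finally show "x \<otimes>\<^bsub>A\<^esub> \<one>\<^bsub>A\<^esub> = x" using mor_ident[OF D2(1) car] by simp
qed

lemma fold_linear: "mor [D, D] [D] (\<lambda>i. 0) fold_fun \<in> linear_maps K (fobj F ([D] @ [D])) (fobj F [D])"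
  using mor_linear[of "[D, D]" "[D]"] fold_emb by simp

lemma mult_bilinear: "bilinear K A A A (mult A)"
proof -
  have "bilinear K (fobj F [D]) (fobj F [D]) (fobj F [D]) (mult A)"
    unfolding algebra_mult[abs_def] using D
    by (intro bilinear_linear[OF _ _ fprod_bilinear fold_linear]) auto
  then show ?thesis unfolding bilinear_def linear_maps_functor_algebra algebra_simps_F .
qed

lemma algebra_monoid: "Group.monoid A"
proof (rule monoidI)
  show "\<one>\<^bsub>A\<^esub> \<in> carrier A"
    unfolding algebra_one[of "\<lambda>i. i" "\<lambda>i t. t"] algebra_simps_F by (rule mor_closed) (auto simp: coord_embedding_empty)
qed (use bilinearD(1)[OF mult_bilinear algebra_module algebra_module] algebra_assoc algebra_unit in auto)

lemma unital_assoc_algebra: "unital_assoc_algebra K A"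
proof -
  interpret A: Module.module K A by (rule algebra_module)
  note B = bilinearD[OF mult_bilinear algebra_module algebra_module]
  have "Ring.ring A"
    by (rule ringI[OF A.abelian_group_axioms algebra_monoid]) (auto simp: B)
  then show ?thesis unfolding unital_assoc_algebra_def using algebra_module by (auto simp: B)
qed

end

section \<open>The values of an isotopy invariant functor\<close>

context isotopy_functor
begin

text \<open>The identity in coordinates relates any two disks. It identifies \<open>F [E]\<close>
  with \<open>A\<close>, although \<open>A\<close> is built from the fixed disk
  \<open>D\<close>.\<close>

abbreviation "transport E Z \<equiv> mor [E] [Z] (\<lambda>i. i) (\<lambda>i t. t)"

lemma transport_emb: "coord_embedding (length [E]) (length [Z]) (\<lambda>i. i) (\<lambda>i t. t)"
  using coord_embedding_ident[of 1] by simp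

lemma transport_transport:
  assumes "oriented_disk E" "oriented_disk Z" "oriented_disk W" "x \<in> carrier (fobj F [E])"
  shows "transport Z W (transport E Z x) = transport E W x"
  using mor_compose[OF _ _ _ transport_emb transport_emb, of E Z W x] assms by simp

lemma transport_ident: "oriented_disk E \<Longrightarrow> x \<in> carrier (fobj F [E]) \<Longrightarrow> transport E E x = x"
  using mor_ident[of "[E]"] by simp

lemma transport_iso:
  assumes E: "oriented_disk E" shows "transport D E \<in> linear_isos K A (fobj F [E])"
proof -
  have DE: "disks [D]" "disks [E]" using E by simp_all
  have "bij_betw (transport D E) (carrier (fobj F [D])) (carrier (fobj F [E]))"
    using transport_transport transport_ident mor_closed[OF DE transport_emb] mor_closed[OF DE(2,1) transport_emb] E
    by (intro bij_betw_byWitness[where f' = "transport E D"]) auto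
  moreover have "transport D E \<in> linear_maps K A (fobj F [E])"
    unfolding linear_maps_functor_algebra by (rule mor_linear[OF DE transport_emb])
  ultimately show ?thesis by (simp add: linear_isos_def algebra_simps_F)
qed

text \<open>The pure tensors of \<open>F X\<close>, seen as a tensor power of \<open>A\<close>.
  Entries are read by \<open>hd\<close> and \<open>tl\<close>, so that the recursion runs over
  \<open>X\<close> alone.\<close>

primrec gen :: "'p disk list \<Rightarrow> 'v list \<Rightarrow> 'v" where
  "gen [] as = feps F \<one>\<^bsub>K\<^esub>"
| "gen (E # X) as = fprod K F [E] X (transport D E (hd as)) (gen X (tl as))"

text \<open>The structure isomorphisms \<open>feps F\<close> and \<open>fmu F\<close> take the place
  of the isomorphisms in \<open>tensor_power_zero\<close> and
  \<open>tensor_power_tensor\<close>.\<close>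

lemma gen_power: "disks X \<Longrightarrow> tensor_power K A (length X) (fobj F X) (gen X)"
proof (induction X)
  case Nil
  have "tensor_power K A 0 (fobj F []) (\<lambda>as. feps F \<one>\<^bsub>K\<^esub>)"
    by (rule tensor_power_zero[OF K fobj_module feps_iso]) simp
  then show ?case by simp
next
  case (Cons E X)
  then have E: "oriented_disk E" "disks [E]" and X: "disks X" by simp_all
  have 1: "tensor_power K A 1 (fobj F [E]) (\<lambda>as. transport D E (hd as))"
    by (rule tensor_power_one[OF algebra_module fobj_module transport_iso]) (simp_all add: E)
  have "tensor_power K A (1 + length X) (fobj F ([E] @ X))
     (\<lambda>as. fmu F [E] X (pure_tensor K (fobj F [E]) (fobj F X) (transport D E (hd (take 1 as))) (gen X (drop 1 as))))"
    using E X by (intro tensor_power_tensor[OF algebra_module 1 Cons.IH[OF X] fobj_module fmu_iso]) simp_all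
  moreover have "(\<lambda>as. fmu F [E] X (pure_tensor K (fobj F [E]) (fobj F X) (transport D E (hd (take 1 as))) (gen X (drop 1 as)))) =
      gen (E # X)"
  proof
    fix as show "fmu F [E] X (pure_tensor K (fobj F [E]) (fobj F X) (transport D E (hd (take 1 as))) (gen X (drop 1 as))) =
      gen (E # X) as"
      by (cases as) (simp_all add: fprod_def)
  qed
  ultimately show ?case by (simp del: gen.simps)
qed

lemma gen_closed: "disks X \<Longrightarrow> as \<in> tuples A (length X) \<Longrightarrow> gen X as \<in> carrier (fobj F X)"
  using tensor_powerD(4)[OF gen_power] .

lemma gen_append:
  assumes Y: "disks Y" and bs: "bs \<in> tuples A (length Y)"
  shows "disks X \<Longrightarrow> as \<in> tuples A (length X) \<Longrightarrow> gen (X @ Y) (as @ bs) = fprod K F X Y (gen X as) (gen Y bs)"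
proof (induction X arbitrary: as)
  case Nil
  then show ?case using fprod_unit(1)[OF Y gen_closed[OF Y bs]] by (simp add: tuples_def)
next
  case (Cons E X)
  then obtain a as' where as: "as = a # as'" "a \<in> carrier A" "as' \<in> tuples A (length X)"
    by (auto simp: tuples_def length_Suc_conv)
  have E: "disks [E]" and X: "disks X" using Cons.prems(1) by simp_all
  have a: "transport D E a \<in> carrier (fobj F [E])"
    using mor_closed[OF _ E transport_emb, of D a] as(2) by (simp add: algebra_simps_F)
  show ?case
    using Cons.IH[OF X as(3)] fprod_assoc[OF E X Y a gen_closed[OF X as(3)] gen_closed[OF Y bs]]
    by (simp add: as(1))
qed

lemma gen_single:
  assumes "oriented_disk E" "a \<in> carrier A" shows "gen [E] [a] = transport D E a"
  using fprod_unit(2)[of "[E]" "transport D E a"] mor_closed[OF _ _ transport_emb, of D E a] assms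
  by (simp add: algebra_simps_F)

text \<open>The product formula for one embedding. The conditions on \<open>X\<close>,
  \<open>Y\<close> and the coordinates are included so that closure under composition and union
  needs no side conditions.\<close>

definition good :: "'p disk list \<Rightarrow> 'p disk list \<Rightarrow> (nat \<Rightarrow> nat) \<Rightarrow> (nat \<Rightarrow> real \<Rightarrow> real) \<Rightarrow> bool" where
  "good X Y \<kappa> f \<longleftrightarrow> disks X \<and> disks Y \<and> coord_embedding (length X) (length Y) \<kappa> f \<and>
     (\<forall>as\<in>tuples A (length X).
        mor X Y \<kappa> f (gen X as) = gen Y (ordered_products A (length X) (length Y) \<kappa> f as))"

lemma products_tuples:
  "as \<in> tuples A n \<Longrightarrow> ordered_products A n m \<kappa> f as \<in> tuples A m"
  using ordered_products_carrier[OF algebra_monoid] by (simp add: tuples_def)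

lemma goodD:
  assumes "good X Y \<kappa> f"
  shows "disks X" "disks Y" "coord_embedding (length X) (length Y) \<kappa> f"
    "as \<in> tuples A (length X) \<Longrightarrow>
      mor X Y \<kappa> f (gen X as) = gen Y (ordered_products A (length X) (length Y) \<kappa> f as)"
  using assms unfolding good_def by blast+

lemma good_compose:
  assumes g: "good X Y \<kappa> f" and g': "good Y Z \<kappa>' f'"
  shows "good X Z (\<lambda>i. \<kappa>' (\<kappa> i)) (\<lambda>i t. f' (\<kappa> i) (f i t))"
  unfolding good_def
proof (intro conjI ballI goodD(1)[OF g] goodD(2)[OF g'] coord_embedding_compose[OF goodD(3)[OF g] goodD(3)[OF g']])
  fix as assume as: "as \<in> tuples A (length X)"
  have "mor X Z (\<lambda>i. \<kappa>' (\<kappa> i)) (\<lambda>i t. f' (\<kappa> i) (f i t)) (gen X as) = mor Y Z \<kappa>' f' (mor X Y \<kappa> f (gen X as))"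
    using mor_compose[OF goodD(1,2)[OF g] goodD(2)[OF g'] goodD(3)[OF g] goodD(3)[OF g'] gen_closed[OF goodD(1)[OF g] as]]
    by simp
  also have "\<dots> = gen Z (ordered_products A (length Y) (length Z) \<kappa>' f' (ordered_products A (length X) (length Y) \<kappa> f as))"
    using goodD(4)[OF g as] goodD(4)[OF g' products_tuples[OF as]] by simp
  finally show "mor X Z (\<lambda>i. \<kappa>' (\<kappa> i)) (\<lambda>i t. f' (\<kappa> i) (f i t)) (gen X as) =
      gen Z (ordered_products A (length X) (length Z) (\<lambda>i. \<kappa>' (\<kappa> i)) (\<lambda>i t. f' (\<kappa> i) (f i t)) as)"
    using ordered_products_compose[OF algebra_monoid goodD(3)[OF g] goodD(3)[OF g']] as by (simp add: tuples_def)
qed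

lemma good_union:
  assumes g: "good X X' \<kappa> f" and g': "good Y Y' \<kappa>' f'"
  shows "good (X @ Y) (X' @ Y') (union_index (length X) (length X') \<kappa> \<kappa>') (union_fun (length X) f f')"
  unfolding good_def
proof (intro conjI ballI)
  note d = goodD(1,2)[OF g] goodD(1,2)[OF g'] and e = goodD(3)[OF g] goodD(3)[OF g']
  show "disks (X @ Y)" "disks (X' @ Y')" using d by simp_all
  show "coord_embedding (length (X @ Y)) (length (X' @ Y')) (union_index (length X) (length X') \<kappa> \<kappa>') (union_fun (length X) f f')"
    using coord_embedding_union[OF e] by simp
  fix as assume "as \<in> tuples A (length (X @ Y))"
  then have as: "take (length X) as \<in> tuples A (length X)" "drop (length X) as \<in> tuples A (length Y)"
    using tuples_split[of as A "length X" "length Y"] by simp_all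
  let ?a = "take (length X) as" and ?b = "drop (length X) as"
  have "mor (X @ Y) (X' @ Y') (union_index (length X) (length X') \<kappa> \<kappa>') (union_fun (length X) f f') (gen (X @ Y) (?a @ ?b)) =
      fprod K F X' Y' (mor X X' \<kappa> f (gen X ?a)) (mor Y Y' \<kappa>' f' (gen Y ?b))"
    using gen_append[OF d(3) as(2) d(1) as(1)] mor_union[OF d e gen_closed[OF d(1) as(1)] gen_closed[OF d(3) as(2)]] by simp
  also have "\<dots> = gen (X' @ Y') (ordered_products A (length X) (length X') \<kappa> f ?a @ ordered_products A (length Y) (length Y') \<kappa>' f' ?b)"
    using goodD(4)[OF g as(1)] goodD(4)[OF g' as(2)] gen_append[OF d(4) products_tuples[OF as(2)] d(2) products_tuples[OF as(1)]]
    by simp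
  also have "\<dots> = gen (X' @ Y') (ordered_products A (length (X @ Y)) (length (X' @ Y'))
      (union_index (length X) (length X') \<kappa> \<kappa>') (union_fun (length X) f f') (?a @ ?b))"
    using ordered_products_union[OF e, of ?a A ?b] as(1) by (simp add: tuples_def)
  finally show "mor (X @ Y) (X' @ Y') (union_index (length X) (length X') \<kappa> \<kappa>') (union_fun (length X) f f') (gen (X @ Y) as) =
      gen (X' @ Y') (ordered_products A (length (X @ Y)) (length (X' @ Y'))
      (union_index (length X) (length X') \<kappa> \<kappa>') (union_fun (length X) f f') as)" by simp
qed

lemma good_same_order:
  assumes g: "good X Y \<kappa> f" and e: "coord_embedding (length X) (length Y) \<kappa>' f'"
    and so: "same_order (length X) \<kappa> f \<kappa>' f'"
  shows "good X Y \<kappa>' f'"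
  using g e mor_same_order[OF goodD(1-3)[OF g] e so] ordered_products_same_order[OF goodD(3)[OF g] so, of A]
  unfolding good_def by simp

lemma good_ident: "disks X \<Longrightarrow> good X X (\<lambda>i. i) (\<lambda>i t. t)"
  using mor_ident[OF _ gen_closed] ordered_products_ident[OF algebra_monoid]
  by (auto simp: good_def coord_embedding_ident tuples_def)

lemma good_swap:
  assumes X: "disks X" and Y: "disks Y"
  shows "good (X @ Y) (Y @ X) (swap_index (length X) (length Y)) (\<lambda>i t. t)"
  unfolding good_def
proof (intro conjI ballI)
  show "disks (X @ Y)" "disks (Y @ X)" using X Y by simp_all
  show "coord_embedding (length (X @ Y)) (length (Y @ X)) (swap_index (length X) (length Y)) (\<lambda>i t. t)"
    using coord_embedding_swap by simp
  fix as assume "as \<in> tuples A (length (X @ Y))"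
  then have as: "take (length X) as \<in> tuples A (length X)" "drop (length X) as \<in> tuples A (length Y)"
    using tuples_split[of as A "length X" "length Y"] by simp_all
  let ?a = "take (length X) as" and ?b = "drop (length X) as"
  have "mor (X @ Y) (Y @ X) (swap_index (length X) (length Y)) (\<lambda>i t. t) (gen (X @ Y) (?a @ ?b)) = gen (Y @ X) (?b @ ?a)"
    using gen_append[OF Y as(2) X as(1)] gen_append[OF X as(1) Y as(2)]
      mor_swap[OF X Y gen_closed[OF X as(1)] gen_closed[OF Y as(2)]] by simp
  also have "?b @ ?a = ordered_products A (length (X @ Y)) (length (Y @ X)) (swap_index (length X) (length Y)) (\<lambda>i t. t) (?a @ ?b)"
    using ordered_products_swap[OF algebra_monoid, of ?a "length X" ?b "length Y" "\<lambda>i t. t"] as by (simp only: tuples_def mem_Collect_eq length_append)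
  finally show "mor (X @ Y) (Y @ X) (swap_index (length X) (length Y)) (\<lambda>i t. t) (gen (X @ Y) as) =
     gen (Y @ X) (ordered_products A (length (X @ Y)) (length (Y @ X)) (swap_index (length X) (length Y)) (\<lambda>i t. t) as)"
    by simp
qed

lemma good_transport:
  assumes E: "oriented_disk E" and Z: "oriented_disk Z"
  shows "good [E] [Z] (\<lambda>i. i) (\<lambda>i t. t)"
  unfolding good_def
proof (intro conjI ballI transport_emb)
  fix as assume "as \<in> tuples A (length [E])"
  then obtain a where as: "as = [a]" "a \<in> carrier A" by (auto simp: tuples_def length_Suc_conv)
  have "ordered_products A (length [E]) (length [Z]) (\<lambda>i. i) (\<lambda>i t. t) as = as"
    using ordered_products_ident[OF algebra_monoid, of as 1] as by simp
  then show "transport E Z (gen [E] as) = gen [Z] (ordered_products A (length [E]) (length [Z]) (\<lambda>i. i) (\<lambda>i t. t) as)"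
    using gen_single[OF E as(2)] gen_single[OF Z as(2)] transport_transport[OF D E Z, of a] as
    by (simp only: algebra_simps_F)
qed (use E Z in simp_all)

lemma transport_mor:
  assumes X: "disks X" and Z: "oriented_disk Z" and e: "coord_embedding (length X) (length [D]) \<kappa> f"
    and x: "x \<in> carrier (fobj F X)"
  shows "transport D Z (mor X [D] \<kappa> f x) = mor X [Z] \<kappa> f x"
  using mor_compose[OF X _ _ e transport_emb x, of Z] Z by simp

text \<open>The multiplication of \<open>A\<close> was defined with the disk \<open>D\<close>. In
  coordinates the fold embedding is the same for all disks, so transporting two factors to
  \<open>Z\<close> and folding there is folding in \<open>D\<close> and transporting the
  product.\<close>

lemma good_fold:
  assumes Z: "oriented_disk Z" shows "good [Z, Z] [Z] (\<lambda>i. 0) fold_fun"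
  unfolding good_def
proof (intro conjI ballI fold_emb)
  fix as assume "as \<in> tuples A (length [Z, Z])"
  then obtain a b where as: "as = [a, b]" "a \<in> carrier A" "b \<in> carrier A"
    by (auto simp: tuples_def length_Suc_conv numeral_2_eq_2)
  note ab = as(2,3)[unfolded algebra_simps_F]
  have d: "disks [D]" "disks [Z]" "disks ([D] @ [D])" "disks ([Z] @ [Z])" using Z by simp_all
  let ?id = "\<lambda>i::nat. i" and ?idf = "\<lambda>(i::nat) t::real. t" and ?z = "\<lambda>i::nat. 0::nat"
  have "gen [Z, Z] as = fprod K F [Z] [Z] (transport D Z a) (transport D Z b)"
    using gen_single[OF Z as(3)] as(1) by simp
  also have "\<dots> = mor ([D] @ [D]) ([Z] @ [Z]) (union_index (length [D]) (length [Z]) ?id ?id) (union_fun (length [D]) ?idf ?idf)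
     (fprod K F [D] [D] a b)"
    using mor_union[OF d(1,2,1,2) transport_emb transport_emb ab] by simp
  also have "\<dots> = mor ([D] @ [D]) ([Z] @ [Z]) ?id ?idf (fprod K F [D] [D] a b)"
  proof -
    have "coord_map ([D] @ [D]) ([Z] @ [Z]) (union_index (length [D]) (length [Z]) ?id ?id) (union_fun (length [D]) ?idf ?idf) =
       coord_map ([D] @ [D]) ([Z] @ [Z]) ?id ?idf"
      by (rule coord_map_cong[OF d(3)]) (auto simp: union_index_def union_fun_def)
    then show ?thesis by (simp add: mor_def)
  qed
  finally have g: "gen [Z, Z] as = mor ([D] @ [D]) ([Z] @ [Z]) ?id ?idf (fprod K F [D] [D] a b)" .
  have e2: "coord_embedding (length ([D] @ [D])) (length ([Z] @ [Z])) ?id ?idf"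
    using coord_embedding_ident[of 2] by (simp add: numeral_2_eq_2)
  have p: "fprod K F [D] [D] a b \<in> carrier (fobj F ([D] @ [D]))" using fprod_closed[OF d(1,1) ab] .
  have fe: "coord_embedding (length ([W] @ [W])) (length [W]) ?z fold_fun" for W :: "'p disk" using fold_emb by simp
  have "mor [Z, Z] [Z] ?z fold_fun (gen [Z, Z] as) = mor ([D] @ [D]) [Z] ?z fold_fun (fprod K F [D] [D] a b)"
    using mor_compose[OF d(3,4,2) e2 fe p] g by simp
  also have "\<dots> = transport D Z (a \<otimes>\<^bsub>A\<^esub> b)"
    using transport_mor[OF d(3) Z _ p, of ?z fold_fun] fe[of D] by (simp add: algebra_mult)
  also have "\<dots> = gen [Z] [a \<otimes>\<^bsub>A\<^esub> b]"
    using gen_single[OF Z, of "a \<otimes>\<^bsub>A\<^esub> b"] as monoid.m_closed[OF algebra_monoid] by simp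
  finally show "mor [Z, Z] [Z] ?z fold_fun (gen [Z, Z] as) =
      gen [Z] (ordered_products A (length [Z, Z]) (length [Z]) ?z fold_fun as)"
    using ordered_products_fold[OF algebra_monoid as(2,3)] by (simp add: as(1) numeral_2_eq_2)
qed (use Z in simp_all)

lemma good_unit:
  assumes Z: "oriented_disk Z" shows "good [] [Z] \<kappa> f"
  unfolding good_def
proof (intro conjI ballI)
  show e: "coord_embedding (length []) (length [Z]) \<kappa> f" by (simp add: coord_embedding_empty)
  fix as assume "as \<in> tuples A (length ([] :: 'p disk list))"
  then have as: "as = []" by (simp add: tuples_def)
  have "mor [] [Z] \<kappa> f (gen [] as) = transport D Z \<one>\<^bsub>A\<^esub>"
    using transport_mor[OF _ Z, of "[]" \<kappa> f "feps F \<one>\<^bsub>K\<^esub>"] by (simp add: algebra_one[of \<kappa> f] coord_embedding_empty)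
  also have "\<dots> = gen [Z] [\<one>\<^bsub>A\<^esub>]" using gen_single[OF Z] monoid.one_closed[OF algebra_monoid] by simp
  finally show "mor [] [Z] \<kappa> f (gen [] as) = gen [Z] (ordered_products A (length []) (length [Z]) \<kappa> f as)"
    using ordered_products_empty[of A 1 \<kappa> f] by (simp add: as)
qed (use Z in simp_all)

lemma good_empty: "disks Y \<Longrightarrow> good [] Y \<kappa> f"
proof (induction Y arbitrary: \<kappa> f)
  case (Nil \<kappa> f)
  then show ?case
    using good_same_order[OF good_ident[of "[]"], of \<kappa> f] by (simp add: coord_embedding_empty same_order_def)
next
  case (Cons Z Y \<kappa> f)
  \<comment> \<open>Units are inserted one component at a time. Out of the empty union any two
    embeddings have the same order, so the shifted coordinates may be replaced by the given
    ones.\<close>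
  have "good ([] @ []) ([Z] @ Y) (union_index 0 1 \<kappa> \<kappa>) (union_fun 0 f f)"
    using good_union[OF good_unit[of Z \<kappa> f] Cons.IH[of \<kappa> f]] Cons.prems by simp
  then show ?case
    using good_same_order[of "[]" "Z # Y"] by (simp add: coord_embedding_empty same_order_def)
qed

text \<open>
  The leftmost disk of its fibre can be split off: \<open>f\<close> is isotopic to the embedding of the
  remaining disks, followed by the fold embedding into the component that contains the split disk.
\<close>

lemma good_leftmost:
  assumes E: "oriented_disk E" and X: "disks X" and Y: "disks Y"
    and e: "coord_embedding (Suc (length X)) (length Y) \<kappa> f"
    and rest: "good X Y (\<lambda>i. \<kappa> (Suc i)) (\<lambda>i. f (Suc i))"
    and left: "\<And>i. i < length X \<Longrightarrow> \<kappa> (Suc i) = \<kappa> 0 \<Longrightarrow> f 0 0 < f (Suc i) 0"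
  shows "good (E # X) Y \<kappa> f"
proof -
  define k where "k = \<kappa> 0"
  have k: "k < length Y" using coord_embeddingD(1)[OF e, of 0] by (simp add: k_def)
  \<comment> \<open>\<open>Z\<close> is the component that contains the split disk; \<open>P\<close>
    and \<open>Q\<close> are the components before and after it.\<close>
  define P Q Z where "P = take k Y" and "Q = drop (Suc k) Y" and "Z = Y ! k"
  have Y_eq: "Y = P @ [Z] @ Q" using id_take_nth_drop[OF k] by (simp add: P_def Q_def Z_def)
  have lP: "length P = k" using k by (simp add: P_def)
  have d: "disks P" "oriented_disk Z" "disks Q" using Y unfolding Y_eq by simp_all
  let ?id = "\<lambda>i::nat. i" and ?idf = "\<lambda>(i::nat) t::real. t" and ?z = "\<lambda>i::nat. 0::nat"
  \<comment> \<open>The remaining disks are embedded while \<open>E\<close> waits in front as a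
    component of its own.\<close>
  define u0 where "u0 = union_index 1 1 ?id (\<lambda>i. \<kappa> (Suc i))"
  define g0 where "g0 = union_fun 1 ?idf (\<lambda>i. f (Suc i))"
  have g0: "good (E # X) (E # P @ [Z] @ Q) u0 g0"
    using good_union[OF good_ident[of "[E]"] rest] E by (simp add: Y_eq u0_def g0_def)
  \<comment> \<open>\<open>E\<close> is moved across \<open>P\<close>, to the place just before
    \<open>Z\<close>.\<close>
  define u1 where "u1 = union_index (1 + k) (k + 1) (swap_index 1 k) ?id"
  define g1 where "g1 = union_fun (1 + k) ?idf ?idf"
  have g1: "good (E # P @ [Z] @ Q) (P @ [E] @ [Z] @ Q) u1 g1"
    using good_union[OF good_swap[of "[E]" P] good_ident[of "[Z] @ Q"]] E d by (simp add: u1_def g1_def lP)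
  \<comment> \<open>The fold embedding needs two copies of one disk, so \<open>E\<close> is
    transported to \<open>Z\<close> and then folded into it; \<open>P\<close> and \<open>Q\<close>
    stay fixed.\<close>
  define u2 where "u2 = union_index k k ?id (union_index 2 1 (\<lambda>i. ?z (union_index 1 1 ?id ?id i)) ?id)"
  define g2 where "g2 = union_fun k ?idf (union_fun 2 (\<lambda>i t. fold_fun (union_index 1 1 ?id ?id i) (union_fun 1 ?idf ?idf i t)) ?idf)"
  have "good ([E] @ [Z]) ([Z] @ [Z]) (union_index 1 1 ?id ?id) (union_fun 1 ?idf ?idf)"
    using good_union[OF good_transport[OF E d(2)] good_transport[OF d(2) d(2)]] by simp
  then have "good [E, Z] [Z] (\<lambda>i. ?z (union_index 1 1 ?id ?id i)) (\<lambda>i t. fold_fun (union_index 1 1 ?id ?id i) (union_fun 1 ?idf ?idf i t))"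
    using good_compose good_fold[OF d(2)] by fastforce
  from good_union[OF good_ident[OF d(1)] good_union[OF this good_ident[OF d(3)]]]
  have g2: "good (P @ [E] @ [Z] @ Q) (P @ [Z] @ Q) u2 g2" by (simp add: lP u2_def g2_def numeral_2_eq_2)
  define u where "u i = u2 (u1 (u0 i))" for i
  define h where "h i t = g2 (u1 (u0 i)) (g1 (u0 i) (g0 i t))" for i t
  have gh: "good (E # X) Y u h"
    using good_compose[OF good_compose[OF g0 g1] g2] unfolding u_def[abs_def] h_def[abs_def] Y_eq .
  \<comment> \<open>The split disk is centred at \<open>- 1\<close>, while the others in its
    component are pushed by \<open>exp\<close> to positive positions in unchanged order. By
    \<open>left\<close> this is the order of \<open>f\<close>.\<close>
  have u_0: "u 0 = k" and h_0: "h 0 0 = - 1"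
    by (simp_all add: u_def h_def u0_def u1_def u2_def g0_def g1_def g2_def union_index_def union_fun_def
        swap_index_def fold_fun_def)
  have u_Suc: "u (Suc i) = \<kappa> (Suc i)" for i
    by (cases "\<kappa> (Suc i)" k rule: linorder_cases)
      (auto simp: u_def u0_def u1_def u2_def union_index_def swap_index_def)
  have h_Suc: "h (Suc i) 0 = (if \<kappa> (Suc i) = k then exp (f (Suc i) 0) else f (Suc i) 0)" for i
    by (cases "\<kappa> (Suc i)" k rule: linorder_cases)
      (auto simp: h_def u0_def u1_def g0_def g1_def g2_def union_index_def union_fun_def swap_index_def fold_fun_def)
  have "same_order (length (E # X)) u h \<kappa> f"
    unfolding same_order_def
  proof (intro conjI allI impI)
    fix i show "u i = \<kappa> i" using u_0 u_Suc by (cases i) (simp_all add: k_def)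
  next
    fix i i' assume i: "i < length (E # X)" "i' < length (E # X)" and "u i = u i'"
    then have "\<kappa> i = \<kappa> i'" using u_0 u_Suc by (cases i; cases i') (simp_all add: k_def)
    moreover have "- 1 < exp t" "\<not> exp t < - 1" for t :: real
      using exp_gt_zero[of t] by linarith+
    ultimately show "h i 0 < h i' 0 \<longleftrightarrow> f i 0 < f i' 0"
      using left[of "i - 1"] left[of "i' - 1"] i by (cases i; cases i') (auto simp: h_0 h_Suc k_def)
  qed
  then show ?thesis using good_same_order[OF gh] e by simp
qed

text \<open>Induction on the number of source disks. A disk with the smallest \<open>f i 0\<close>
  overall is also leftmost in its own component; a permutation brings it to the front of the list,
  where \<open>good_leftmost\<close> splits it off.\<close>

theorem good_all:
  "disks X \<Longrightarrow> disks Y \<Longrightarrow> coord_embedding (length X) (length Y) \<kappa> f \<Longrightarrow> good X Y \<kappa> f"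
proof (induction "length X" arbitrary: X \<kappa> f)
  case 0
  then show ?case using good_empty by simp
next
  case (Suc n)
  note X = Suc.prems(1) and Y = Suc.prems(2) and e = Suc.prems(3)
  have "0 \<in> {..<length X}" using Suc.hyps(2) by (metis lessThan_iff zero_less_Suc)
  then have "{..<length X} \<noteq> {}" by blast
  then obtain i where "is_arg_min (\<lambda>i. f i 0) (\<lambda>i. i \<in> {..<length X}) i"
    using ex_is_arg_min_if_finite[of "{..<length X}" "\<lambda>i. f i 0"] by blast
  then have i: "i < length X" and min: "\<And>i'. i' < length X \<Longrightarrow> f i 0 \<le> f i' 0"
    by (simp_all add: is_arg_min_linorder)
  define U V E where "U = take i X" and "V = drop (Suc i) X" and "E = X ! i"
  have X_eq: "X = U @ [E] @ V" using id_take_nth_drop[OF i] by (simp add: U_def V_def E_def)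
  have lU: "length U = i" using i by (simp add: U_def)
  have d: "disks U" "oriented_disk E" "disks V" using X unfolding X_eq by simp_all
  \<comment> \<open>Sends a position in \<open>E # U @ V\<close> to the position of the same disk in
    \<open>X\<close>: the front goes to \<open>i\<close>, the entries of \<open>U\<close> move back
    by one, those of \<open>V\<close> keep their place.\<close>
  define \<tau> where "\<tau> c = (if c = 0 then i else if c \<le> i then c - 1 else c)" for c
  let ?id = "\<lambda>i::nat. i" and ?idf = "\<lambda>(i::nat) t::real. t"
  have lX: "length X = Suc (length (U @ V))" unfolding X_eq by simp
  have \<tau>: "coord_embedding (Suc (length (U @ V))) (length X) \<tau> ?idf"
    using i lX by (intro coord_embedding_inj) (auto simp: \<tau>_def inj_on_def increasing_smooth_id)
  have e1: "coord_embedding (Suc (length (U @ V))) (length Y) (\<lambda>c. \<kappa> (\<tau> c)) (\<lambda>c. f (\<tau> c))"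
    using coord_embedding_compose[OF \<tau> e] by simp
  have S: "coord_embedding (length (U @ V)) (Suc (length (U @ V))) Suc ?idf"
    by (rule coord_embedding_inj) (auto simp: increasing_smooth_id)
  have g': "good (U @ V) Y (\<lambda>c. \<kappa> (\<tau> (Suc c))) (\<lambda>c. f (\<tau> (Suc c)))"
  proof (rule Suc.hyps(1))
    show "n = length (U @ V)" using Suc.hyps(2) lX by simp
    show "coord_embedding (length (U @ V)) (length Y) (\<lambda>c. \<kappa> (\<tau> (Suc c))) (\<lambda>c. f (\<tau> (Suc c)))"
      using coord_embedding_compose[OF S e1] by simp
  qed (use d Y in simp_all)
  have g1: "good (E # U @ V) Y (\<lambda>c. \<kappa> (\<tau> c)) (\<lambda>c. f (\<tau> c))"
  proof (rule good_leftmost[OF d(2) _ Y e1 g'])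
    fix c assume c: "c < length (U @ V)" "\<kappa> (\<tau> (Suc c)) = \<kappa> (\<tau> 0)"
    have "\<tau> (Suc c) < length X" using coord_embeddingD(1)[OF \<tau>, of "Suc c"] c(1) by simp
    moreover have "\<tau> (Suc c) \<noteq> \<tau> 0" by (auto simp: \<tau>_def)
    \<comment> \<open>Minimality gives a weak inequality; disjointness of the images excludes
      equality.\<close>
    ultimately show "f (\<tau> 0) 0 < f (\<tau> (Suc c)) 0"
      using min[of "\<tau> (Suc c)"] coord_embeddingD(3)[OF e, of "\<tau> (Suc c)" i 0 0] i c(2) by (simp add: \<tau>_def)
  qed (use d in simp)
  define \<sigma> where "\<sigma> = union_index (i + 1) (1 + i) (swap_index i 1) ?id"
  have g0: "good X (E # U @ V) \<sigma> (union_fun (i + 1) ?idf ?idf)"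
    using good_union[OF good_swap[of U "[E]"] good_ident[OF d(3)]] d unfolding X_eq by (simp add: \<sigma>_def lU)
  \<comment> \<open>\<open>\<sigma>\<close>, a swap of \<open>U\<close> with \<open>[E]\<close>,
    undoes the reordering, so the composite has the components and the order of the original
    embedding.\<close>
  have "\<tau> (\<sigma> c) = c" for c
    by (auto simp: \<tau>_def \<sigma>_def union_index_def swap_index_def)
  then have "same_order (length X) (\<lambda>c. \<kappa> (\<tau> (\<sigma> c))) (\<lambda>c t. f (\<tau> (\<sigma> c)) (union_fun (i + 1) ?idf ?idf c t)) \<kappa> f"
    by (simp add: same_order_def union_fun_def)
  then show ?case using good_same_order[OF good_compose[OF g0 g1] e] by simp
qed

end

section \<open>Full faithfulness\<close>

context isotopy_functor
begin

lemma fmor_gen: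
  assumes X: "disks X" and Y: "disks Y" and e: "coord_embedding (length X) (length Y) \<kappa> f"
    and as: "as \<in> tuples A (length X)"
  shows "fmor F X Y (coord_map X Y \<kappa> f) (gen X as) = gen Y (ordered_products A (length X) (length Y) \<kappa> f as)"
  using goodD(4)[OF good_all[OF X Y e] as] by (simp add: mor_def)

lemma feps_smult: "a \<in> carrier K \<Longrightarrow> feps F a = a \<odot>\<^bsub>fobj F []\<^esub> feps F \<one>\<^bsub>K\<^esub>"
proof -
  interpret K: cring K by (rule K)
  assume a: "a \<in> carrier K"
  then have "feps F (a \<odot>\<^bsub>ground_space K\<^esub> \<one>\<^bsub>K\<^esub>) = a \<odot>\<^bsub>fobj F []\<^esub> feps F \<one>\<^bsub>K\<^esub>"
    by (intro linear_mapsD(3)[OF linear_isosD(1)[OF feps_iso]]) (simp_all add: ground_space_def)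
  then show ?thesis using a by (simp add: ground_space_def)
qed

end

text \<open>With the generators of a second functor as \<open>\<phi>\<close>, this supplies the
  tensor powers of an algebra homomorphism \<open>h\<close>.\<close>

lemma multilinear_map:
  assumes h: "h \<in> linear_maps K A B" and \<phi>: "multilinear K B n W \<phi>" and A: "Module.module K A"
  shows "multilinear K A n W (\<lambda>as. \<phi> (map h as))"
proof (rule multilinearI)
  note H = linear_mapsD[OF h]
  have car: "set (map h us) \<subseteq> carrier B" if "set us \<subseteq> carrier A" for us
    using that H(1) by auto
  show "\<phi> (map h as) \<in> carrier W" if "as \<in> tuples A n" for as
    using multilinearD(1)[OF \<phi>, of "map h as"] car that by (simp add: tuples_def)
  fix us vs assume us: "set us \<subseteq> carrier A" and vs: "set vs \<subseteq> carrier A" and len: "length us + 1 + length vs = n"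
  have l: "restrict (\<lambda>x. \<phi> (map h us @ x # map h vs)) (carrier B) \<in> linear_maps K B W"
    using multilinearD(2)[OF \<phi> car[OF us] car[OF vs]] len by simp
  have "compose (carrier A) (restrict (\<lambda>x. \<phi> (map h us @ x # map h vs)) (carrier B)) h =
      restrict (\<lambda>x. \<phi> (map h (us @ x # vs))) (carrier A)"
    using H(1) by (auto simp: compose_def restrict_def)
  then show "restrict (\<lambda>x. \<phi> (map h (us @ x # vs))) (carrier A) \<in> linear_maps K A W"
    using linear_maps_compose[OF A h l] by simp
qed

lemma Arr_disk_cat: "Arr disk_cat = oriented_embeddings"
  by (simp add: disk_cat_def)

lemma monoidal_transformationsD:
  assumes "\<alpha> \<in> monoidal_transformations K F G"
  shows "\<alpha> \<in> extensional (Obj disk_cat)"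
    and "disks X \<Longrightarrow> \<alpha> X \<in> linear_maps K (fobj F X) (fobj G X)"
    and "disks X \<Longrightarrow> disks Y \<Longrightarrow> j \<in> oriented_embeddings X Y \<Longrightarrow> x \<in> carrier (fobj F X) \<Longrightarrow>
      \<alpha> Y (fmor F X Y j x) = fmor G X Y j (\<alpha> X x)"
    and "disks X \<Longrightarrow> disks Y \<Longrightarrow> x \<in> carrier (fobj F X) \<Longrightarrow> y \<in> carrier (fobj F Y) \<Longrightarrow>
      \<alpha> (X @ Y) (fprod K F X Y x y) = fprod K G X Y (\<alpha> X x) (\<alpha> Y y)"
    and "a \<in> carrier K \<Longrightarrow> \<alpha> [] (feps F a) = feps G a"
proof -
  note M = assms[unfolded monoidal_transformations_def mem_Collect_eq]
  note c = M[THEN conjunct2]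
  show "\<alpha> \<in> extensional (Obj disk_cat)" using M by (rule conjunct1)
  show "disks X \<Longrightarrow> \<alpha> X \<in> linear_maps K (fobj F X) (fobj G X)" using c[THEN conjunct1] by blast
  show "disks X \<Longrightarrow> disks Y \<Longrightarrow> j \<in> oriented_embeddings X Y \<Longrightarrow> x \<in> carrier (fobj F X) \<Longrightarrow>
      \<alpha> Y (fmor F X Y j x) = fmor G X Y j (\<alpha> X x)"
    using c[THEN conjunct2, THEN conjunct1] by (simp add: Arr_disk_cat)
  show "disks X \<Longrightarrow> disks Y \<Longrightarrow> x \<in> carrier (fobj F X) \<Longrightarrow> y \<in> carrier (fobj F Y) \<Longrightarrow>
      \<alpha> (X @ Y) (fprod K F X Y x y) = fprod K G X Y (\<alpha> X x) (\<alpha> Y y)"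
    using c[THEN conjunct2, THEN conjunct2, THEN conjunct1] by blast
  show "a \<in> carrier K \<Longrightarrow> \<alpha> [] (feps F a) = feps G a"
    using c[THEN conjunct2, THEN conjunct2, THEN conjunct2] by blast
qed

lemma monoidal_transformationsI:
  assumes "\<alpha> \<in> extensional (Obj disk_cat)"
    and "\<And>X. disks X \<Longrightarrow> \<alpha> X \<in> linear_maps K (fobj F X) (fobj G X)"
    and "\<And>X Y j x. disks X \<Longrightarrow> disks Y \<Longrightarrow> j \<in> oriented_embeddings X Y \<Longrightarrow> x \<in> carrier (fobj F X) \<Longrightarrow>
      \<alpha> Y (fmor F X Y j x) = fmor G X Y j (\<alpha> X x)"
    and "\<And>X Y x y. disks X \<Longrightarrow> disks Y \<Longrightarrow> x \<in> carrier (fobj F X) \<Longrightarrow> y \<in> carrier (fobj F Y) \<Longrightarrow>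
      \<alpha> (X @ Y) (fprod K F X Y x y) = fprod K G X Y (\<alpha> X x) (\<alpha> Y y)"
    and "\<And>a. a \<in> carrier K \<Longrightarrow> \<alpha> [] (feps F a) = feps G a"
  shows "\<alpha> \<in> monoidal_transformations K F G"
  unfolding monoidal_transformations_def using assms by (simp add: Arr_disk_cat)

locale isotopy_functor_pair = F: isotopy_functor K D F + G: isotopy_functor K D G
  for K :: "('k, 'm) ring_scheme" and D :: "'p disk" and F G :: "('p, 'k, 'v) sm_functor"
begin

text \<open>Naturality along the transport from \<open>D\<close> to a disk, together with
  monoidality, reduces every component to the one at \<open>[D]\<close>. Faithfulness follows
  because these elements generate.\<close>

lemma transformation_gen:
  assumes \<alpha>: "\<alpha> \<in> monoidal_transformations K F G"
  shows "disks X \<Longrightarrow> as \<in> tuples F.A (length X) \<Longrightarrow> \<alpha> X (F.gen X as) = G.gen X (map (\<alpha> [D]) as)"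
proof (induction X arbitrary: as)
  case Nil
  then show ?case using monoidal_transformationsD(5)[OF \<alpha> F.one_K] by simp
next
  case (Cons E X)
  note T = monoidal_transformationsD[OF \<alpha>]
  obtain a as' where as: "as = a # as'" "a \<in> carrier F.A" "as' \<in> tuples F.A (length X)"
    using Cons.prems(2) by (auto simp: tuples_def length_Suc_conv)
  have E: "disks [E]" and X: "disks X" using Cons.prems(1) by simp_all
  have D: "disks [D]" by simp
  have a: "a \<in> carrier (fobj F [D])" using as(2) by (simp add: F.algebra_simps_F)
  have "coord_map [D] [E] (\<lambda>i. i) (\<lambda>i t. t) \<in> oriented_embeddings [D] [E]"
    by (rule coord_map_in_embeddings[OF D E F.transport_emb])
  then have "\<alpha> [E] (F.transport D E a) = G.transport D E (\<alpha> [D] a)"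
    unfolding F.mor_def G.mor_def by (rule T(3)[OF D E _ a])
  moreover have "\<alpha> ([E] @ X) (fprod K F [E] X (F.transport D E a) (F.gen X as')) =
      fprod K G [E] X (\<alpha> [E] (F.transport D E a)) (\<alpha> X (F.gen X as'))"
    by (rule T(4)[OF E X F.mor_closed[OF D E F.transport_emb a] F.gen_closed[OF X as(3)]])
  ultimately show ?case using Cons.IH[OF X as(3)] by (simp add: as(1))
qed

lemma faithful:
  assumes \<alpha>: "\<alpha> \<in> monoidal_transformations K F G" and \<beta>: "\<beta> \<in> monoidal_transformations K F G"
    and eq: "\<alpha> [D] = \<beta> [D]"
  shows "\<alpha> = \<beta>"
proof (rule extensionalityI[OF monoidal_transformationsD(1)[OF \<alpha>] monoidal_transformationsD(1)[OF \<beta>]])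
  fix X :: "'p disk list" assume X: "disks X"
  show "\<alpha> X = \<beta> X"
    by (rule tensor_power_agree[OF F.gen_power[OF X] monoidal_transformationsD(2)[OF \<alpha> X] monoidal_transformationsD(2)[OF \<beta> X]])
      (simp add: transformation_gen[OF \<alpha> X] transformation_gen[OF \<beta> X] eq)
qed

text \<open>The component at \<open>X\<close> is a tensor power of \<open>h\<close>, given by the
  universal property. On generators, naturality is the product formula in both functors, and
  monoidality is \<open>gen_append\<close>.\<close>

lemma full:
  assumes h: "h \<in> linear_maps K F.A G.A" and hom: "h \<in> ring_hom F.A G.A"
  shows "\<exists>\<alpha>\<in>monoidal_transformations K F G. \<alpha> [D] = h"
proof -
  have map_h: "map h as \<in> tuples G.A n" if "as \<in> tuples F.A n" for as n
    using that linear_mapsD(1)[OF h] by (auto simp: tuples_def)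
  have "\<forall>X\<in>Obj disk_cat. \<exists>l. l \<in> linear_maps K (fobj F X) (fobj G X) \<and>
      (\<forall>as\<in>tuples F.A (length X). l (F.gen X as) = G.gen X (map h as))"
  proof
    fix X :: "'p disk list" assume X: "disks X"
    have "multilinear K F.A (length X) (fobj G X) (\<lambda>as. G.gen X (map h as))"
      by (rule multilinear_map[OF h tensor_powerD(2)[OF G.gen_power[OF X]] F.algebra_module])
    then obtain l where "l \<in> linear_maps K (fobj F X) (fobj G X)"
      "\<And>as. as \<in> tuples F.A (length X) \<Longrightarrow> l (F.gen X as) = G.gen X (map h as)"
      using tensor_power_universal[OF F.gen_power[OF X] G.fobj_module[OF X]] by blast
    then show "\<exists>l. l \<in> linear_maps K (fobj F X) (fobj G X) \<and>
      (\<forall>as\<in>tuples F.A (length X). l (F.gen X as) = G.gen X (map h as))" by blast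
  qed
  from bchoice[OF this] obtain L where L: "\<And>X. disks X \<Longrightarrow> L X \<in> linear_maps K (fobj F X) (fobj G X)"
    "\<And>X as. disks X \<Longrightarrow> as \<in> tuples F.A (length X) \<Longrightarrow> L X (F.gen X as) = G.gen X (map h as)"
    by blast
  define \<alpha> where "\<alpha> = restrict L (Obj disk_cat)"
  have \<alpha>: "\<alpha> X \<in> linear_maps K (fobj F X) (fobj G X)" if "disks X" for X using L(1) that by (simp add: \<alpha>_def)
  have \<alpha>_gen: "\<alpha> X (F.gen X as) = G.gen X (map h as)" if "disks X" "as \<in> tuples F.A (length X)" for X as
    using L(2) that by (simp add: \<alpha>_def)
  have "\<alpha> \<in> monoidal_transformations K F G"
  proof (rule monoidal_transformationsI)
    show "\<alpha> \<in> extensional (Obj disk_cat)" by (simp add: \<alpha>_def)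
    fix X Y j and x :: 'v assume X: "disks X" and Y: "disks Y" and j: "j \<in> oriented_embeddings X Y"
      and x: "x \<in> carrier (fobj F X)"
    obtain \<kappa> f where e: "coord_embedding (length X) (length Y) \<kappa> f" and j_eq: "j = coord_map X Y \<kappa> f"
      using embeddings_coord_map[OF X Y j] .
    have "compose (carrier (fobj F X)) (\<alpha> Y) (fmor F X Y j) = compose (carrier (fobj F X)) (fmor G X Y j) (\<alpha> X)"
    proof (rule tensor_power_agree[OF F.gen_power[OF X]
          linear_maps_compose[OF F.fobj_module[OF X] F.fmor_linear[OF X Y j] \<alpha>[OF Y]]
          linear_maps_compose[OF F.fobj_module[OF X] \<alpha>[OF X] G.fmor_linear[OF X Y j]]])
      fix as assume as: "as \<in> tuples F.A (length X)"
      have "\<alpha> Y (fmor F X Y j (F.gen X as)) = G.gen Y (map h (ordered_products F.A (length X) (length Y) \<kappa> f as))"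
        using F.fmor_gen[OF X Y e as] \<alpha>_gen[OF Y F.products_tuples[OF as]] by (simp add: j_eq)
      also have "map h (ordered_products F.A (length X) (length Y) \<kappa> f as) = ordered_products G.A (length X) (length Y) \<kappa> f (map h as)"
        using as ring_hom_mult[OF hom] ring_hom_one[OF hom]
        by (intro ordered_products_hom[OF F.algebra_monoid]) (auto simp: tuples_def)
      also have "G.gen Y \<dots> = fmor G X Y j (\<alpha> X (F.gen X as))"
        using G.fmor_gen[OF X Y e map_h[OF as]] \<alpha>_gen[OF X as] by (simp add: j_eq)
      finally show "compose (carrier (fobj F X)) (\<alpha> Y) (fmor F X Y j) (F.gen X as) =
          compose (carrier (fobj F X)) (fmor G X Y j) (\<alpha> X) (F.gen X as)"
        using F.gen_closed[OF X as] by (simp add: compose_eq)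
    qed
    then show "\<alpha> Y (fmor F X Y j x) = fmor G X Y j (\<alpha> X x)"
      using x by (metis compose_eq)
  next
    fix X Y and x y :: 'v assume X: "disks X" and Y: "disks Y" and x: "x \<in> carrier (fobj F X)" and y: "y \<in> carrier (fobj F Y)"
    note M = F.fobj_module[OF X] F.fobj_module[OF Y] G.fobj_module[OF X] G.fobj_module[OF Y]
    have XY: "disks (X @ Y)" using X Y by simp
    have b1: "bilinear K (fobj F X) (fobj F Y) (fobj G (X @ Y)) (\<lambda>x y. \<alpha> (X @ Y) (fprod K F X Y x y))"
      by (rule bilinear_linear[OF M(1,2) F.fprod_bilinear[OF X Y] \<alpha>[OF XY]])
    have b2: "bilinear K (fobj F X) (fobj F Y) (fobj G (X @ Y)) (\<lambda>x y. fprod K G X Y (\<alpha> X x) (\<alpha> Y y))"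
      by (rule bilinear_compose[OF G.fprod_bilinear[OF X Y] M \<alpha>[OF X] \<alpha>[OF Y]])
    show "\<alpha> (X @ Y) (fprod K F X Y x y) = fprod K G X Y (\<alpha> X x) (\<alpha> Y y)"
    proof (rule bilinear_agree[OF M(1,2) tensor_powerD(3)[OF F.gen_power[OF X]] _ tensor_powerD(3)[OF F.gen_power[OF Y]] b1 b2 _ _ x y])
      show "F.gen X ` tuples F.A (length X) \<subseteq> carrier (fobj F X)" "F.gen Y ` tuples F.A (length Y) \<subseteq> carrier (fobj F Y)"
        using F.gen_closed X Y by blast+
      fix u v assume "u \<in> F.gen X ` tuples F.A (length X)" "v \<in> F.gen Y ` tuples F.A (length Y)"
      then obtain as bs where as: "as \<in> tuples F.A (length X)" "u = F.gen X as"
        and bs: "bs \<in> tuples F.A (length Y)" "v = F.gen Y bs" by blast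
      have "\<alpha> (X @ Y) (fprod K F X Y u v) = G.gen (X @ Y) (map h (as @ bs))"
        using F.gen_append[OF Y bs(1) X as(1)] \<alpha>_gen[OF XY, of "as @ bs"] tuples_append[OF as(1) bs(1)] as bs by simp
      also have "\<dots> = fprod K G X Y (\<alpha> X u) (\<alpha> Y v)"
        using G.gen_append[OF Y map_h[OF bs(1)] X map_h[OF as(1)]] \<alpha>_gen[OF X as(1)] \<alpha>_gen[OF Y bs(1)] as bs by simp
      finally show "\<alpha> (X @ Y) (fprod K F X Y u v) = fprod K G X Y (\<alpha> X u) (\<alpha> Y v)" .
    qed
  next
    fix a assume a: "a \<in> carrier K"
    have d: "disks []" by simp
    have "\<alpha> [] (F.gen [] []) = G.gen [] (map h [])" by (rule \<alpha>_gen[OF d]) (simp add: tuples_def)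
    then have "\<alpha> [] (feps F \<one>\<^bsub>K\<^esub>) = feps G \<one>\<^bsub>K\<^esub>" by simp
    then show "\<alpha> [] (feps F a) = feps G a"
      unfolding F.feps_smult[OF a] G.feps_smult[OF a] linear_mapsD(3)[OF \<alpha>[OF d] a F.feps_closed[OF F.one_K]] by simp
  qed (rule \<alpha>)
  \<comment> \<open>On the disk \<open>D\<close> itself \<open>gen [D] [a]\<close> is
    \<open>a\<close>, because the transport from \<open>D\<close> to \<open>D\<close> is the
    identity.\<close>
  moreover have "\<alpha> [D] = h"
  proof (rule extensionalityI)
    have D: "disks [D]" by simp
    show "\<alpha> [D] \<in> extensional (carrier F.A)" using linear_mapsD(4)[OF \<alpha>[OF D]] by (simp add: F.algebra_simps_F)
    show "h \<in> extensional (carrier F.A)" using linear_mapsD(4)[OF h] .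
    fix a assume a: "a \<in> carrier F.A"
    have "F.gen [D] [a] = a"
      using F.gen_single[OF F.D a] F.transport_ident[OF F.D] a by (simp only: F.algebra_simps_F)
    moreover have ha: "h a \<in> carrier G.A" using linear_mapsD(1)[OF h a] .
    then have "G.gen [D] [h a] = h a"
      using G.gen_single[OF F.D ha] G.transport_ident[OF F.D] by (simp only: G.algebra_simps_F)
    ultimately show "\<alpha> [D] a = h a"
      using \<alpha>_gen[OF D, of "[a]"] a by (simp add: tuples_def del: F.gen.simps G.gen.simps)
  qed
  ultimately show ?thesis by blast
qed

lemma transformation_algebra_hom:
  assumes \<alpha>: "\<alpha> \<in> monoidal_transformations K F G"
  shows "\<alpha> [D] \<in> linear_maps K F.A G.A" "\<alpha> [D] \<in> ring_hom F.A G.A"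
proof -
  note T = monoidal_transformationsD[OF \<alpha>]
  have D: "disks [D]" "disks [D, D]" "disks []" by simp_all
  show l: "\<alpha> [D] \<in> linear_maps K F.A G.A"
    unfolding linear_maps_functor_algebra by (rule T(2)[OF D(1)])
  show "\<alpha> [D] \<in> ring_hom F.A G.A"
  proof (rule ring_hom_memI)
    fix x y assume x: "x \<in> carrier F.A" and y: "y \<in> carrier F.A"
    show "\<alpha> [D] x \<in> carrier G.A" using linear_mapsD(1)[OF l x] .
    show "\<alpha> [D] (x \<oplus>\<^bsub>F.A\<^esub> y) = \<alpha> [D] x \<oplus>\<^bsub>G.A\<^esub> \<alpha> [D] y" using linear_mapsD(2)[OF l x y] .
    note xy = x[unfolded F.algebra_simps_F] y[unfolded F.algebra_simps_F]
    have p: "fprod K F [D] [D] x y \<in> carrier (fobj F [D, D])" using F.fprod_closed[OF D(1,1) xy] by simp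
    have "\<alpha> [D] (F.mor [D, D] [D] (\<lambda>i. 0) fold_fun (fprod K F [D] [D] x y)) =
        G.mor [D, D] [D] (\<lambda>i. 0) fold_fun (\<alpha> [D, D] (fprod K F [D] [D] x y))"
      unfolding F.mor_def G.mor_def
      by (rule T(3)[OF D(2,1) coord_map_in_embeddings[OF D(2,1) F.fold_emb] p])
    also have "\<alpha> [D, D] (fprod K F [D] [D] x y) = fprod K G [D] [D] (\<alpha> [D] x) (\<alpha> [D] y)"
      using T(4)[OF D(1,1) xy] by simp
    finally show "\<alpha> [D] (x \<otimes>\<^bsub>F.A\<^esub> y) = \<alpha> [D] x \<otimes>\<^bsub>G.A\<^esub> \<alpha> [D] y"
      by (simp add: F.algebra_mult G.algebra_mult)
  next
    let ?e = "coord_map [] [D] (\<lambda>i. i) (\<lambda>i t. t)"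
    have "?e \<in> oriented_embeddings [] [D]"
      by (rule coord_map_in_embeddings[OF D(3,1)]) (simp add: coord_embedding_empty)
    then have "\<alpha> [D] (fmor F [] [D] ?e (feps F \<one>\<^bsub>K\<^esub>)) = fmor G [] [D] ?e (\<alpha> [] (feps F \<one>\<^bsub>K\<^esub>))"
      by (rule T(3)[OF D(3,1) _ F.feps_closed[OF F.one_K]])
    then show "\<alpha> [D] \<one>\<^bsub>F.A\<^esub> = \<one>\<^bsub>G.A\<^esub>"
      unfolding F.algebra_one[of "\<lambda>i. i" "\<lambda>i t. t"] G.algebra_one[of "\<lambda>i. i" "\<lambda>i t. t"] F.mor_def G.mor_def
      using T(5)[OF F.one_K] by simp
  qed
qed

end

section \<open>The functor of an algebra\<close>

lemma coord_map_inject: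
  assumes X: "disks X" and Y: "disks Y" and e: "coord_embedding (length X) (length Y) \<kappa> f"
    and eq: "coord_map X Y \<kappa> f = coord_map X Y \<kappa>' f'" and i: "i < length X"
  shows "\<kappa> i = \<kappa>' i" "f i t = f' i t"
proof -
  have "coord_point Y (\<kappa> i) (f i t) = coord_point Y (\<kappa>' i) (f' i t)"
    using fun_cong[OF eq, of "coord_point X i t"] by (simp add: X i)
  then show "\<kappa> i = \<kappa>' i" "f i t = f' i t"
    using coord_embeddingD(1)[OF e i] by (simp_all add: Y)
qed

text \<open>Two presentations of one embedding differ only at indices beyond the last disk, which
  the order does not test. This makes the product formula well defined on embeddings.\<close>

lemma same_order_coord_map:
  assumes "disks X" "disks Y" "coord_embedding (length X) (length Y) \<kappa> f"
    and "coord_map X Y \<kappa> f = coord_map X Y \<kappa>' f'"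
  shows "same_order (length X) \<kappa> f \<kappa>' f'"
  using coord_map_inject[OF assms] unfolding same_order_def by metis

text \<open>One tensor power is fixed for every \<open>n\<close>, and a union of disks will be sent
  to the power given by their number. Concatenation of lists then corresponds to addition of
  exponents.\<close>

locale algebra_tensor_powers =
  fixes K :: "('k, 'm) ring_scheme" and A :: "('k, 'v) module" and T :: "nat \<Rightarrow> ('k, 'v) module" and g :: "nat \<Rightarrow> 'v list \<Rightarrow> 'v"
  assumes A: "unital_assoc_algebra K A" and T: "\<And>n. tensor_power K A n (T n) (g n)"
    and inf: "infinite (UNIV :: 'v set)" and le: "carrier K \<lesssim> (UNIV :: 'v set)"
begin

lemma A_module: "Module.module K A" and A_ring: "Ring.ring A"
  using A unfolding unital_assoc_algebra_def by blast+

sublocale A: Module.module K A by (rule A_module)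

lemma A_monoid: "Group.monoid A"
  using A_ring by (rule ring.is_monoid)

lemma T_module [simp, intro]: "Module.module K (T n)"
  using tensor_powerD(1)[OF T] .

lemma g_closed: "as \<in> tuples A n \<Longrightarrow> g n as \<in> carrier (T n)"
  using tensor_powerD(4)[OF T] .

lemma products_tuples: "as \<in> tuples A n \<Longrightarrow> ordered_products A n m \<kappa> f as \<in> tuples A m"
  using ordered_products_carrier[OF A_monoid] by (simp add: tuples_def)

lemma sandwich_linear:
  assumes l: "l \<in> carrier A" and r: "r \<in> carrier A"
  shows "restrict (\<lambda>x. l \<otimes>\<^bsub>A\<^esub> (x \<otimes>\<^bsub>A\<^esub> r)) (carrier A) \<in> linear_maps K A A"
proof (rule linear_mapsI_restrict[OF A_module])
  interpret R: Ring.ring A by (rule A_ring)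
  have sm: "(a \<odot>\<^bsub>A\<^esub> x) \<otimes>\<^bsub>A\<^esub> y = a \<odot>\<^bsub>A\<^esub> (x \<otimes>\<^bsub>A\<^esub> y)" "x \<otimes>\<^bsub>A\<^esub> (a \<odot>\<^bsub>A\<^esub> y) = a \<odot>\<^bsub>A\<^esub> (x \<otimes>\<^bsub>A\<^esub> y)"
    if "a \<in> carrier K" "x \<in> carrier A" "y \<in> carrier A" for a x y
    using A that unfolding unital_assoc_algebra_def by blast+
  show "l \<otimes>\<^bsub>A\<^esub> (x \<otimes>\<^bsub>A\<^esub> r) \<in> carrier A" if "x \<in> carrier A" for x using that l r by simp
  show "l \<otimes>\<^bsub>A\<^esub> ((x \<oplus>\<^bsub>A\<^esub> y) \<otimes>\<^bsub>A\<^esub> r) = l \<otimes>\<^bsub>A\<^esub> (x \<otimes>\<^bsub>A\<^esub> r) \<oplus>\<^bsub>A\<^esub> l \<otimes>\<^bsub>A\<^esub> (y \<otimes>\<^bsub>A\<^esub> r)"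
    if "x \<in> carrier A" "y \<in> carrier A" for x y using that l r by (simp add: R.l_distr R.r_distr)
  show "l \<otimes>\<^bsub>A\<^esub> ((a \<odot>\<^bsub>A\<^esub> x) \<otimes>\<^bsub>A\<^esub> r) = a \<odot>\<^bsub>A\<^esub> (l \<otimes>\<^bsub>A\<^esub> (x \<otimes>\<^bsub>A\<^esub> r))"
    if "a \<in> carrier K" "x \<in> carrier A" for a x using that l r sm by simp
qed

text \<open>By \<open>ordered_products_slot\<close>, varying one entry amounts to a slot of
  \<open>\<phi>\<close> precomposed with a two-sided multiplication, and both are linear.\<close>

lemma products_multilinear:
  assumes e: "coord_embedding n m \<kappa> f" and \<phi>: "multilinear K A m W \<phi>"
  shows "multilinear K A n W (\<lambda>as. \<phi> (ordered_products A n m \<kappa> f as))"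
proof (rule multilinearI)
  show "\<phi> (ordered_products A n m \<kappa> f as) \<in> carrier W" if "as \<in> tuples A n" for as
    using multilinearD(1)[OF \<phi> products_tuples[OF that]] .
  fix us vs assume us: "set us \<subseteq> carrier A" and vs: "set vs \<subseteq> carrier A" and len: "length us + 1 + length vs = n"
  obtain ps l r qs where s: "set ps \<subseteq> carrier A" "set qs \<subseteq> carrier A" "length ps + 1 + length qs = m"
    "l \<in> carrier A" "r \<in> carrier A"
    "\<And>x. x \<in> carrier A \<Longrightarrow> ordered_products A n m \<kappa> f (us @ x # vs) = ps @ (l \<otimes>\<^bsub>A\<^esub> (x \<otimes>\<^bsub>A\<^esub> r)) # qs"
    by (rule ordered_products_slot[OF A_monoid e us vs len]) (rule that)
  have "compose (carrier A) (restrict (\<lambda>x. \<phi> (ps @ x # qs)) (carrier A)) (restrict (\<lambda>x. l \<otimes>\<^bsub>A\<^esub> (x \<otimes>\<^bsub>A\<^esub> r)) (carrier A)) =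
      restrict (\<lambda>x. \<phi> (ordered_products A n m \<kappa> f (us @ x # vs))) (carrier A)"
    unfolding compose_def using s(6) linear_mapsD(1)[OF sandwich_linear[OF s(4,5)]] by (intro restrict_ext) simp
  then show "restrict (\<lambda>x. \<phi> (ordered_products A n m \<kappa> f (us @ x # vs))) (carrier A) \<in> linear_maps K A W"
    using linear_maps_compose[OF A_module sandwich_linear[OF s(4,5)] multilinearD(2)[OF \<phi> s(1,2,3)]] by simp
qed

text \<open>The coordinates of \<open>j\<close> are not unique, so the linear map is chosen together
  with some presentation of \<open>j\<close>; the next lemma removes the dependence on it.\<close>

definition Fmor :: "'p disk list \<Rightarrow> 'p disk list \<Rightarrow> (nat \<times> 'p \<Rightarrow> nat \<times> 'p) \<Rightarrow> 'v \<Rightarrow> 'v" where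
  "Fmor X Y j = (SOME l. l \<in> linear_maps K (T (length X)) (T (length Y)) \<and>
     (\<exists>\<kappa> f. coord_embedding (length X) (length Y) \<kappa> f \<and> j = coord_map X Y \<kappa> f \<and>
       (\<forall>as\<in>tuples A (length X). l (g (length X) as) =
          g (length Y) (ordered_products A (length X) (length Y) \<kappa> f as))))"

lemma Fmor:
  assumes X: "disks X" and Y: "disks Y" and e: "coord_embedding (length X) (length Y) \<kappa> f"
  shows "Fmor X Y (coord_map X Y \<kappa> f) \<in> linear_maps K (T (length X)) (T (length Y))"
    and "as \<in> tuples A (length X) \<Longrightarrow> Fmor X Y (coord_map X Y \<kappa> f) (g (length X) as) =
      g (length Y) (ordered_products A (length X) (length Y) \<kappa> f as)"
proof -
  let ?P = "\<lambda>l. l \<in> linear_maps K (T (length X)) (T (length Y)) \<and>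
     (\<exists>\<kappa>' f'. coord_embedding (length X) (length Y) \<kappa>' f' \<and> coord_map X Y \<kappa> f = coord_map X Y \<kappa>' f' \<and>
       (\<forall>as\<in>tuples A (length X). l (g (length X) as) =
          g (length Y) (ordered_products A (length X) (length Y) \<kappa>' f' as)))"
  obtain l where "l \<in> linear_maps K (T (length X)) (T (length Y))"
    "\<And>as. as \<in> tuples A (length X) \<Longrightarrow> l (g (length X) as) =
      g (length Y) (ordered_products A (length X) (length Y) \<kappa> f as)"
    using tensor_power_universal[OF T T_module products_multilinear[OF e tensor_powerD(2)[OF T]]] by blast
  then have "?P l" using e by blast
  then have P: "?P (Fmor X Y (coord_map X Y \<kappa> f))" unfolding Fmor_def by (rule someI[of ?P])
  then obtain \<kappa>' f' where "coord_embedding (length X) (length Y) \<kappa>' f'" "coord_map X Y \<kappa> f = coord_map X Y \<kappa>' f'"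
    and G: "\<forall>as\<in>tuples A (length X). Fmor X Y (coord_map X Y \<kappa> f) (g (length X) as) =
          g (length Y) (ordered_products A (length X) (length Y) \<kappa>' f' as)" by blast
  \<comment> \<open>The presentation behind the choice may be a different one, but it has the same
    order and hence the same products.\<close>
  then have so: "same_order (length X) \<kappa> f \<kappa>' f'" using same_order_coord_map[OF X Y e] by blast
  show "Fmor X Y (coord_map X Y \<kappa> f) \<in> linear_maps K (T (length X)) (T (length Y))" using P by blast
  show "as \<in> tuples A (length X) \<Longrightarrow> Fmor X Y (coord_map X Y \<kappa> f) (g (length X) as) =
      g (length Y) (ordered_products A (length X) (length Y) \<kappa> f as)"
    using G ordered_products_same_order[OF e so, of A] by simp
qed

text \<open>The tensor product of \<open>T m\<close> and \<open>T n\<close> lies on another type. A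
  copy \<open>S\<close> inside \<open>'v\<close> is a tensor power of exponent \<open>m + n\<close>,
  and uniqueness identifies it with \<open>T (m + n)\<close>, taking pairs of tuples to their
  concatenation.\<close>

lemma mu_exists:
  "\<exists>\<mu>. \<mu> \<in> linear_isos K (tensor K (T m) (T n)) (T (m + n)) \<and>
     (\<forall>as\<in>tuples A m. \<forall>bs\<in>tuples A n. \<mu> (pure_tensor K (T m) (T n) (g m as) (g n bs)) = g (m + n) (as @ bs))"
proof -
  note M = tensor_module[OF T_module[of m] T_module[of n]]
  note B = bilinearD(1)[OF pure_tensor_bilinear[OF T_module[of m] T_module[of n]] T_module T_module]
  obtain S :: "('k, 'v) module" and \<nu> where S: "Module.module K S" and \<nu>: "\<nu> \<in> linear_isos K (tensor K (T m) (T n)) S"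
    using transport_module[OF M tensor_lepoll[OF T_module T_module inf]] by blast
  obtain \<phi> where \<phi>: "\<phi> \<in> linear_isos K S (T (m + n))"
    "\<And>as. as \<in> tuples A (m + n) \<Longrightarrow>
       \<phi> (\<nu> (pure_tensor K (T m) (T n) (g m (take m as)) (g n (drop m as)))) = g (m + n) as"
    using tensor_power_unique[OF tensor_power_tensor[OF A_module T T S \<nu>] T] by blast
  have "compose (carrier (tensor K (T m) (T n))) \<phi> \<nu> (pure_tensor K (T m) (T n) (g m as) (g n bs)) = g (m + n) (as @ bs)"
    if "as \<in> tuples A m" "bs \<in> tuples A n" for as bs
    using \<phi>(2)[OF tuples_append[OF that]] that B[OF g_closed[OF that(1)] g_closed[OF that(2)]]
    by (simp add: compose_eq tuples_def)
  then show ?thesis using linear_isos_compose[OF M \<nu> \<phi>(1)] by blast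
qed

definition Fmu :: "nat \<Rightarrow> nat \<Rightarrow> ('v \<times> 'v \<Rightarrow> 'k) set \<Rightarrow> 'v" where
  "Fmu m n = (SOME \<mu>. \<mu> \<in> linear_isos K (tensor K (T m) (T n)) (T (m + n)) \<and>
     (\<forall>as\<in>tuples A m. \<forall>bs\<in>tuples A n. \<mu> (pure_tensor K (T m) (T n) (g m as) (g n bs)) = g (m + n) (as @ bs)))"

lemma Fmu:
  shows "Fmu m n \<in> linear_isos K (tensor K (T m) (T n)) (T (m + n))"
    and "as \<in> tuples A m \<Longrightarrow> bs \<in> tuples A n \<Longrightarrow>
      Fmu m n (pure_tensor K (T m) (T n) (g m as) (g n bs)) = g (m + n) (as @ bs)"
  using someI_ex[OF mu_exists[of m n]] unfolding Fmu_def by blast+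

text \<open>The same detour through a copy inside \<open>'v\<close>, now for the power
  \<open>0\<close> and the ground space.\<close>

lemma eps_exists: "\<exists>e. e \<in> linear_isos K (ground_space K) (T 0) \<and> e \<one>\<^bsub>K\<^esub> = g 0 []"
proof -
  note G = ground_space_module[OF A.is_cring]
  have "carrier (ground_space K) \<lesssim> (UNIV :: 'v set)" using le by (simp add: ground_space_def)
  then obtain S :: "('k, 'v) module" and \<nu> where S: "Module.module K S" and \<nu>: "\<nu> \<in> linear_isos K (ground_space K) S"
    using transport_module[OF G] by blast
  obtain \<phi> where \<phi>: "\<phi> \<in> linear_isos K S (T 0)" "\<And>as. as \<in> tuples A 0 \<Longrightarrow> \<phi> (\<nu> \<one>\<^bsub>K\<^esub>) = g 0 as"
    using tensor_power_unique[OF tensor_power_zero[OF A.is_cring S \<nu>] T] by blast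
  have "\<one>\<^bsub>K\<^esub> \<in> carrier (ground_space K)" by (simp add: ground_space_def)
  then have "compose (carrier (ground_space K)) \<phi> \<nu> \<one>\<^bsub>K\<^esub> = g 0 []"
    using \<phi>(2)[of "[]"] by (simp add: compose_eq tuples_def)
  then show ?thesis using linear_isos_compose[OF G \<nu> \<phi>(1)] by blast
qed

definition Feps :: "'k \<Rightarrow> 'v" where
  "Feps = (SOME e. e \<in> linear_isos K (ground_space K) (T 0) \<and> e \<one>\<^bsub>K\<^esub> = g 0 [])"

lemma Feps: "Feps \<in> linear_isos K (ground_space K) (T 0)" "Feps \<one>\<^bsub>K\<^esub> = g 0 []"
  using someI_ex[OF eps_exists] unfolding Feps_def by blast+

definition algebra_functor :: "('p, 'k, 'v) sm_functor" where
  "algebra_functor = \<lparr>fobj = (\<lambda>X. T (length X)), fmor = Fmor, fmu = (\<lambda>X Y. Fmu (length X) (length Y)), feps = Feps\<rparr>"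

abbreviation "prd m n x y \<equiv> Fmu m n (pure_tensor K (T m) (T n) x y)"

lemma algebra_functor_simps [simp]:
  "fobj algebra_functor X = T (length X)" "fmor algebra_functor = Fmor"
  "fmu algebra_functor X Y = Fmu (length X) (length Y)" "feps algebra_functor = Feps"
  "fprod K algebra_functor X Y x y = prd (length X) (length Y) x y"
  by (simp_all add: algebra_functor_def fprod_def)

lemma prd_bilinear: "bilinear K (T m) (T n) (T (m + n)) (prd m n)"
  by (rule bilinear_linear[OF _ _ pure_tensor_bilinear linear_isosD(1)[OF Fmu(1)]]) auto

lemma prd_closed: "x \<in> carrier (T m) \<Longrightarrow> y \<in> carrier (T n) \<Longrightarrow> prd m n x y \<in> carrier (T (m + n))"
  using bilinearD(1)[OF prd_bilinear] by blast

lemma Feps_smult: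
  assumes a: "a \<in> carrier K" shows "Feps a = a \<odot>\<^bsub>T 0\<^esub> g 0 []"
proof -
  have "Feps (a \<odot>\<^bsub>ground_space K\<^esub> \<one>\<^bsub>K\<^esub>) = a \<odot>\<^bsub>T 0\<^esub> Feps \<one>\<^bsub>K\<^esub>"
    using a by (intro linear_mapsD(3)[OF linear_isosD(1)[OF Feps(1)]]) (simp_all add: ground_space_def)
  then show ?thesis using a by (simp add: ground_space_def Feps(2))
qed

lemma T_induct [consumes 1, case_names gen add smult]:
  assumes "x \<in> carrier (T n)" "\<And>as. as \<in> tuples A n \<Longrightarrow> P (g n as)"
    and "\<And>x y. x \<in> carrier (T n) \<Longrightarrow> y \<in> carrier (T n) \<Longrightarrow> P x \<Longrightarrow> P y \<Longrightarrow> P (x \<oplus>\<^bsub>T n\<^esub> y)"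
    and "\<And>a x. a \<in> carrier K \<Longrightarrow> x \<in> carrier (T n) \<Longrightarrow> P x \<Longrightarrow> P (a \<odot>\<^bsub>T n\<^esub> x)"
  shows "P x"
  using tensor_powerD(3)[OF T] assms(1) by (induction rule: spans_induct) (use assms(2-) in auto)

lemma T_bilinear_agree:
  assumes b: "bilinear K (T m) (T n) W b" and c: "bilinear K (T m) (T n) W c"
    and eq: "\<And>as bs. as \<in> tuples A m \<Longrightarrow> bs \<in> tuples A n \<Longrightarrow> b (g m as) (g n bs) = c (g m as) (g n bs)"
    and x: "x \<in> carrier (T m)" and y: "y \<in> carrier (T n)"
  shows "b x y = c x y"
  by (rule bilinear_agree[OF T_module T_module tensor_powerD(3)[OF T] _ tensor_powerD(3)[OF T] b c _ _ x y])
    (use eq g_closed in auto)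

section \<open>Functoriality and the coherence conditions\<close>

lemma Fmor_ident:
  assumes X: "disks X"
  shows "Fmor X X (restrict (\<lambda>z. z) (pts X)) = restrict (\<lambda>x. x) (carrier (T (length X)))"
  unfolding ident_coord[OF X]
proof (rule tensor_power_agree[OF T Fmor(1)[OF X X coord_embedding_ident] linear_maps_ident[OF T_module]])
  fix as assume as: "as \<in> tuples A (length X)"
  then show "Fmor X X (coord_map X X (\<lambda>i. i) (\<lambda>i t. t)) (g (length X) as) =
      restrict (\<lambda>x. x) (carrier (T (length X))) (g (length X) as)"
    using Fmor(2)[OF X X coord_embedding_ident as] ordered_products_ident[OF A_monoid, of as "length X"] g_closed[OF as]
    by (simp add: tuples_def)
qed

lemma Fmor_compose:
  assumes X: "disks X" and Y: "disks Y" and Z: "disks Z"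
    and e: "coord_embedding (length X) (length Y) \<kappa> f" and e': "coord_embedding (length Y) (length Z) \<kappa>' f'"
  shows "Fmor X Z (compose (pts X) (coord_map Y Z \<kappa>' f') (coord_map X Y \<kappa> f)) =
    compose (carrier (T (length X))) (Fmor Y Z (coord_map Y Z \<kappa>' f')) (Fmor X Y (coord_map X Y \<kappa> f))"
  unfolding coord_map_compose[OF X Y e]
proof (rule tensor_power_agree[OF T Fmor(1)[OF X Z coord_embedding_compose[OF e e']]
      linear_maps_compose[OF T_module Fmor(1)[OF X Y e] Fmor(1)[OF Y Z e']]])
  fix as assume as: "as \<in> tuples A (length X)"
  then show "Fmor X Z (coord_map X Z (\<lambda>i. \<kappa>' (\<kappa> i)) (\<lambda>i t. f' (\<kappa> i) (f i t))) (g (length X) as) =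
     compose (carrier (T (length X))) (Fmor Y Z (coord_map Y Z \<kappa>' f')) (Fmor X Y (coord_map X Y \<kappa> f)) (g (length X) as)"
    using Fmor(2)[OF X Z coord_embedding_compose[OF e e'] as] Fmor(2)[OF X Y e as] Fmor(2)[OF Y Z e' products_tuples[OF as]]
      ordered_products_compose[OF A_monoid e e', of as] g_closed[OF as]
    by (simp add: compose_eq tuples_def)
qed

lemma algebra_functor_is_functor: "is_functor disk_cat (vect_cat K) (fobj algebra_functor) (fmor algebra_functor)"
  unfolding is_functor_def
proof (intro conjI ballI)
  fix X :: "'p disk list" assume X: "disks X"
  show "fobj algebra_functor X \<in> Obj (vect_cat K)" by (simp add: vect_cat_def)
  show "fmor algebra_functor X X (Ident disk_cat X) = Ident (vect_cat K) (fobj algebra_functor X)"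
    using Fmor_ident[OF X] by (simp add: vect_cat_def disk_cat_def)
next
  fix X Y :: "'p disk list" and j assume X: "disks X" and Y: "disks Y" and "j \<in> Arr disk_cat X Y"
  then have "j \<in> oriented_embeddings X Y" by (simp add: Arr_disk_cat)
  then obtain \<kappa> f where "coord_embedding (length X) (length Y) \<kappa> f" "j = coord_map X Y \<kappa> f"
    using embeddings_coord_map[OF X Y] by blast
  then show "fmor algebra_functor X Y j \<in> Arr (vect_cat K) (fobj algebra_functor X) (fobj algebra_functor Y)"
    using Fmor(1)[OF X Y] by (simp add: vect_cat_def)
next
  fix X Y Z :: "'p disk list" and j j'
  assume X: "disks X" and Y: "disks Y" and Z: "disks Z" and "j \<in> Arr disk_cat X Y" "j' \<in> Arr disk_cat Y Z"
  then have "j \<in> oriented_embeddings X Y" "j' \<in> oriented_embeddings Y Z" by (simp_all add: Arr_disk_cat)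
  then obtain \<kappa> f \<kappa>' f' where "coord_embedding (length X) (length Y) \<kappa> f" "j = coord_map X Y \<kappa> f"
    "coord_embedding (length Y) (length Z) \<kappa>' f'" "j' = coord_map Y Z \<kappa>' f'"
    using embeddings_coord_map[OF X Y] embeddings_coord_map[OF Y Z] by metis
  then show "fmor algebra_functor X Z (Comp disk_cat X j' j) =
      Comp (vect_cat K) (fobj algebra_functor X) (fmor algebra_functor Y Z j') (fmor algebra_functor X Y j)"
    using Fmor_compose[OF X Y Z] by (simp add: vect_cat_def disk_cat_def)
qed

lemma Fmor_union:
  assumes X: "disks X" "disks X'" and Y: "disks Y" "disks Y'"
    and e: "coord_embedding (length X) (length X') \<kappa> f" and e': "coord_embedding (length Y) (length Y') \<kappa>' f'"
    and x: "x \<in> carrier (T (length X))" and y: "y \<in> carrier (T (length Y))"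
  shows "Fmor (X @ Y) (X' @ Y') (disj_union_map X Y X' (coord_map X X' \<kappa> f) (coord_map Y Y' \<kappa>' f')) (prd (length X) (length Y) x y) =
    prd (length X') (length Y') (Fmor X X' (coord_map X X' \<kappa> f) x) (Fmor Y Y' (coord_map Y Y' \<kappa>' f') y)"
  unfolding coord_map_union[OF X(1) Y(1) e]
proof -
  let ?u = "union_index (length X) (length X') \<kappa> \<kappa>'" and ?h = "union_fun (length X) f f'"
  have XY: "disks (X @ Y)" "disks (X' @ Y')" using X Y by simp_all
  have eu: "coord_embedding (length (X @ Y)) (length (X' @ Y')) ?u ?h" using coord_embedding_union[OF e e'] by simp
  note M = Fmor(1)[OF XY eu, unfolded length_append]
  show "Fmor (X @ Y) (X' @ Y') (coord_map (X @ Y) (X' @ Y') ?u ?h) (prd (length X) (length Y) x y) =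
    prd (length X') (length Y') (Fmor X X' (coord_map X X' \<kappa> f) x) (Fmor Y Y' (coord_map Y Y' \<kappa>' f') y)"
  proof (rule T_bilinear_agree[OF bilinear_linear[OF T_module T_module prd_bilinear M]
        bilinear_compose[OF prd_bilinear T_module T_module T_module T_module Fmor(1)[OF X e] Fmor(1)[OF Y e']] _ x y])
    fix as bs assume as: "as \<in> tuples A (length X)" and bs: "bs \<in> tuples A (length Y)"
    have "Fmor (X @ Y) (X' @ Y') (coord_map (X @ Y) (X' @ Y') ?u ?h) (g (length X + length Y) (as @ bs)) =
        g (length X' + length Y') (ordered_products A (length X + length Y) (length X' + length Y') ?u ?h (as @ bs))"
      using Fmor(2)[OF XY eu, of "as @ bs"] tuples_append[OF as bs] by simp
    then show "Fmor (X @ Y) (X' @ Y') (coord_map (X @ Y) (X' @ Y') ?u ?h) (prd (length X) (length Y) (g (length X) as) (g (length Y) bs)) =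
       prd (length X') (length Y') (Fmor X X' (coord_map X X' \<kappa> f) (g (length X) as)) (Fmor Y Y' (coord_map Y Y' \<kappa>' f') (g (length Y) bs))"
      using Fmu(2)[OF as bs] Fmor(2)[OF X e as] Fmor(2)[OF Y e' bs] ordered_products_union[OF e e', of as A bs]
        Fmu(2)[OF products_tuples[OF as] products_tuples[OF bs]] as by (simp add: tuples_def)
  qed
qed

text \<open>On generators this is associativity of concatenation. It extends in three variables: by
  induction in \<open>z\<close>, and for a generator \<open>z\<close> by bilinearity in
  \<open>x\<close> and \<open>y\<close>.\<close>

lemma prd_assoc:
  assumes x: "x \<in> carrier (T l)" and y: "y \<in> carrier (T m)" and z: "z \<in> carrier (T n)"
  shows "prd (l + m) n (prd l m x y) z = prd l (m + n) x (prd m n y z)"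
  using z
proof (induction rule: T_induct)
  case (gen cs)
  note c = g_closed[OF gen]
  have l: "restrict (\<lambda>u. prd (l + m) n u (g n cs)) (carrier (T (l + m))) \<in> linear_maps K (T (l + m)) (T (l + m + n))"
    and r: "restrict (\<lambda>u. prd m n u (g n cs)) (carrier (T m)) \<in> linear_maps K (T m) (T (m + n))"
    using prd_bilinear c unfolding bilinear_def by blast+
  have b1: "bilinear K (T l) (T m) (T (l + m + n)) (\<lambda>x y. restrict (\<lambda>u. prd (l + m) n u (g n cs)) (carrier (T (l + m))) (prd l m x y))"
    by (rule bilinear_linear[OF T_module T_module prd_bilinear l])
  \<comment> \<open>The first argument passes through the identity map so that
    \<open>bilinear_compose\<close> applies.\<close>
  have b2: "bilinear K (T l) (T m) (T (l + m + n)) (\<lambda>x y. prd l (m + n) (restrict (\<lambda>x. x) (carrier (T l)) x) (restrict (\<lambda>u. prd m n u (g n cs)) (carrier (T m)) y))"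
    using bilinear_compose[OF prd_bilinear T_module T_module T_module T_module linear_maps_ident[OF T_module] r, of l]
    by (simp add: add.assoc)
  have "restrict (\<lambda>u. prd (l + m) n u (g n cs)) (carrier (T (l + m))) (prd l m x y) =
      prd l (m + n) (restrict (\<lambda>x. x) (carrier (T l)) x) (restrict (\<lambda>u. prd m n u (g n cs)) (carrier (T m)) y)"
  proof (rule T_bilinear_agree[OF b1 b2 _ x y])
    fix as bs assume as: "as \<in> tuples A l" and bs: "bs \<in> tuples A m"
    show "restrict (\<lambda>u. prd (l + m) n u (g n cs)) (carrier (T (l + m))) (prd l m (g l as) (g m bs)) =
      prd l (m + n) (restrict (\<lambda>x. x) (carrier (T l)) (g l as)) (restrict (\<lambda>u. prd m n u (g n cs)) (carrier (T m)) (g m bs))"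
      using Fmu(2)[OF as bs] Fmu(2)[OF bs gen] Fmu(2)[OF tuples_append[OF as bs] gen] Fmu(2)[OF as tuples_append[OF bs gen]]
        g_closed[OF as] g_closed[OF bs] g_closed[OF tuples_append[OF as bs]] by (simp add: add.assoc)
  qed
  then show ?case using x y prd_closed[OF x y] by simp
next
  case (add z z')
  note B = bilinearD[OF prd_bilinear T_module T_module]
  show ?case
    using add.IH B(3)[OF prd_closed[OF x y] add.hyps(1,2)] B(3)[OF y add.hyps(1,2)]
      B(3)[OF x prd_closed[OF y add.hyps(1)] prd_closed[OF y add.hyps(2)]] by (simp add: add.assoc)
next
  case (smult a z)
  note B = bilinearD[OF prd_bilinear T_module T_module]
  show ?case
    using smult.IH B(5)[OF prd_closed[OF x y] smult.hyps(2,1)] B(5)[OF y smult.hyps(2,1)]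
      B(5)[OF x prd_closed[OF y smult.hyps(2)] smult.hyps(1)] by (simp add: add.assoc)
qed

text \<open>Joining the empty tuple changes no generator; scalars are pulled out of
  \<open>Feps\<close> by \<open>Feps_smult\<close>.\<close>

lemma prd_unit:
  assumes a: "a \<in> carrier K" and x: "x \<in> carrier (T n)"
  shows "prd 0 n (Feps a) x = a \<odot>\<^bsub>T n\<^esub> x" "prd n 0 x (Feps a) = a \<odot>\<^bsub>T n\<^esub> x"
proof -
  have nil: "[] \<in> tuples A 0" by (simp add: tuples_def)
  note e = g_closed[OF nil]
  have l: "restrict (prd 0 n (g 0 [])) (carrier (T n)) = restrict (\<lambda>x. x) (carrier (T n))"
  proof (rule tensor_power_agree[OF T _ linear_maps_ident[OF T_module]])
    show "restrict (prd 0 n (g 0 [])) (carrier (T n)) \<in> linear_maps K (T n) (T n)"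
      using prd_bilinear[of 0 n] e unfolding bilinear_def by simp
  qed (use Fmu(2)[OF nil, of _ n] in simp)
  have r: "restrict (\<lambda>x. prd n 0 x (g 0 [])) (carrier (T n)) = restrict (\<lambda>x. x) (carrier (T n))"
  proof (rule tensor_power_agree[OF T _ linear_maps_ident[OF T_module]])
    show "restrict (\<lambda>x. prd n 0 x (g 0 [])) (carrier (T n)) \<in> linear_maps K (T n) (T n)"
      using prd_bilinear[of n 0] e unfolding bilinear_def by simp
  qed (use Fmu(2)[OF _ nil, of _ n] in simp)
  have "prd 0 n (g 0 []) x = x" "prd n 0 x (g 0 []) = x"
    using fun_cong[OF l, of x] fun_cong[OF r, of x] x by simp_all
  then show "prd 0 n (Feps a) x = a \<odot>\<^bsub>T n\<^esub> x" "prd n 0 x (Feps a) = a \<odot>\<^bsub>T n\<^esub> x"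
    unfolding Feps_smult[OF a]
    using bilinearD(4)[OF prd_bilinear T_module T_module e x a] bilinearD(5)[OF prd_bilinear T_module T_module x e a]
    by simp_all
qed

lemma Fmor_swap:
  assumes X: "disks X" and Y: "disks Y" and x: "x \<in> carrier (T (length X))" and y: "y \<in> carrier (T (length Y))"
  shows "Fmor (X @ Y) (Y @ X) (swap_map X Y) (prd (length X) (length Y) x y) = prd (length Y) (length X) y x"
  unfolding swap_map_coord[OF X Y]
proof -
  let ?s = "swap_index (length X) (length Y)" and ?i = "\<lambda>(i::nat) t::real. t"
  have XY: "disks (X @ Y)" "disks (Y @ X)" using X Y by simp_all
  have es: "coord_embedding (length (X @ Y)) (length (Y @ X)) ?s ?i" using coord_embedding_swap by simp
  note M = Fmor(1)[OF XY es, unfolded length_append]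
  have b2: "bilinear K (T (length X)) (T (length Y)) (T (length Y + length X)) (\<lambda>x y. prd (length Y) (length X) y x)"
    by (rule bilinear_flip[OF prd_bilinear])
  show "Fmor (X @ Y) (Y @ X) (coord_map (X @ Y) (Y @ X) ?s ?i) (prd (length X) (length Y) x y) = prd (length Y) (length X) y x"
  proof (rule T_bilinear_agree[OF bilinear_linear[OF T_module T_module prd_bilinear M] b2 _ x y])
    fix as bs assume as: "as \<in> tuples A (length X)" and bs: "bs \<in> tuples A (length Y)"
    have "Fmor (X @ Y) (Y @ X) (coord_map (X @ Y) (Y @ X) ?s ?i) (g (length X + length Y) (as @ bs)) =
        g (length Y + length X) (ordered_products A (length X + length Y) (length Y + length X) ?s ?i (as @ bs))"
      using Fmor(2)[OF XY es, of "as @ bs"] tuples_append[OF as bs] by simp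
    also have "ordered_products A (length X + length Y) (length Y + length X) ?s ?i (as @ bs) = bs @ as"
      using as bs by (intro ordered_products_swap[OF A_monoid]) (simp_all add: tuples_def)
    finally show "Fmor (X @ Y) (Y @ X) (coord_map (X @ Y) (Y @ X) ?s ?i) (prd (length X) (length Y) (g (length X) as) (g (length Y) bs)) =
        prd (length Y) (length X) (g (length Y) bs) (g (length X) as)"
      using Fmu(2)[OF as bs] Fmu(2)[OF bs as] by simp
  qed
qed

lemma algebra_functor_sm: "is_sm_functor K algebra_functor"
  unfolding is_sm_functor_def
proof (intro conjI ballI algebra_functor_is_functor)
  show "feps algebra_functor \<in> linear_isos K (ground_space K) (fobj algebra_functor [])" using Feps(1) by simp
next
  fix X Y :: "'p disk list"
  show "fmu algebra_functor X Y \<in> linear_isos K (tensor K (fobj algebra_functor X) (fobj algebra_functor Y)) (fobj algebra_functor (X @ Y))"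
    using Fmu(1) by simp
next
  fix X Y X' Y' :: "'p disk list" and j j' and x y :: 'v
  assume X: "disks X" and Y: "disks Y" and X': "disks X'" and Y': "disks Y'"
    and j: "j \<in> Arr disk_cat X X'" and j': "j' \<in> Arr disk_cat Y Y'"
    and x: "x \<in> carrier (fobj algebra_functor X)" and y: "y \<in> carrier (fobj algebra_functor Y)"
  obtain \<kappa> f where e: "coord_embedding (length X) (length X') \<kappa> f" "j = coord_map X X' \<kappa> f"
    using embeddings_coord_map[OF X X'] j unfolding Arr_disk_cat by blast
  obtain \<kappa>' f' where e': "coord_embedding (length Y) (length Y') \<kappa>' f'" "j' = coord_map Y Y' \<kappa>' f'"
    using embeddings_coord_map[OF Y Y'] j' unfolding Arr_disk_cat by blast
  show "fmor algebra_functor (X @ Y) (X' @ Y') (disj_union_map X Y X' j j') (fprod K algebra_functor X Y x y) =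
      fprod K algebra_functor X' Y' (fmor algebra_functor X X' j x) (fmor algebra_functor Y Y' j' y)"
    using Fmor_union[OF X X' Y Y' e(1) e'(1)] x y by (simp add: e(2) e'(2))
qed (use prd_assoc prd_unit Fmor_swap in simp_all)

text \<open>Isotopic embeddings have the same order by \<open>isotopicD\<close>, and the products
  depend on the order only.\<close>

lemma algebra_functor_isotopy_invariant: "isotopy_invariant algebra_functor"
  unfolding isotopy_invariant_def
proof (intro ballI impI)
  fix X Y :: "'p disk list" and j j' assume X: "disks X" and Y: "disks Y"
    and j: "j \<in> Arr disk_cat X Y" and j': "j' \<in> Arr disk_cat X Y" and iso: "isotopic X Y j j'"
  obtain \<kappa> f where e: "coord_embedding (length X) (length Y) \<kappa> f" "j = coord_map X Y \<kappa> f"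
    using embeddings_coord_map[OF X Y] j unfolding Arr_disk_cat by blast
  obtain \<kappa>' f' where e': "coord_embedding (length X) (length Y) \<kappa>' f'" "j' = coord_map X Y \<kappa>' f'"
    using embeddings_coord_map[OF X Y] j' unfolding Arr_disk_cat by blast
  have so: "same_order (length X) \<kappa> f \<kappa>' f'"
    using isotopicD[OF X Y _ e(1) e'(1)] iso by (simp add: e(2) e'(2))
  have "Fmor X Y j = Fmor X Y j'"
    unfolding e(2) e'(2)
    by (rule tensor_power_agree[OF T Fmor(1)[OF X Y e(1)] Fmor(1)[OF X Y e'(1)]])
      (simp add: Fmor(2)[OF X Y e(1)] Fmor(2)[OF X Y e'(1)] ordered_products_same_order[OF e(1) so])
  then show "fmor algebra_functor X Y j = fmor algebra_functor X Y j'" by simp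
qed

text \<open>\<open>T 1\<close> and \<open>A\<close> are both first tensor powers of
  \<open>A\<close>, which gives a linear isomorphism. It is multiplicative because the fold
  embedding has the single fibre \<open>[0, 1]\<close> and so sends the tuple \<open>[a, b]\<close>
  to the product of \<open>a\<close> and \<open>b\<close>.\<close>

lemma functor_algebra_iso:
  assumes D: "oriented_disk D"
  shows "\<exists>u. is_iso (algebra_cat K) (functor_algebra K D algebra_functor) A u"
proof -
  let ?B = "functor_algebra K D algebra_functor"
  have id: "restrict (\<lambda>x. x) (carrier A) \<in> linear_isos K A A"
    using linear_maps_ident[OF A_module] by (simp add: linear_isos_def bij_betw_def inj_on_def)
  have "tensor_power K A 1 A (\<lambda>as. restrict (\<lambda>x. x) (carrier A) (hd as))"
    by (rule tensor_power_one[OF A_module A_module id])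
  then obtain f where f: "f \<in> linear_isos K (T 1) A"
    "\<And>as. as \<in> tuples A 1 \<Longrightarrow> f (g 1 as) = restrict (\<lambda>x. x) (carrier A) (hd as)"
    using tensor_power_unique[OF T] by blast
  have f_g: "f (g 1 [a]) = a" and ga: "g 1 [a] \<in> carrier (T 1)" if "a \<in> carrier A" for a
    using f(2)[of "[a]"] g_closed[of "[a]" 1] that by (simp_all add: tuples_def)
  obtain h where h: "h \<in> linear_isos K A (T 1)" "\<forall>x\<in>carrier (T 1). h (f x) = x" "\<forall>y\<in>carrier A. f (h y) = y"
    by (rule linear_isos_inverse[OF T_module A_module f(1)]) (rule that)
  note fl = linear_mapsD[OF linear_isosD(1)[OF f(1)]] and hl = linear_mapsD[OF linear_isosD(1)[OF h(1)]]
  have h_g: "h a = g 1 [a]" if "a \<in> carrier A" for a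
    using h(2) ga[OF that] f_g[OF that] by metis
  have B: "carrier ?B = carrier (T 1)" "\<And>x y. x \<oplus>\<^bsub>?B\<^esub> y = x \<oplus>\<^bsub>T 1\<^esub> y"
    by (simp_all add: functor_algebra_def)
  have DD: "disks [D]" "disks [D, D]" "disks []" using D by simp_all
  have fe: "coord_embedding (length [D, D]) (length [D]) (\<lambda>i. 0) fold_fun"
    using coord_embedding_fold by (simp add: numeral_2_eq_2)
  have mult: "g 1 [a] \<otimes>\<^bsub>?B\<^esub> g 1 [b] = g 1 [a \<otimes>\<^bsub>A\<^esub> b]" if "a \<in> carrier A" "b \<in> carrier A" for a b
  proof -
    have ab: "[a] \<in> tuples A 1" "[b] \<in> tuples A 1" "[a, b] \<in> tuples A (length [D, D])" using that by (simp_all add: tuples_def)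
    have "g 1 [a] \<otimes>\<^bsub>?B\<^esub> g 1 [b] = Fmor [D, D] [D] (coord_map [D, D] [D] (\<lambda>i. 0) fold_fun) (g (length [D, D]) [a, b])"
      using Fmu(2)[OF ab(1,2)] by (simp add: functor_algebra_def fold_embedding_coord[OF D] numeral_2_eq_2)
    also have "\<dots> = g 1 [a \<otimes>\<^bsub>A\<^esub> b]"
      using Fmor(2)[OF DD(2,1) fe ab(3)] ordered_products_fold[OF A_monoid that] by (simp add: numeral_2_eq_2)
    finally show ?thesis .
  qed
  have one: "\<one>\<^bsub>?B\<^esub> = g 1 [\<one>\<^bsub>A\<^esub>]"
  proof -
    have "\<one>\<^bsub>?B\<^esub> = Fmor [] [D] (coord_map [] [D] (\<lambda>i. i) (\<lambda>i t. t)) (g 0 [])"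
      by (simp add: functor_algebra_def Feps(2) flip: empty_coord)
    also have "\<dots> = g 1 [\<one>\<^bsub>A\<^esub>]"
      using Fmor(2)[OF DD(3,1), of "\<lambda>i. i" "\<lambda>i t. t" "[]"] ordered_products_empty[of A 1]
      by (simp add: tuples_def coord_embedding_empty)
    finally show ?thesis .
  qed
  have car_g: "\<exists>a\<in>carrier A. x = g 1 [a]" if "x \<in> carrier (T 1)" for x
    using h(2) h_g fl(1)[OF that] that by metis
  have f_arr: "f \<in> linear_maps K ?B A" "h \<in> linear_maps K A ?B"
    unfolding linear_maps_functor_algebra using linear_isosD(1)[OF f(1)] linear_isosD(1)[OF h(1)] by simp_all
  have f_hom: "f \<in> ring_hom ?B A"
  proof (rule ring_hom_memI)
    fix x y assume x: "x \<in> carrier ?B" and y: "y \<in> carrier ?B"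
    show "f x \<in> carrier A" "f (x \<oplus>\<^bsub>?B\<^esub> y) = f x \<oplus>\<^bsub>A\<^esub> f y" using x y fl(1,2) by (simp_all add: B)
    obtain a b where "a \<in> carrier A" "x = g 1 [a]" "b \<in> carrier A" "y = g 1 [b]" using car_g x y B(1) by blast
    then show "f (x \<otimes>\<^bsub>?B\<^esub> y) = f x \<otimes>\<^bsub>A\<^esub> f y"
      using mult f_g monoid.m_closed[OF A_monoid] by simp
  qed (use one f_g monoid.one_closed[OF A_monoid] in simp)
  have h_hom: "h \<in> ring_hom A ?B"
  proof (rule ring_hom_memI)
    fix x y assume x: "x \<in> carrier A" and y: "y \<in> carrier A"
    show "h x \<in> carrier ?B" "h (x \<oplus>\<^bsub>A\<^esub> y) = h x \<oplus>\<^bsub>?B\<^esub> h y" using x y hl(1,2) by (simp_all add: B)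
    show "h (x \<otimes>\<^bsub>A\<^esub> y) = h x \<otimes>\<^bsub>?B\<^esub> h y"
      using mult[OF x y] h_g[OF x] h_g[OF y] h_g[OF monoid.m_closed[OF A_monoid x y]] by simp
  qed (use one h_g monoid.one_closed[OF A_monoid] in simp)
  have "is_iso (algebra_cat K) ?B A f"
  proof (rule is_isoI)
    show "f \<in> Arr (algebra_cat K) ?B A" "h \<in> Arr (algebra_cat K) A ?B"
      using f_arr f_hom h_hom by (simp_all add: algebra_cat_def)
    show "Comp (algebra_cat K) ?B h f = Ident (algebra_cat K) ?B" "Comp (algebra_cat K) A f h = Ident (algebra_cat K) A"
      using h(2,3) by (auto simp: algebra_cat_def compose_def B(1) intro!: restrict_ext)
  qed
  then show ?thesis by blast
qed

end

section \<open>The equivalence\<close>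

lemma functor_cat_is_category:
  assumes K: "cring K" and D: "oriented_disk (D :: 'p disk)"
  shows "is_category (isotopy_invariant_functor_cat K :: (('p, 'k, 'v) sm_functor, 'p disk list \<Rightarrow> 'v \<Rightarrow> 'v) cat)"
proof -
  let ?C = "isotopy_invariant_functor_cat K :: (('p, 'k, 'v) sm_functor, 'p disk list \<Rightarrow> 'v \<Rightarrow> 'v) cat"
  have loc: "isotopy_functor K D F" if "F \<in> Obj ?C" for F
    using that K D by (simp add: isotopy_invariant_functor_cat_def isotopy_functor_def)
  note M = isotopy_functor.fobj_module[OF loc] and L = linear_mapsD(1)[OF isotopy_functor.fmor_linear[OF loc]]
    and P = isotopy_functor.fprod_closed[OF loc] and E = isotopy_functor.feps_closed[OF loc]
  have Arr: "Arr ?C = monoidal_transformations K"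
    and Id: "Ident ?C F = (\<lambda>X\<in>Obj disk_cat. restrict (\<lambda>x. x) (carrier (fobj F X)))"
    and Co: "Comp ?C F \<beta> \<alpha> = (\<lambda>X\<in>Obj disk_cat. compose (carrier (fobj F X)) (\<beta> X) (\<alpha> X))" for F \<alpha> \<beta>
    by (simp_all add: isotopy_invariant_functor_cat_def)
  note T = monoidal_transformationsD
  \<comment> \<open>Arrows are extensional both as families and in each component, so agreement on
    the carriers suffices.\<close>
  have ext: "\<alpha> = \<beta>" if "\<alpha> \<in> extensional (Obj disk_cat)" "\<beta> \<in> extensional (Obj disk_cat)"
    "\<And>X. disks X \<Longrightarrow> \<alpha> X \<in> extensional (carrier (fobj F X))" "\<And>X. disks X \<Longrightarrow> \<beta> X \<in> extensional (carrier (fobj F X))"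
    "\<And>X x. disks X \<Longrightarrow> x \<in> carrier (fobj F X) \<Longrightarrow> \<alpha> X x = \<beta> X x"
    for \<alpha> \<beta> :: "'p disk list \<Rightarrow> 'v \<Rightarrow> 'v" and F :: "('p, 'k, 'v) sm_functor"
    using that by (intro extensionalityI[OF that(1,2)] extensionalityI[of _ "carrier (fobj F _)"]) blast+
  have Tc: "\<alpha> X x \<in> carrier (fobj G X)" if "\<alpha> \<in> monoidal_transformations K F G" "disks X" "x \<in> carrier (fobj F X)" for F G \<alpha> X x
    using linear_mapsD(1)[OF T(2)[OF that(1,2)] that(3)] .
  show ?thesis
    unfolding is_category_def
  proof (intro conjI ballI)
    fix F assume F: "F \<in> Obj ?C"
    show "Ident ?C F \<in> Arr ?C F F"
      unfolding Arr Id
      by (rule monoidal_transformationsI) (simp_all add: linear_maps_ident M[OF F] L[OF F] P[OF F] E[OF F])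
  next
    fix F G H \<alpha> \<beta>
    assume F: "F \<in> Obj ?C" and G: "G \<in> Obj ?C" and H: "H \<in> Obj ?C" and "\<alpha> \<in> Arr ?C F G" "\<beta> \<in> Arr ?C G H"
    then have \<alpha>: "\<alpha> \<in> monoidal_transformations K F G" and \<beta>: "\<beta> \<in> monoidal_transformations K G H" by (simp_all add: Arr)
    show "Comp ?C F \<beta> \<alpha> \<in> Arr ?C F H"
      unfolding Arr Co
    proof (rule monoidal_transformationsI)
      show "(\<lambda>X\<in>Obj disk_cat. compose (carrier (fobj F X)) (\<beta> X) (\<alpha> X)) X \<in> linear_maps K (fobj F X) (fobj H X)" if "disks X" for X
        using linear_maps_compose[OF M[OF F that] T(2)[OF \<alpha> that] T(2)[OF \<beta> that]] that by simp
    qed (simp_all add: compose_eq L[OF F] P[OF F] E[OF F] T(3-5)[OF \<alpha>] T(3-5)[OF \<beta>] Tc[OF \<alpha>])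
  next
    fix F G \<alpha> assume F: "F \<in> Obj ?C" and G: "G \<in> Obj ?C" and "\<alpha> \<in> Arr ?C F G"
    then have \<alpha>: "\<alpha> \<in> monoidal_transformations K F G" by (simp add: Arr)
    note e = T(1)[OF \<alpha>] linear_mapsD(4)[OF T(2)[OF \<alpha>]]
    show "Comp ?C F \<alpha> (Ident ?C F) = \<alpha>"
      unfolding Id Co by (rule ext[of _ _ F]) (simp_all add: e compose_eq)
    show "Comp ?C F (Ident ?C G) \<alpha> = \<alpha>"
      unfolding Id Co by (rule ext[of _ _ F]) (simp_all add: e compose_eq Tc[OF \<alpha>])
  next
    fix F G H J \<alpha> \<beta> \<gamma>
    assume "F \<in> Obj ?C" "G \<in> Obj ?C" "H \<in> Obj ?C" "J \<in> Obj ?C" and "\<alpha> \<in> Arr ?C F G" "\<beta> \<in> Arr ?C G H" "\<gamma> \<in> Arr ?C H J"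
    then have \<alpha>: "\<alpha> \<in> monoidal_transformations K F G" by (simp add: Arr)
    show "Comp ?C F \<gamma> (Comp ?C F \<beta> \<alpha>) = Comp ?C F (Comp ?C G \<gamma> \<beta>) \<alpha>"
      unfolding Co by (rule ext[of _ _ F]) (simp_all add: compose_eq Tc[OF \<alpha>])
  qed
qed

lemma algebra_cat_is_category: "is_category (algebra_cat K :: (('k, 'v) module, 'v \<Rightarrow> 'v) cat)"
proof -
  let ?C = "algebra_cat K :: (('k, 'v) module, 'v \<Rightarrow> 'v) cat"
  have Arr: "Arr ?C A B = {f \<in> linear_maps K A B. f \<in> ring_hom A B}"
    and Id: "Ident ?C A = restrict (\<lambda>x. x) (carrier A)" and Co: "Comp ?C A h f = compose (carrier A) h f" for A B f h
    by (simp_all add: algebra_cat_def)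
  have M: "Module.module K A" and R: "Ring.ring A" if "A \<in> Obj ?C" for A
    using that by (simp_all add: algebra_cat_def unital_assoc_algebra_def)
  have ops: "x \<otimes>\<^bsub>A\<^esub> y \<in> carrier A" "x \<oplus>\<^bsub>A\<^esub> y \<in> carrier A" "\<one>\<^bsub>A\<^esub> \<in> carrier A"
    if "A \<in> Obj ?C" "x \<in> carrier A" "y \<in> carrier A" for A x y
    using R[OF that(1)] that(2,3) by (simp_all add: ring.ring_simprules)
  have one: "\<one>\<^bsub>A\<^esub> \<in> carrier A" if "A \<in> Obj ?C" for A
    using R[OF that] by (simp add: ring.ring_simprules)
  show ?thesis
    unfolding is_category_def
  proof (intro conjI ballI)
    fix A assume A: "A \<in> Obj ?C"
    have "restrict (\<lambda>x. x) (carrier A) \<in> ring_hom A A"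
      by (rule ring_hom_memI) (simp_all add: ops[OF A] one[OF A])
    then show "Ident ?C A \<in> Arr ?C A A" using linear_maps_ident[OF M[OF A]] by (simp add: Arr Id)
  next
    fix A B C f h assume A: "A \<in> Obj ?C" and f: "f \<in> Arr ?C A B" and h: "h \<in> Arr ?C B C"
    have f': "f \<in> linear_maps K A B" "f \<in> ring_hom A B" and h': "h \<in> linear_maps K B C" "h \<in> ring_hom B C"
      using f h by (simp_all add: Arr)
    have "compose (carrier A) h f \<in> ring_hom A C"
      by (rule ring_hom_memI)
        (simp_all add: compose_eq ops[OF A] one[OF A] ring_hom_closed[OF f'(2)] ring_hom_closed[OF h'(2)]
          ring_hom_mult[OF f'(2)] ring_hom_mult[OF h'(2)] ring_hom_add[OF f'(2)] ring_hom_add[OF h'(2)]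
          ring_hom_one[OF f'(2)] ring_hom_one[OF h'(2)])
    then show "Comp ?C A h f \<in> Arr ?C A C"
      using linear_maps_compose[OF M[OF A] f'(1) h'(1)] by (simp add: Arr Co)
  next
    fix A B f assume "f \<in> Arr ?C A B"
    then have f: "f \<in> linear_maps K A B" by (simp add: Arr)
    note L = linear_mapsD(1,4)[OF f]
    show "Comp ?C A f (Ident ?C A) = f"
      unfolding Co Id by (rule extensionalityI[OF _ L(2)]) (simp_all add: compose_eq)
    show "Comp ?C A (Ident ?C B) f = f"
      unfolding Co Id by (rule extensionalityI[OF _ L(2)]) (simp_all add: compose_eq L(1))
  next
    fix A B C E f h k assume "f \<in> Arr ?C A B"
    then have f: "f \<in> linear_maps K A B" by (simp add: Arr)
    show "Comp ?C A k (Comp ?C A h f) = Comp ?C A (Comp ?C B k h) f"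
      unfolding Co by (rule extensionalityI[of _ "carrier A"]) (simp_all add: compose_eq linear_mapsD(1)[OF f])
  qed
qed

text \<open>The cardinality conditions give \<open>'v\<close> room for the tensor powers of every
  algebra over it; essential surjectivity rests on them.\<close>

theorem theorem1p6:
  fixes K :: "('k, 'm) ring_scheme" and D :: "'p disk"
  assumes "field K"
    and "infinite (UNIV :: 'v set)" and "carrier K \<lesssim> (UNIV :: 'v set)"
    and "oriented_disk D"
  shows "is_equivalence
           (isotopy_invariant_functor_cat K :: (('p, 'k, 'v) sm_functor, 'p disk list \<Rightarrow> 'v \<Rightarrow> 'v) cat)
           (algebra_cat K)
           (functor_algebra K D)
           (\<lambda>F G \<alpha>. \<alpha> [D])"
proof -
  let ?C = "isotopy_invariant_functor_cat K :: (('p, 'k, 'v) sm_functor, 'p disk list \<Rightarrow> 'v \<Rightarrow> 'v) cat"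
  let ?D = "algebra_cat K :: (('k, 'v) module, 'v \<Rightarrow> 'v) cat"
  have K: "cring K" using assms(1) by (simp add: field.axioms(1) domain.axioms(1))
  have C: "is_category ?C" using functor_cat_is_category[OF K assms(4)] .
  have F: "isotopy_functor K D F" if "F \<in> Obj ?C" for F
    using that K assms(4) by (simp add: isotopy_invariant_functor_cat_def isotopy_functor_def)
  have FG: "isotopy_functor_pair K D F G" if "F \<in> Obj ?C" "G \<in> Obj ?C" for F G
    using F that by (simp add: isotopy_functor_pair_def)
  have ArrC: "Arr ?C = monoidal_transformations K"
    and ArrD: "Arr ?D = (\<lambda>A B. {f \<in> linear_maps K A B. f \<in> ring_hom A B})"
    by (simp_all add: isotopy_invariant_functor_cat_def algebra_cat_def)
  show ?thesis
  proof (rule is_equivalenceI[OF C algebra_cat_is_category])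
    show "is_functor ?C ?D (functor_algebra K D) (\<lambda>F G \<alpha>. \<alpha> [D])"
      unfolding is_functor_def
    proof (intro conjI ballI)
      fix F assume "F \<in> Obj ?C"
      then show "functor_algebra K D F \<in> Obj ?D"
        using isotopy_functor.unital_assoc_algebra[OF F] by (simp add: algebra_cat_def)
      show "Ident ?C F [D] = Ident ?D (functor_algebra K D F)"
        using assms(4) by (simp add: isotopy_invariant_functor_cat_def algebra_cat_def functor_algebra_def)
    next
      fix F G \<alpha> assume "F \<in> Obj ?C" "G \<in> Obj ?C" "\<alpha> \<in> Arr ?C F G"
      then show "\<alpha> [D] \<in> Arr ?D (functor_algebra K D F) (functor_algebra K D G)"
        using isotopy_functor_pair.transformation_algebra_hom[OF FG] by (simp add: ArrC ArrD)
    next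
      fix F \<alpha> \<beta>
      show "Comp ?C F \<beta> \<alpha> [D] = Comp ?D (functor_algebra K D F) (\<beta> [D]) (\<alpha> [D])"
        using assms(4) by (simp add: isotopy_invariant_functor_cat_def algebra_cat_def functor_algebra_def)
    qed
  next
    fix F G \<alpha> \<beta> assume "F \<in> Obj ?C" "G \<in> Obj ?C" "\<alpha> \<in> Arr ?C F G" "\<beta> \<in> Arr ?C F G" "\<alpha> [D] = \<beta> [D]"
    then show "\<alpha> = \<beta>" using isotopy_functor_pair.faithful[OF FG] by (simp add: ArrC)
  next
    fix F G h assume "F \<in> Obj ?C" "G \<in> Obj ?C" "h \<in> Arr ?D (functor_algebra K D F) (functor_algebra K D G)"
    then show "\<exists>\<alpha>\<in>Arr ?C F G. \<alpha> [D] = h" using isotopy_functor_pair.full[OF FG] by (simp add: ArrC ArrD)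
  next
    fix A assume "A \<in> Obj ?D"
    then have A: "unital_assoc_algebra K A" by (simp add: algebra_cat_def)
    then have "\<forall>n. \<exists>T g. tensor_power K A n T g"
      using tensor_power_exists[OF _ assms(2,3)] unfolding unital_assoc_algebra_def by blast
    then obtain T g where T: "\<And>n. tensor_power K A n (T n) (g n)" by metis
    interpret algebra_tensor_powers K A T g by unfold_locales (fact A T assms(2,3))+
    have "algebra_functor \<in> Obj ?C"
      using algebra_functor_sm algebra_functor_isotopy_invariant by (simp add: isotopy_invariant_functor_cat_def)
    then show "\<exists>F\<in>Obj ?C. \<exists>u. is_iso ?D (functor_algebra K D F) A u"
      using functor_algebra_iso[OF assms(4)] by blast
  qed
qed

end
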